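(* Let $q\in\mathbb{C}\setminus\{0\}$, $\delta=q+q^{-1}$, and, if $q$ is a root of unity, let $l$ be the smallest positive integer with $q^{2l}=1$. Let $w,w'$ be infinite link states. (1) The $TL_\infty(\delta)$ representations $\mathcal{X}(w)$ and $\mathcal{X}(w')$ are isomorphic if and only if $w$ and $w'$ are equivalent. (2) If the irreducible quotients $\mathcal{L}(w)$ and $\mathcal{L}(w')$ are non-trivial (i.e. nonzero), then they are isomorphic if and only if $w$ and $w'$ are equivalent, or $l=3$ and $s(w),s(w')\in\{0,1\}$.
   Context: $TL_\infty(\delta)$ is the unital associative $\mathbb{C}$-algebra generated by $\mathbf{1}$ and $e_i$, $i\in\mathbb{N}=\{1,2,\dots\}$, with relations $e_i^2=\delta e_i$, $e_ie_{i\pm1}e_i=e_i$, $e_ie_j=e_je_i$ for $|i-j|>1$; $TL_n(\delta)$ is the algebra generated by $1,e_1,\dots,e_{n-1}$ with the same relations. An $(n,p)$-link state is a configuration on the points $1,\dots,n$ with $p$ cups (each joining two points) and $n-2p$ strings (each attached to a single point), non-intersecting: no two cups cross and no string point lies strictly between the endpoints of a cup. $\mathcal{V}_{n,p}$ is the $TL_n(\delta)$ representation with basis the $(n,p)$-link states, acting by diagram concatenation (closed loops replaced by $\delta$; result zero if the number of cups increases). $\langle x,y\rangle$ is the bilinear form on $\mathcal{V}_{n,p}$ given on link states by reflecting $x$ and gluing it to $y$: it is $0$ unless every string of $x$ is connected to a string of $y$, and otherwise equals $\delta^{k}$, $k$ being the number of closed loops. $\mathcal{R}_{n,p}=\{x\in\mathcal{V}_{n,p}:\langle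 x,y\rangle=0\ \forall y\in\mathcal{V}_{n,p}\}$. An infinite link state is the analogous non-intersecting configuration of cups and strings on the points $1,2,3,\dots$ (each point on exactly one cup or string; no string point strictly between endpoints of a cup). $s(w)\in\mathbb{N}\cup\{0,\infty\}$ is the number of strings. $TL_\infty(\delta)$ acts on the span of all infinite link states by concatenation: $e_iw=0$ if $i,i+1$ are both strings; $e_iw=\delta w$ if $i,i+1$ are joined; if exactly one of $i,i+1$ is a string and the other is joined to $b$, then $e_iw$ has cup $\{i,i+1\}$ and $b$ a string; if $i$ is joined to $a\ne i+1$ and $i+1$ to $b$, these cups are replaced by $\{i,i+1\},\{a,b\}$. $\mathcal{X}(w)$ is the subrepresentation generated by $w$. The restriction of an infinite link state to length $n$ deletes all points greater than $n$; if this would cut a cup, one instead restricts to the smallest $n'>n$ for which no cup is cut. Two infinite link states are equivalent if they differ at only finitely many points (only finitely many points have different connections) and there is $n$ such that for all $m\ge n$ their restrictions to length $m$ lie in the same space $\mathcal{V}_{m',p}$. An element of $\mathcal{X}(w)$ is a finite linear combination of link states that agree beyond some point, and is restricted, for $n$ large enough, term by term. $\mathcal{R}(w)=\{x\in\mathcal{X}(w):$ there is $n$ such that $x$ restricts to an element of $\mathcal{R}_{n',p}$ for all $n'\ge n\}$ ($p$ depending on $n'$), a subrepresentation of $\mathcal{X}(w)$, and $\mathcal{L}(w)=\mathcal{X}(w)/\mathcal{R}(w)$. *)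

theory Defs
  imports
    Complex_Main
    "HOL-Library.Poly_Mapping"
    "HOL-Library.Extended_Nat"
    "HOL-Algebra.QuotRing"
    "HOL-Algebra.Module"
begin

text \<open>
  Points and generators are numbered from 0. The points are 0, 1, 2, ..., and the
  generator \<open>e\<^sub>i\<close> acts on the points \<open>i\<close> and \<open>Suc i\<close>.
  Vector spaces with a given basis are spaces of finitely supported functions, i.e. of type
  \<open>'b \<Rightarrow>\<^sub>0 complex\<close>.
\<close>

definition scl :: "complex \<Rightarrow> ('b \<Rightarrow>\<^sub>0 complex) \<Rightarrow> 'b \<Rightarrow>\<^sub>0 complex" where
  "scl c x = Poly_Mapping.map ((*) c) x"

definition lin_ext :: "('b \<Rightarrow> 'd \<Rightarrow>\<^sub>0 complex) \<Rightarrow> ('b \<Rightarrow>\<^sub>0 complex) \<Rightarrow> 'd \<Rightarrow>\<^sub>0 complex" where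
  "lin_ext f x = (\<Sum>b\<in>Poly_Mapping.keys x. scl (Poly_Mapping.lookup x b) (f b))"

section \<open>The infinite Temperley-Lieb algebra\<close>

datatype tl_word = Word (letters: "nat list")

instantiation tl_word :: monoid_add
begin

definition "0 = Word []"
definition "u + v = Word (letters u @ letters v)"

instance
  by standard (auto simp: zero_tl_word_def plus_tl_word_def)

end

text \<open>
  The multiplication of \<open>'a \<Rightarrow>\<^sub>0 'b\<close> is convolution with respect to the addition on \<open>'a\<close>;
  hence the following is the free unital complex algebra on the letters 0, 1, 2, ...
\<close>

type_synonym free_alg = "tl_word \<Rightarrow>\<^sub>0 complex"

definition free_ring :: "free_alg ring" where
  "free_ring = \<lparr>carrier = UNIV, mult = (*), one = 1, zero = 0, add = (+)\<rparr>"

definition gen :: "nat \<Rightarrow> free_alg" where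
  "gen i = Poly_Mapping.single (Word [i]) 1"

definition tl_relators :: "complex \<Rightarrow> free_alg set" where
  "tl_relators \<delta> =
     {gen i * gen i - scl \<delta> (gen i) | i. True}
   \<union> {gen i * gen (Suc i) * gen i - gen i | i. True}
   \<union> {gen (Suc i) * gen i * gen (Suc i) - gen (Suc i) | i. True}
   \<union> {gen i * gen j - gen j * gen i | i j. Suc i < j \<or> Suc j < i}"

definition TL :: "complex \<Rightarrow> free_alg set ring" where
  "TL \<delta> = free_ring Quot (genideal free_ring (tl_relators \<delta>))"

section \<open>Representations\<close>

text \<open>
  A representation of a unital complex algebra \<open>R\<close> is a left \<open>R\<close>-module; complex scalars act
  through their image in \<open>R\<close>, so that \<open>R\<close>-module homomorphisms are automatically linear.
  The record type of modules is the one of the library, whose ring multiplication fields are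
  irrelevant for modules. The library locale for modules requires a commutative ring and does
  not apply, but its notion of submodule makes sense over any ring.
\<close>

definition submodule_gen ::
    "('r, 's) ring_scheme \<Rightarrow> ('r, 'v, 't) module_scheme \<Rightarrow> 'v set \<Rightarrow> 'v set" where
  "submodule_gen R M S = \<Inter>{N. submodule N R M \<and> S \<subseteq> N}"

definition quot_module :: "('r, 'v, 't) module_scheme \<Rightarrow> 'v set \<Rightarrow> ('r, 'v set) module" where
  "quot_module M N =
     \<lparr>carrier = a_rcosets\<^bsub>M\<^esub> N, mult = undefined, one = undefined, zero = N,
      add = set_add M, smult = (\<lambda>a C. \<Union>x\<in>C. N +>\<^bsub>M\<^esub> (a \<odot>\<^bsub>M\<^esub> x))\<rparr>"

definition module_iso ::
    "('r, 's) ring_scheme \<Rightarrow> ('r, 'v, 't) module_scheme \<Rightarrow> ('r, 'w, 'u) module_scheme \<Rightarrow> bool" where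
  "module_iso R M N \<longleftrightarrow>
     (\<exists>h \<in> iso (add_monoid M) (add_monoid N).
        \<forall>a\<in>carrier R. \<forall>x\<in>carrier M. h (a \<odot>\<^bsub>M\<^esub> x) = a \<odot>\<^bsub>N\<^esub> h x)"

section \<open>Link states\<close>

text \<open>
  A link state on a set \<open>S\<close> of points is encoded as the involution of \<open>S\<close> that swaps the two
  endpoints of each cup and fixes the points carrying a string.
\<close>

definition link_state_on :: "nat set \<Rightarrow> (nat \<Rightarrow> nat) \<Rightarrow> bool" where
  "link_state_on S c \<longleftrightarrow>
     (\<forall>i\<in>S. c i \<in> S \<and> c (c i) = i) \<and>
     \<not> (\<exists>i\<in>S. \<exists>j\<in>S. i < j \<and> j < c i \<and> c i < c j) \<and>
     \<not> (\<exists>i\<in>S. \<exists>j\<in>S. i < j \<and> j < c i \<and> c j = j)"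

type_synonym fin_link = "nat list"
type_synonym inf_link = "nat \<Rightarrow> nat"

definition link_states :: "nat \<Rightarrow> nat \<Rightarrow> fin_link set" where
  "link_states n p =
     {x. length x = n \<and> link_state_on {..<n} ((!) x) \<and> card {i. i < n \<and> i < x ! i} = p}"

definition inf_link_states :: "inf_link set" where
  "inf_link_states = {w. link_state_on UNIV w}"

definition num_strings :: "inf_link \<Rightarrow> enat" where
  "num_strings w = (if finite {i. w i = i} then enat (card {i. w i = i}) else \<infinity>)"

section \<open>The bilinear form on finite link states and its radical\<close>

definition V :: "nat \<Rightarrow> nat \<Rightarrow> (fin_link \<Rightarrow>\<^sub>0 complex) set" where
  "V n p = {x. Poly_Mapping.keys x \<subseteq> link_states n p}"

text \<open>
  Gluing the reflection of \<open>x\<close> to \<open>y\<close> identifies their points. The connected components of the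
  resulting picture correspond to the components of the points under the cups of \<open>x\<close> and \<open>y\<close>,
  and a component is a closed loop iff no string of \<open>x\<close> or \<open>y\<close> is attached to it.
\<close>

definition glued :: "fin_link \<Rightarrow> fin_link \<Rightarrow> (nat \<times> nat) set" where
  "glued x y = {(i, j). i < length x \<and> (j = x ! i \<or> j = y ! i)}\<^sup>*"

definition num_loops :: "fin_link \<Rightarrow> fin_link \<Rightarrow> nat" where
  "num_loops x y =
     card {C. \<exists>i<length x. C = glued x y `` {i} \<and> (\<forall>j\<in>C. x ! j \<noteq> j \<and> y ! j \<noteq> j)}"

definition link_form :: "complex \<Rightarrow> fin_link \<Rightarrow> fin_link \<Rightarrow> complex" where
  "link_form \<delta> x y =
     (if \<forall>i<length x. x ! i = i \<longrightarrow> (\<exists>j. (i, j) \<in> glued x y \<and> y ! j = j)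
      then \<delta> ^ num_loops x y else 0)"

definition bilin_form ::
    "complex \<Rightarrow> (fin_link \<Rightarrow>\<^sub>0 complex) \<Rightarrow> (fin_link \<Rightarrow>\<^sub>0 complex) \<Rightarrow> complex" where
  "bilin_form \<delta> x y =
     (\<Sum>u\<in>Poly_Mapping.keys x. \<Sum>v\<in>Poly_Mapping.keys y. Poly_Mapping.lookup x u * Poly_Mapping.lookup y v * link_form \<delta> u v)"

definition radical :: "complex \<Rightarrow> nat \<Rightarrow> nat \<Rightarrow> (fin_link \<Rightarrow>\<^sub>0 complex) set" where
  "radical \<delta> n p = {x \<in> V n p. \<forall>y \<in> V n p. bilin_form \<delta> x y = 0}"

section \<open>The action on infinite link states\<close>

type_synonym inf_vec = "inf_link \<Rightarrow>\<^sub>0 complex"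

definition e_link :: "complex \<Rightarrow> nat \<Rightarrow> inf_link \<Rightarrow> inf_vec" where
  "e_link \<delta> i w =
     (if w i = i \<and> w (Suc i) = Suc i then 0
      else if w i = Suc i then scl \<delta> (Poly_Mapping.single w 1)
      else if w i = i then
        (let b = w (Suc i) in Poly_Mapping.single (w(b := b, i := Suc i, Suc i := i)) 1)
      else if w (Suc i) = Suc i then
        (let b = w i in Poly_Mapping.single (w(b := b, i := Suc i, Suc i := i)) 1)
      else
        (let a = w i; b = w (Suc i)
         in Poly_Mapping.single (w(a := b, b := a, i := Suc i, Suc i := i)) 1))"

definition word_act :: "complex \<Rightarrow> tl_word \<Rightarrow> inf_vec \<Rightarrow> inf_vec" where
  "word_act \<delta> u = foldr (\<lambda>i. lin_ext (e_link \<delta> i)) (letters u)"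

definition free_act :: "complex \<Rightarrow> free_alg \<Rightarrow> inf_vec \<Rightarrow> inf_vec" where
  "free_act \<delta> a x = (\<Sum>u\<in>Poly_Mapping.keys a. scl (Poly_Mapping.lookup a u) (word_act \<delta> u x))"

text \<open>
  The elements of \<^term>\<open>carrier (TL \<delta>)\<close> are cosets; as the generators satisfy the relations on the
  span of the infinite link states, all members of a coset act in the same way.
\<close>

definition link_module :: "complex \<Rightarrow> (free_alg set, inf_vec) module" where
  "link_module \<delta> =
     \<lparr>carrier = {x. Poly_Mapping.keys x \<subseteq> inf_link_states}, mult = undefined, one = undefined,
      zero = 0, add = (+), smult = (\<lambda>A x. the_elem ((\<lambda>a. free_act \<delta> a x) ` A))\<rparr>"

definition X :: "complex \<Rightarrow> inf_link \<Rightarrow> (free_alg set, inf_vec) module" where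
  "X \<delta> w = (link_module \<delta>)
     \<lparr>carrier := submodule_gen (TL \<delta>) (link_module \<delta>) {Poly_Mapping.single w 1}\<rparr>"

section \<open>Restriction, equivalence and the quotient\<close>

definition restr_length :: "inf_link \<Rightarrow> nat \<Rightarrow> nat" where
  "restr_length w n = (LEAST m. n \<le> m \<and> (\<forall>i<m. w i < m))"

definition restr :: "inf_link \<Rightarrow> nat \<Rightarrow> fin_link" where
  "restr w n = map w [0..<restr_length w n]"

definition link_equiv :: "inf_link \<Rightarrow> inf_link \<Rightarrow> bool" where
  "link_equiv w w' \<longleftrightarrow>
     finite {i. w i \<noteq> w' i} \<and>
     (\<exists>n. \<forall>m\<ge>n. \<exists>m' p. restr w m \<in> link_states m' p \<and> restr w' m \<in> link_states m' p)"

definition restr_vec :: "inf_vec \<Rightarrow> nat \<Rightarrow> (fin_link \<Rightarrow>\<^sub>0 complex)" where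
  "restr_vec x n = lin_ext (\<lambda>u. Poly_Mapping.single (restr u n) 1) x"

definition inf_radical :: "complex \<Rightarrow> inf_link \<Rightarrow> inf_vec set" where
  "inf_radical \<delta> w =
     {x \<in> carrier (X \<delta> w). \<exists>n. \<forall>m\<ge>n. \<exists>m' p. restr_vec x m \<in> radical \<delta> m' p}"

definition L :: "complex \<Rightarrow> inf_link \<Rightarrow> (free_alg set, inf_vec set) module" where
  "L \<delta> w = quot_module (X \<delta> w) (inf_radical \<delta> w)"

end

theory Submission
  imports Defs
begin

text \<open>
  A word in the generators maps a link state to a power of \<open>\<delta>\<close> times a link state, or to 0, so the
  action can be studied through words and states (\<open>wact\<close>). Call a state canonical on a closed interval
  if it consists there of flat cups \<open>{a, a+1}, {a+2, a+3}, ...\<close> followed by strings. On a closed interval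
  every state is moved to a canonical one, and from there to every other state with as many strings, by
  generators that never meet a closed loop (\<open>reach_canon\<close>, \<open>reach_from_canon\<close>). Hence \<open>X(w)\<close> is the span of the
  states equivalent to \<open>w\<close>, and each of these generates it.

  Representations \<open>X\<close>. For each cup of \<open>w\<close> some word fixes \<open>w\<close> and has only states with that cup in its
  image (\<open>cup_projector\<close>). An isomorphism maps \<open>w\<close> to a finite combination \<open>x'\<close> of states that agree with
  \<open>w'\<close> beyond some point. The same words fix \<open>x'\<close>, so \<open>w'\<close> has all far cups of \<open>w\<close>, and by symmetry \<open>w\<close>
  has those of \<open>w'\<close>. A word that imposes flat cups on an initial interval compares the numbers of
  strings there.

  Representations \<open>L\<close>. The generators are self-adjoint for the form (\<open>form_adjoint\<close>), so \<open>R(w)\<close> is a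
  subrepresentation, and pairing with a state is realised by a word: a vector outside \<open>R(w)\<close> is mapped
  by a word to a nonzero multiple of a state, and this word kills all states with more strings
  (\<open>extraction\<close>). Let an isomorphism map the class of \<open>w\<close> to that of \<open>x'\<close>. If the tails of \<open>w\<close> and \<open>w'\<close> agree,
  the extracting word rules out that \<open>w\<close> has more strings. Otherwise one of them, say \<open>w\<close>, has infinitely
  many cups that the other lacks. The words projecting to far cups commute with an extracting word, so
  they produce two distinct states, equal on a long initial interval, that agree up to a nonzero scalar
  modulo \<open>R(w')\<close> (\<open>twist\<close>). This congruence is respected by the generators, and no generator can kill
  exactly one of two congruent states.

  If the common initial part has two strings, a string of one of the states can be moved next to the
  other string and killed there, while the other state survives (\<open>two_strings_clash\<close>). If \<open>w'\<close> has at most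
  one string, the generators turn the two states into states with overlapping cups \<open>{i, i+1}\<close> and
  \<open>{i+1, i+2}\<close>; applying \<open>e\<^sub>i\<close> and \<open>e\<^sub>i e\<^sub>i\<^sub>+\<^sub>1\<close> to both then gives \<open>\<delta>\<^sup>2 = 1\<close> (\<open>cong_overlap\<close>), which says \<open>l = 3\<close>.
  Conversely, for \<open>\<delta>\<^sup>2 = 1\<close> and at most one string, a sign on link states defines a linear functional on
  which every generator acts by \<open>\<delta>\<close>. Its kernel is \<open>R(w)\<close>, so that \<open>L(w)\<close> is the same one-dimensional
  representation for all such \<open>w\<close>.
\<close>

section \<open>Link states and the generators\<close>

lemma inf_link_states_iff:
  "u \<in> inf_link_states \<longleftrightarrow>
     (\<forall>i. u (u i) = i) \<and> (\<forall>a b. a < b \<and> b < u a \<longrightarrow> a < u b \<and> u b < u a \<and> u b \<noteq> b)"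
proof
  assume u: "u \<in> inf_link_states"
  then have inv: "u (u i) = i" for i
    by (simp add: inf_link_states_def link_state_on_def)
  have no: "\<not> (i < j \<and> j < u i \<and> u i < u j)" "\<not> (i < j \<and> j < u i \<and> u j = j)" for i j
    using u by (auto simp: inf_link_states_def link_state_on_def)
  show "(\<forall>i. u (u i) = i) \<and> (\<forall>a b. a < b \<and> b < u a \<longrightarrow> a < u b \<and> u b < u a \<and> u b \<noteq> b)"
  proof (intro conjI allI impI; (elim conjE)?)
    fix a b assume ab: "a < b" "b < u a"
    have "u b \<noteq> u a" using inv ab by (metis less_irrefl)
    then show "u b < u a" using no(1)[of a b] ab by linarith
    have "u b \<noteq> a" using inv ab by (metis less_irrefl)
    then show "a < u b" using no(1)[of "u b" a] ab by (auto simp: inv)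
    show "u b \<noteq> b" using no(2) ab by blast
  qed (rule inv)
next
  assume "(\<forall>i. u (u i) = i) \<and> (\<forall>a b. a < b \<and> b < u a \<longrightarrow> a < u b \<and> u b < u a \<and> u b \<noteq> b)"
  then show "u \<in> inf_link_states"
    unfolding inf_link_states_def link_state_on_def mem_Collect_eq
    by (metis UNIV_I less_asym)
qed

lemma link_inv: "u \<in> inf_link_states \<Longrightarrow> u (u i) = i"
  by (simp add: inf_link_states_iff)

lemma link_eq_iff: "u \<in> inf_link_states \<Longrightarrow> u i = u j \<longleftrightarrow> i = j"
  by (metis link_inv)

lemma link_nest:
  assumes "u \<in> inf_link_states" "a < b" "b < u a"
  shows "a < u b" "u b < u a" "u b \<noteq> b"
  using assms by (auto simp: inf_link_states_iff)

definition both_strings :: "nat \<Rightarrow> inf_link \<Rightarrow> bool" where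
  "both_strings i u \<longleftrightarrow> u i = i \<and> u (Suc i) = Suc i"

text \<open>
  The link state that remains after \<open>e\<^sub>i\<close>, for all cases in one formula: the former partners of \<open>i\<close> and
  \<open>Suc i\<close> are joined, and if one of the two points was a string, the other partner becomes a string.
  A fixed point encodes a string, so reading a partner off directly would be wrong in that case.
\<close>

definition E :: "nat \<Rightarrow> inf_link \<Rightarrow> inf_link" where
  "E i u k =
     (if k = i then Suc i else if k = Suc i then i
      else if u k = i then (if u (Suc i) = Suc i then k else u (Suc i))
      else if u k = Suc i then (if u i = i then k else u i)
      else u k)"

lemma E_cup [simp]: "E i u i = Suc i" "E i u (Suc i) = i"
  by (simp_all add: E_def)

lemma E_loop:
  assumes "u \<in> inf_link_states" "u i = Suc i"
  shows "E i u = u"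
proof
  fix k show "E i u k = u k"
    using assms(2) link_inv[OF assms(1), of k] link_inv[OF assms(1), of i] unfolding E_def
    by (auto split: if_splits)
qed

lemma e_link_E:
  assumes u: "u \<in> inf_link_states"
  shows "e_link \<delta> i u =
    (if both_strings i u then 0 else Poly_Mapping.single (E i u) (if u i = Suc i then \<delta> else 1))"
proof -
  note inv = link_inv[OF u]
  consider "both_strings i u" | "\<not> both_strings i u" "u i = Suc i" | "\<not> both_strings i u" "u i = i"
    | "\<not> both_strings i u" "u i \<noteq> i" "u i \<noteq> Suc i" "u (Suc i) = Suc i"
    | "\<not> both_strings i u" "u i \<noteq> i" "u i \<noteq> Suc i" "u (Suc i) \<noteq> Suc i"
    by blast
  then show ?thesis
  proof cases
    case 1 then show ?thesis by (auto simp: e_link_def both_strings_def)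
  next
    case 2
    have "scl \<delta> (Poly_Mapping.single u 1) = Poly_Mapping.single u \<delta>"
      by (simp add: scl_def map_single)
    with 2 show ?thesis by (simp add: e_link_def both_strings_def E_loop[OF u])
  next
    case 3
    have "u(u (Suc i) := u (Suc i), i := Suc i, Suc i := i) = E i u"
      by (rule ext, use 3 inv[of i] inv[of "Suc i"] inv in \<open>simp add: E_def both_strings_def\<close>)
        (metis inv)
    with 3 show ?thesis by (simp add: e_link_def both_strings_def Let_def)
  next
    case 4
    have "u(u i := u i, i := Suc i, Suc i := i) = E i u"
      by (rule ext, use 4 inv[of i] inv[of "Suc i"] inv in \<open>simp add: E_def both_strings_def\<close>)
        (metis inv)
    with 4 show ?thesis by (simp add: e_link_def both_strings_def Let_def)
  next
    case 5
    have "u(u i := u (Suc i), u (Suc i) := u i, i := Suc i, Suc i := i) = E i u"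
      by (rule ext, use 5 inv[of i] inv[of "Suc i"] inv in \<open>simp add: E_def both_strings_def\<close>)
        (metis inv)
    with 5 show ?thesis by (simp add: e_link_def both_strings_def Let_def)
  qed
qed

lemma E_inv:
  assumes u: "u \<in> inf_link_states" and "\<not> both_strings i u"
  shows "E i u (E i u k) = k"
proof -
  note inv = link_inv[OF u] link_eq_iff[OF u]
  show ?thesis
    using assms(2) inv[of i] inv[of "Suc i"] inv[of k] unfolding E_def both_strings_def
    by (smt (verit) inv n_not_Suc_n)
qed

text \<open>
  Planarity survives because \<open>i\<close> and \<open>Suc i\<close> are neighbours: a cup that contains one of them also
  contains the other, or ends at it, so the new cup joins points on the same side of every other cup.
\<close>

lemma E_nest:
  assumes u: "u \<in> inf_link_states" and "\<not> both_strings i u" and "a < b" "b < E i u a"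
  shows "a < E i u b \<and> E i u b < E i u a \<and> E i u b \<noteq> b"
proof -
  note inv = link_inv[OF u]
  note nest = link_nest[OF u]
  have a: "a \<noteq> i" "a \<noteq> Suc i" using assms by (auto simp: E_def split: if_splits)
  show ?thesis
  proof (cases "b = i \<or> b = Suc i")
    case True
    have "E i u a \<noteq> i" "E i u a \<noteq> Suc i"
      using a E_inv[OF assms(1,2), of a] by (metis E_cup)+
    with True a assms show ?thesis by (auto simp: E_def)
  next
    case False
    have ne: "u a \<noteq> u b" "u i \<noteq> u (Suc i)" "u b \<noteq> u i" "u b \<noteq> u (Suc i)"
      using link_eq_iff[OF u] a False assms(3) by auto
    consider "u a \<noteq> i" "u a \<noteq> Suc i" | "u a = i" | "u a = Suc i" by blast
    then show ?thesis
    proof cases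
      case 1
      then have Ea: "E i u a = u a" using a by (simp add: E_def)
      then have ab: "b < u a" using assms(4) by simp
      note n = nest[OF assms(3) ab]
      consider "u b \<noteq> i" "u b \<noteq> Suc i" | "u b = i" | "u b = Suc i" by blast
      then show ?thesis
      proof cases
        case 1 then show ?thesis using n False Ea by (simp add: E_def)
      next
        case 2
        then have "a < Suc i" "Suc i < u a" using n 1 by auto
        note m = nest[OF this]
        have "u (Suc i) \<noteq> b" using 2 inv[of "Suc i"] by auto
        then show ?thesis using m False Ea 2 by (simp add: E_def)
      next
        case 3
        then have "a < i" "i < u a" using n a by auto
        note m = nest[OF this]
        have "u i \<noteq> b" using 3 inv[of i] by auto
        then show ?thesis using m False Ea 3 by (simp add: E_def)
      qed
    next
      case 2
      then have p: "u i = a" using inv[of a] by simp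
      then have s: "u (Suc i) \<noteq> Suc i" "E i u a = u (Suc i)" "b < u (Suc i)"
        using assms(3,4) a 2 by (auto simp: E_def split: if_splits)
      have "u b \<noteq> i" "u b \<noteq> Suc i" using ne(1) 2 s(3) inv[of b] by auto
      then have Eb: "E i u b = u b" using False by (simp add: E_def)
      have "a < i"
      proof (rule ccontr)
        assume "\<not> a < i"
        then have "Suc i < u i" using p a by simp
        then show False using nest(2)[of i "Suc i"] p assms(3) s by simp
      qed
      have "u (Suc i) \<noteq> i" using p a(2) inv[of "Suc i"] by auto
      then have "i < u (Suc i)"
        using nest(2)[of a "u (Suc i)"] assms(3) s inv 2 by (metis Suc_lessD less_trans linorder_neqE_nat not_less_eq order_less_irrefl)
      then have "Suc i < u (Suc i)" using s by simp
      show ?thesis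
      proof (cases "b < i")
        case True
        then show ?thesis using nest[of a b] assms(3) 2 Eb s \<open>i < u (Suc i)\<close> by auto
      next
        case f: False
        then have "Suc i < b" using False by simp
        then show ?thesis using nest[of "Suc i" b] s Eb assms(3) \<open>a < i\<close> by simp
      qed
    next
      case 3
      then have s: "u (Suc i) = a" using inv[of a] by simp
      then have p: "u i \<noteq> i" "E i u a = u i" "b < u i"
        using assms(3,4) a 3 by (auto simp: E_def split: if_splits)
      have B: "u b \<noteq> i" "u b \<noteq> Suc i" using ne(1) 3 p(3) inv[of b] by auto
      then have Eb: "E i u b = u b" using False by (simp add: E_def)
      show ?thesis
      proof (cases "a < i")
        case True
        then have ap: "a < u i" "u i < i" using nest[of a i] 3 p by auto
        then have n: "a < u b" "u b < Suc i" "u b \<noteq> b" using nest[of a b] 3 assms(3) p by auto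
        have "u b < u i"
        proof (rule ccontr)
          assume "\<not> u b < u i"
          then have "u i < u b" "u b < u (u i)" using ne n B inv by auto
          then show False using nest(1)[of "u i" "u b"] inv p by simp
        qed
        then show ?thesis using n Eb p by simp
      next
        case f: False
        then have ia: "Suc i < a" using a by simp
        then have n: "i < u b" "u b < u i" "u b \<noteq> b" using nest[of i b] assms(3) p by auto
        have "u b \<noteq> a" using 3 inv[of b] False by auto
        moreover have "\<not> u b < a"
        proof
          assume "u b < a"
          then have "Suc i < u b" "u b < u (Suc i)" using n s B by auto
          then show False using nest(2)[of "Suc i" "u b"] inv s assms(3) by simp
        qed
        ultimately show ?thesis using n Eb p by simp
      qed
    qed
  qed
qed

lemma E_states:
  assumes "u \<in> inf_link_states" "\<not> both_strings i u"
  shows "E i u \<in> inf_link_states"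
  unfolding inf_link_states_iff
  using E_inv[OF assms] E_nest[OF assms] by blast

section \<open>Moving between link states on a closed interval\<close>

text \<open>
  No cup crosses a boundary of the interval from \<open>a\<close> to \<open>b - 1\<close>; strings are allowed.
\<close>

definition closed_ivl :: "nat \<Rightarrow> nat \<Rightarrow> inf_link \<Rightarrow> bool" where
  "closed_ivl a b u \<longleftrightarrow> (\<forall>k. a \<le> k \<and> k < b \<longrightarrow> a \<le> u k \<and> u k < b)"

definition strs :: "nat \<Rightarrow> nat \<Rightarrow> inf_link \<Rightarrow> nat" where
  "strs a b u = card {k. a \<le> k \<and> k < b \<and> u k = k}"

definition flat :: "nat \<Rightarrow> nat \<Rightarrow> inf_link \<Rightarrow> bool" where
  "flat a p u \<longleftrightarrow> (\<forall>k<p. u (a + 2 * k) = Suc (a + 2 * k) \<and> u (Suc (a + 2 * k)) = a + 2 * k)"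

definition canon :: "nat \<Rightarrow> nat \<Rightarrow> nat \<Rightarrow> inf_link \<Rightarrow> bool" where
  "canon a b p u \<longleftrightarrow> a + 2 * p \<le> b \<and> flat a p u \<and> (\<forall>k. a + 2 * p \<le> k \<and> k < b \<longrightarrow> u k = k)"

text \<open>
  A generator that neither meets two strings nor closes a loop: it maps the state to a state, with
  coefficient 1 for every value of \<open>\<delta>\<close>.
\<close>

definition step :: "nat \<Rightarrow> nat \<Rightarrow> inf_link \<Rightarrow> inf_link \<Rightarrow> bool" where
  "step a b u v \<longleftrightarrow> (\<exists>i. a \<le> i \<and> Suc i < b \<and> u i \<noteq> Suc i \<and> \<not> both_strings i u \<and> v = E i u)"

abbreviation reach :: "nat \<Rightarrow> nat \<Rightarrow> inf_link \<Rightarrow> inf_link \<Rightarrow> bool" where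
  "reach a b \<equiv> (step a b)\<^sup>*\<^sup>*"

lemma closed_ivl_inv:
  assumes "u \<in> inf_link_states" "closed_ivl a b u"
  shows "a \<le> u k \<and> u k < b \<longleftrightarrow> a \<le> k \<and> k < b"
  using assms link_inv[OF assms(1)] unfolding closed_ivl_def by metis

lemma reach_E:
  assumes "u \<in> inf_link_states" "a \<le> i" "Suc i < b" "\<not> both_strings i u"
  shows "reach a b u (E i u)"
proof (cases "u i = Suc i")
  case True then show ?thesis using E_loop assms by simp
next
  case False
  then have "step a b u (E i u)" using assms by (auto simp: step_def)
  then show ?thesis by (rule r_into_rtranclp[where r = "step a b"])
qed

lemma reach_mono:
  assumes "reach a' b' u v" "a \<le> a'" "b' \<le> b"
  shows "reach a b u v"
proof -
  have "step a' b' v w \<Longrightarrow> step a b v w" for v w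
    using assms(2,3) unfolding step_def by (elim exE, rename_tac i, rule_tac x = i in exI) auto
  then have "step a' b' \<le> step a b" by blast
  then show ?thesis using assms(1) rtranclp_mono by blast
qed

lemma E_outside:
  assumes u: "u \<in> inf_link_states" and c: "closed_ivl a b u" and i: "a \<le> i" "Suc i < b"
    and k: "\<not> (a \<le> k \<and> k < b)"
  shows "E i u k = u k"
  using closed_ivl_inv[OF u c, of k] i k by (auto simp: E_def)

lemma E_closed:
  assumes "u \<in> inf_link_states" "closed_ivl a b u" "a \<le> i" "Suc i < b"
  shows "closed_ivl a b (E i u)"
  using assms unfolding closed_ivl_def E_def by auto

lemma card_swap:
  assumes "finite A" "x \<notin> A" "y \<in> A"
  shows "card (insert x (A - {y})) = card A"
proof -
  have "card A > 0" using assms by (auto simp: card_gt_0_iff)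
  then show ?thesis using assms by simp
qed

text \<open>
  If one of the two points carries a string, the string moves to the former partner of the other.
\<close>

lemma strs_E:
  assumes u: "u \<in> inf_link_states" and d: "\<not> both_strings i u" and c: "closed_ivl a b u" and i: "a \<le> i" "Suc i < b"
  shows "strs a b (E i u) = strs a b u"
proof -
  let ?A = "\<lambda>u. {k. a \<le> k \<and> k < b \<and> u k = k}"
  have fin: "finite (?A u)" by (rule finite_subset[of _ "{..<b}"]) auto
  note inv = link_inv[OF u] link_eq_iff[OF u]
  note cl = closed_ivl_inv[OF u c]
  consider "u i = i" "u (Suc i) \<noteq> Suc i" | "u i \<noteq> i" "u (Suc i) = Suc i" | "u i \<noteq> i" "u (Suc i) \<noteq> Suc i"
    using d by (auto simp: both_strings_def)
  then show ?thesis
  proof cases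
    case 1
    have ne: "u (Suc i) \<noteq> i" using 1 inv by metis
    have "?A (E i u) = insert (u (Suc i)) (?A u - {i})"
    proof (rule Set.set_eqI)
      fix k show "k \<in> ?A (E i u) \<longleftrightarrow> k \<in> insert (u (Suc i)) (?A u - {i})"
      proof (cases "k = i \<or> k = Suc i")
        case True then show ?thesis using 1 ne by auto
      next
        case False
        then show ?thesis using 1 i ne cl[of k] inv(1)[of k] inv(1)[of "Suc i"] by (auto simp: E_def)
      qed
    qed
    moreover have "u (Suc i) \<notin> ?A u" "i \<in> ?A u" using 1 i inv(1)[of "Suc i"] by auto
    ultimately show ?thesis using card_swap[OF fin] by (simp only: strs_def)
  next
    case 2
    have ne: "u i \<noteq> Suc i" using 2 inv by metis
    have "?A (E i u) = insert (u i) (?A u - {Suc i})"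
    proof (rule Set.set_eqI)
      fix k show "k \<in> ?A (E i u) \<longleftrightarrow> k \<in> insert (u i) (?A u - {Suc i})"
      proof (cases "k = i \<or> k = Suc i")
        case True then show ?thesis using 2 ne by auto
      next
        case False
        then show ?thesis using 2 i ne cl[of k] inv(1)[of k] inv(1)[of i] by (auto simp: E_def)
      qed
    qed
    moreover have "u i \<notin> ?A u" "Suc i \<in> ?A u" using 2 i inv(1)[of i] by auto
    ultimately show ?thesis using card_swap[OF fin] by (simp only: strs_def)
  next
    case 3
    have "?A (E i u) = ?A u"
    proof (rule Set.set_eqI)
      fix k show "k \<in> ?A (E i u) \<longleftrightarrow> k \<in> ?A u"
        using 3 inv(2)[of i "Suc i"] inv(1)[of k] by (auto simp: E_def split: if_splits)
    qed
    then show ?thesis by (simp add: strs_def)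
  qed
qed

lemma reach_props:
  assumes "reach a b u v" "u \<in> inf_link_states" "closed_ivl a b u"
  shows "v \<in> inf_link_states \<and> closed_ivl a b v \<and> strs a b v = strs a b u \<and>
    (\<forall>k. \<not> (a \<le> k \<and> k < b) \<longrightarrow> v k = u k)"
  using assms
proof (induction rule: rtranclp_induct)
  case base then show ?case by simp
next
  case (step v w)
  then show ?case by (auto simp: step_def E_states E_closed strs_E E_outside)
qed

lemma reach_trans: "reach a b u v \<Longrightarrow> reach a b v w \<Longrightarrow> reach a b u w"
  by (rule rtranclp_trans)

text \<open>
  If \<open>k\<close> is the first point without a string, \<open>e\<^bsub>k-1\<^esub>\<close> replaces the string at \<open>k - 1\<close> by the left end of a
  cup, so that a cup travels to \<open>a\<close>.
\<close>

lemma move_cup_left: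
  assumes "u \<in> inf_link_states" "closed_ivl a b u" "a \<le> k" "k < b" "u k \<noteq> k"
    "\<forall>j. a \<le> j \<and> j < k \<longrightarrow> u j = j"
  shows "\<exists>v. reach a b u v \<and> v a = Suc a"
  using assms
proof (induction "k - a" arbitrary: k u)
  case 0
  then have "Suc a < b" using closed_ivl_inv[of u a b a] by (metis closed_ivl_inv diff_is_0_eq le_antisym le_neq_implies_less less_le_trans linorder_not_less not_less_eq order_refl)
  moreover have "\<not> both_strings a u" using 0 by (auto simp: both_strings_def)
  ultimately show ?case using reach_E[of u a a b] 0 E_cup(1) by blast
next
  case (Suc d)
  let ?i = "k - 1"
  have i: "a \<le> ?i" "Suc ?i = k" "Suc ?i < b" using Suc by auto
  have d: "\<not> both_strings ?i u" using Suc i by (auto simp: both_strings_def)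
  have "reach a b u (E ?i u)" using reach_E Suc i d by blast
  moreover have "\<exists>v. reach a b (E ?i u) v \<and> v a = Suc a"
  proof (rule Suc(1)[of ?i "E ?i u"])
    show "d = ?i - a" using Suc by simp
    show "E ?i u \<in> inf_link_states" "closed_ivl a b (E ?i u)"
      using E_states E_closed Suc d i by auto
    show "E ?i u ?i \<noteq> ?i" by simp
    show "\<forall>j. a \<le> j \<and> j < ?i \<longrightarrow> E ?i u j = j"
      using Suc(8) i by (auto simp: E_def)
  qed (use i Suc in auto)
  ultimately show ?case using reach_trans by blast
qed

lemma flat_Suc: "flat a (Suc p) u \<longleftrightarrow> u a = Suc a \<and> u (Suc a) = a \<and> flat (a + 2) p u"
proof -
  have "flat a (Suc p) u \<longleftrightarrow> u a = Suc a \<and> u (Suc a) = a \<and>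
    (\<forall>k<p. u (a + 2 * Suc k) = Suc (a + 2 * Suc k) \<and> u (Suc (a + 2 * Suc k)) = a + 2 * Suc k)"
    unfolding flat_def All_less_Suc2 by simp
  then show ?thesis by (simp add: flat_def)
qed

lemma closed_split_cup:
  assumes "u \<in> inf_link_states" "closed_ivl a b u" "u a = Suc a"
  shows "closed_ivl (a + 2) b u"
proof -
  have "u (Suc a) = a" using link_inv assms by metis
  then have "u k \<noteq> a" "u k \<noteq> Suc a" if "a + 2 \<le> k" for k
    using that assms link_inv[OF assms(1), of k] by auto
  with assms(2) show ?thesis unfolding closed_ivl_def
    by (metis Suc_leI add_2_eq_Suc' le_add1 le_neq_implies_less order_trans)
qed

text \<open>
  Once \<open>a\<close> and \<open>Suc a\<close> are joined, the rest of the interval is closed and the argument repeats there.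
\<close>

lemma reach_canon:
  assumes "u \<in> inf_link_states" "closed_ivl a b u" "a \<le> b"
  shows "\<exists>v p. reach a b u v \<and> canon a b p v"
  using assms
proof (induction "b - a" arbitrary: a u rule: less_induct)
  case less
  show ?case
  proof (cases "\<exists>k. a \<le> k \<and> k < b \<and> u k \<noteq> k")
    case False
    then have "canon a b 0 u" using less.prems(3) by (simp add: canon_def flat_def)
    then show ?thesis by blast
  next
    case True
    define k where "k = (LEAST k. a \<le> k \<and> u k \<noteq> k)"
    obtain k0 where k0: "a \<le> k0" "k0 < b" "u k0 \<noteq> k0" using True by blast
    have k: "a \<le> k \<and> u k \<noteq> k" unfolding k_def by (rule LeastI[of _ k0]) (use k0 in simp)
    have "k \<le> k0" unfolding k_def by (rule Least_le) (use k0 in simp)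
    moreover have "\<forall>j. a \<le> j \<and> j < k \<longrightarrow> u j = j"
      using not_less_Least unfolding k_def by blast
    ultimately obtain v where v: "reach a b u v" "v a = Suc a"
      using move_cup_left[of u a b k] less k k0 by auto
    note pv = reach_props[OF v(1) less(2,3)]
    then have cl: "closed_ivl (a + 2) b v" using closed_split_cup v by blast
    have "a < b" using k0 by simp
    then have "Suc a < b" using pv v(2) unfolding closed_ivl_def by (metis order_refl)
    then have "b - (a + 2) < b - a" "a + 2 \<le> b" by simp_all
    then obtain v' p where v': "reach (a + 2) b v v'" "canon (a + 2) b p v'"
      using less(1)[of "a + 2" v] pv cl by blast
    note pv' = reach_props[OF v'(1) pv[THEN conjunct1] cl]
    have "v' a = Suc a" using v pv pv' by simp
    moreover have "v' (Suc a) = a" using calculation link_inv pv pv' by metis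
    ultimately have "canon a b (Suc p) v'" using v'(2) by (simp add: canon_def flat_Suc)
    moreover have "reach a b u v'" using v(1) reach_mono[OF v'(1), of a b] reach_trans by auto
    ultimately show ?thesis by blast
  qed
qed

text \<open>
  The zip move: \<open>e\<close> applied between the last of \<open>r\<close> flat cups and the next point moves that cup one step
  to the right and hands the partner of the next point (or its string) over to the left. Repeated from
  right to left, it carries a string past the cups, or stretches a cup over them.
\<close>

lemma reach_shift:
  assumes "c \<in> inf_link_states" "flat a r c" "c (a + 2 * r) \<ge> a + 2 * r"
  shows "\<exists>c1. reach a (a + 2 * r + 1) c c1 \<and>
    c1 a = (if c (a + 2 * r) = a + 2 * r then a else c (a + 2 * r)) \<and> flat (Suc a) r c1 \<and>
    (\<forall>k. \<not> (a \<le> k \<and> k \<le> a + 2 * r) \<and> k \<noteq> c (a + 2 * r) \<longrightarrow> c1 k = c k)"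
  using assms
proof (induction r arbitrary: c)
  case 0
  then show ?case by (intro exI[of _ c]) (auto simp: flat_def)
next
  case (Suc r)
  let ?t = "a + 2 * Suc r" and ?i = "Suc (a + 2 * r)"
  have ti: "?t = Suc ?i" by simp
  have ci: "c ?i = a + 2 * r" "c (a + 2 * r) = ?i" using Suc.prems(2) by (simp_all add: flat_def)
  have d: "\<not> both_strings ?i c" using ci by (simp add: both_strings_def)
  let ?c = "E ?i c"
  have R: "reach a (?t + 1) c ?c" by (rule reach_E) (use Suc d in auto)
  have keep: "?c k = c k" if "k \<noteq> ?i" "k \<noteq> ?t" "k \<noteq> a + 2 * r" "k \<noteq> c ?t" for k
  proof -
    have "c k \<noteq> ?i" "c k \<noteq> ?t" using that ci link_inv[OF Suc.prems(1), of k] by auto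
    then show ?thesis using that by (simp add: E_def)
  qed
  have fl: "flat a r ?c"
    using Suc.prems(2,3) keep by (simp add: flat_def)
  have e: "?c (a + 2 * r) = (if c ?t = ?t then a + 2 * r else c ?t)"
    using ci by (simp add: E_def)
  have ge: "?c (a + 2 * r) \<ge> a + 2 * r" using e Suc.prems(3) by simp
  obtain c1 where c1: "reach a (a + 2 * r + 1) ?c c1"
    "c1 a = (if ?c (a + 2 * r) = a + 2 * r then a else ?c (a + 2 * r))" "flat (Suc a) r c1"
    "\<forall>k. \<not> (a \<le> k \<and> k \<le> a + 2 * r) \<and> k \<noteq> ?c (a + 2 * r) \<longrightarrow> c1 k = ?c k"
    using Suc.IH[OF E_states[OF Suc.prems(1) d] fl ge] by blast
  have "c1 ?i = ?c ?i" "c1 ?t = ?c ?t" using c1(4) e Suc.prems(3) ti by auto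
  then have "c1 ?i = ?t" "c1 ?t = ?i" by simp_all
  then have "flat (Suc a) (Suc r) c1" using c1(3) unfolding flat_def
    by (auto simp: less_Suc_eq)
  moreover have "reach a (?t + 1) c c1" using R reach_mono[OF c1(1), of a "?t + 1"] reach_trans by auto
  moreover have "c1 a = (if c ?t = ?t then a else c ?t)" using c1(2) e Suc.prems(3) by auto
  moreover have "c1 k = c k" if "\<not> (a \<le> k \<and> k \<le> ?t)" "k \<noteq> c ?t" for k
    using c1(4) keep[of k] that e by auto
  ultimately show ?case by blast
qed

lemma strs_split:
  assumes "a \<le> m" "m \<le> b"
  shows "strs a b u = strs a m u + strs m b u"
proof -
  have "{k. a \<le> k \<and> k < b \<and> u k = k} = {k. a \<le> k \<and> k < m \<and> u k = k} \<union> {k. m \<le> k \<and> k < b \<and> u k = k}"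
    using assms by auto
  moreover have "finite {k. a \<le> k \<and> k < m \<and> u k = k}" "finite {k. m \<le> k \<and> k < b \<and> u k = k}"
    by (rule finite_subset[of _ "{..<b}"], use assms in auto)+
  ultimately show ?thesis unfolding strs_def by (simp add: card_Un_disjoint disjoint_iff)
qed

lemma strs_eq_0_iff: "strs a b u = 0 \<longleftrightarrow> (\<forall>k. a \<le> k \<and> k < b \<longrightarrow> u k \<noteq> k)"
proof -
  have "finite {k. a \<le> k \<and> k < b \<and> u k = k}" by (rule finite_subset[of _ "{..<b}"]) auto
  then show ?thesis by (auto simp: strs_def)
qed

lemma strs_le: "strs a b u \<le> b - a"
proof -
  have "{k. a \<le> k \<and> k < b \<and> u k = k} \<subseteq> {a..<b}" by auto
  then have "card {k. a \<le> k \<and> k < b \<and> u k = k} \<le> card {a..<b}" by (rule card_mono[rotated]) simp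
  then show ?thesis by (simp add: strs_def)
qed

lemma strs_all_iff:
  assumes "a \<le> b"
  shows "strs a b u = b - a \<longleftrightarrow> (\<forall>k. a \<le> k \<and> k < b \<longrightarrow> u k = k)"
proof
  assume s: "strs a b u = b - a"
  have "{k. a \<le> k \<and> k < b \<and> u k = k} \<subseteq> {a..<b}" by auto
  then have "{k. a \<le> k \<and> k < b \<and> u k = k} = {a..<b}"
    using card_subset_eq[OF finite_atLeastLessThan, of _ a b] s unfolding strs_def by simp
  then have "k \<in> {k. a \<le> k \<and> k < b \<and> u k = k} \<longleftrightarrow> k \<in> {a..<b}" for k by (simp only:)
  then show "\<forall>k. a \<le> k \<and> k < b \<longrightarrow> u k = k" unfolding mem_Collect_eq atLeastLessThan_iff by blast
next
  assume "\<forall>k. a \<le> k \<and> k < b \<longrightarrow> u k = k"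
  then have "{k. a \<le> k \<and> k < b \<and> u k = k} = {a..<b}" by auto
  then show "strs a b u = b - a" by (simp add: strs_def)
qed

lemma canon_strs:
  assumes "canon a b p u"
  shows "strs a b u = b - a - 2 * p"
proof -
  have "u k \<noteq> k" if "a \<le> k" "k < a + 2 * p" for k
  proof -
    define j where "j = (k - a) div 2"
    have "j < p" "k = a + 2 * j \<or> k = Suc (a + 2 * j)" using that by (auto simp: j_def)
    then show ?thesis using assms by (auto simp: canon_def flat_def)
  qed
  then have "strs a (a + 2 * p) u = 0" by (simp add: strs_eq_0_iff)
  moreover have "strs (a + 2 * p) b u = b - (a + 2 * p)"
    using assms by (subst strs_all_iff) (auto simp: canon_def)
  ultimately show ?thesis using strs_split[of a "a + 2 * p" b u] assms by (simp add: canon_def)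
qed

lemma closed_cup:
  assumes "u \<in> inf_link_states" "closed_ivl a b u" "a < u a" "a < b"
  shows "closed_ivl (Suc a) (u a) u" "closed_ivl (Suc (u a)) b u" "strs (Suc a) (u a) u = 0"
proof -
  note nest = link_nest[OF assms(1)] and inv = link_inv[OF assms(1)]
  show "closed_ivl (Suc a) (u a) u" "strs (Suc a) (u a) u = 0"
    using nest[of a] by (auto simp: closed_ivl_def strs_eq_0_iff Suc_le_eq)
  show "closed_ivl (Suc (u a)) b u"
    unfolding closed_ivl_def
  proof (intro allI impI)
    fix k assume k: "Suc (u a) \<le> k \<and> k < b"
    have "u k \<noteq> a" "u k \<noteq> u a" using k inv[of k] inv[of a] assms by auto
    moreover have "\<not> (a < u k \<and> u k < u a)" using nest(2)[of a "u k"] inv[of k] k by auto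
    moreover have "a \<le> u k" "u k < b" using assms k by (auto simp: closed_ivl_def)
    ultimately show "Suc (u a) \<le> u k \<and> u k < b" by linarith
  qed
qed

text \<open>
  A canonical form without strings consists of pairs of points.
\<close>

lemma closed_no_strings_even:
  assumes "u \<in> inf_link_states" "closed_ivl a b u" "a \<le> b" "strs a b u = 0"
  obtains m where "b = a + 2 * m"
proof -
  obtain v p where v: "reach a b u v" "canon a b p v" using reach_canon assms by blast
  then show ?thesis using reach_props[OF v(1) assms(1,2)] canon_strs[OF v(2)] assms(4) that[of p]
    by (simp add: canon_def)
qed

lemma closed_ivl_Suc:
  assumes "u \<in> inf_link_states" "closed_ivl a b u" "u a = a"
  shows "closed_ivl (Suc a) b u"
  unfolding closed_ivl_def
proof (intro allI impI)
  fix k assume k: "Suc a \<le> k \<and> k < b"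
  then have "a \<le> u k" "u k < b" using assms(2) by (auto simp: closed_ivl_def)
  moreover have "u k \<noteq> a" using k link_inv[OF assms(1), of k] assms(3) by auto
  ultimately show "Suc a \<le> u k \<and> u k < b" by simp
qed

lemma canon_closed:
  assumes "canon a b p u"
  shows "closed_ivl a b u"
  unfolding closed_ivl_def
proof (intro allI impI)
  fix k assume k: "a \<le> k \<and> k < b"
  show "a \<le> u k \<and> u k < b"
  proof (cases "k < a + 2 * p")
    case True
    define j where "j = (k - a) div 2"
    have "j < p" "k = a + 2 * j \<or> k = Suc (a + 2 * j)" using True k by (auto simp: j_def)
    then show ?thesis using assms k by (auto simp: canon_def flat_def)
  next
    case False
    then show ?thesis using assms k by (simp add: canon_def)
  qed
qed

text \<open>
  The target \<open>y\<close> is built from left to right. If \<open>y\<close> has a string at \<open>a\<close>, the zip move carries the first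
  string to \<open>a\<close>; if \<open>y\<close> joins \<open>a\<close> to \<open>k\<close>, it stretches a cup from \<open>a\<close> to \<open>k\<close>. What is left, inside the cup and
  to its right, is again canonical.
\<close>

lemma reach_from_canon:
  assumes "y \<in> inf_link_states" "closed_ivl a b y" "c \<in> inf_link_states" "canon a b p c"
    "strs a b y = b - a - 2 * p"
  shows "\<exists>v. reach a b c v \<and> (\<forall>k. a \<le> k \<and> k < b \<longrightarrow> v k = y k)"
  using assms
proof (induction "b - a" arbitrary: a b c p rule: less_induct)
  case less
  show ?case
  proof (cases "p = 0 \<or> a = b")
    case True
    then have "strs a b y = b - a" "strs a b c = b - a" 
      using less(6) canon_strs[OF less(5)] less(5) by (auto simp: canon_def)
    then have "\<forall>k. a \<le> k \<and> k < b \<longrightarrow> c k = y k"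
      using strs_all_iff[of a b] less(5) by (auto simp: canon_def)
    then show ?thesis by blast
  next
    case False
    have p: "a + 2 * p \<le> b" "flat a p c" using less(5) by (auto simp: canon_def)
    have ab: "a < b" using p False by simp
    have cc: "closed_ivl a b c" using less(5) by (rule canon_closed)
    show ?thesis
    proof (cases "y a = a")
      case True
      have cl: "closed_ivl (Suc a) b y"
        using closed_ivl_Suc less(2,3) True by blast
      have s: "strs a b y = Suc (strs (Suc a) b y)"
      proof -
        have "\<forall>k. a \<le> k \<and> k < Suc a \<longrightarrow> y k = k" using True by (metis le_antisym less_Suc_eq_le)
        then have "strs a (Suc a) y = Suc 0" using strs_all_iff[of a "Suc a" y] by simp
        then show ?thesis using strs_split[of a "Suc a" b y] ab by simp
      qed
      then have lt: "a + 2 * p < b" using less(6) by simp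
      then have ce: "c (a + 2 * p) = a + 2 * p" using less(5) by (simp add: canon_def)
      obtain c1 where c1: "reach a (a + 2 * p + 1) c c1" "c1 a = a" "flat (Suc a) p c1"
        "\<forall>k. \<not> (a \<le> k \<and> k \<le> a + 2 * p) \<and> k \<noteq> a + 2 * p \<longrightarrow> c1 k = c k"
        using reach_shift[OF less(4) p(2)] ce by auto
      have R: "reach a b c c1" using reach_mono[OF c1(1)] lt by simp
      note pc = reach_props[OF R less(4) cc]
      have cn: "canon (Suc a) b p c1" using c1(3,4) lt less(5) by (auto simp: canon_def)
      have "b - Suc a < b - a" "strs (Suc a) b y = b - Suc a - 2 * p" using ab s less(6) by simp_all
      then obtain v where v: "reach (Suc a) b c1 v" "\<forall>k. Suc a \<le> k \<and> k < b \<longrightarrow> v k = y k"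
        using less(1)[of b "Suc a" c1 p] cl pc less(2) cn by blast
      have "closed_ivl (Suc a) b c1"
        using closed_ivl_Suc pc c1(2) by blast
      note pv = reach_props[OF v(1) pc[THEN conjunct1] this]
      have "v a = a" using pv pc c1(2) by simp
      then have "\<forall>k. a \<le> k \<and> k < b \<longrightarrow> v k = y k" using v(2) True
        by (metis Suc_leI le_neq_implies_less)
      moreover have "reach a b c v" using reach_trans[OF R reach_mono[OF v(1)]] by simp
      ultimately show ?thesis by blast
    next
      case False
      define k where "k = y a"
      have k: "a < k" "k < b" using False less(3) ab by (auto simp: closed_ivl_def k_def)
      note cls = closed_cup[OF less(2,3), folded k_def, OF k(1) ab]
      obtain r where r: "k = Suc a + 2 * r"
        using closed_no_strings_even[OF less(2) cls(1) _ cls(3)] k by auto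
      have st: "strs a b y = strs (Suc k) b y"
      proof -
        have "y k = a" using link_inv[OF less(2)] by (simp add: k_def)
        then have "y k \<noteq> k" using k by simp
        then have "strs k (Suc k) y = 0" "strs a (Suc a) y = 0"
          using False unfolding strs_eq_0_iff by (metis le_antisym less_Suc_eq_le)+
        then show ?thesis using strs_split[of a "Suc a" b y] strs_split[of "Suc a" k b y] strs_split[of k "Suc k" b y] k cls(3)
          by simp
      qed
      have "strs (Suc k) b y \<le> b - Suc k" by (rule strs_le)
      then have rp: "Suc r \<le> p" using st less(6) p k r by arith
      have cr: "c (a + 2 * r) = k" using p(2) rp r by (auto simp: flat_def)
      have "flat a r c" using p(2) rp by (auto simp: flat_def)
      then obtain c1 where c1: "reach a (a + 2 * r + 1) c c1" "c1 a = k" "flat (Suc a) r c1"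
        "\<forall>j. \<not> (a \<le> j \<and> j \<le> a + 2 * r) \<and> j \<noteq> k \<longrightarrow> c1 j = c j"
        using reach_shift[OF less(4), of a r] cr r by auto
      have R: "reach a b c c1" using reach_mono[OF c1(1)] k r by simp
      note pc = reach_props[OF R less(4) cc]
      note clc = closed_cup[of c1 a b, unfolded c1(2), OF pc[THEN conjunct1] pc[THEN conjunct2, THEN conjunct1] k(1) ab]
      have cn: "canon (Suc a) k r c1" using c1(3) r by (auto simp: canon_def)
      have "k - Suc a < b - a" "strs (Suc a) k y = k - Suc a - 2 * r" using k cls(3) r by simp_all
      then obtain v where v: "reach (Suc a) k c1 v" "\<forall>j. Suc a \<le> j \<and> j < k \<longrightarrow> v j = y j"
        using less(1)[of k "Suc a" c1 r] cls(1) pc less(2) cn by blast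
      note pv = reach_props[OF v(1) pc[THEN conjunct1] clc(1)]
      have cn': "canon (Suc k) b (p - Suc r) v"
        unfolding canon_def flat_def
      proof (intro conjI allI impI)
        show "Suc k + 2 * (p - Suc r) \<le> b" using p rp r by arith
      next
        fix j assume j: "j < p - Suc r"
        have e: "Suc k + 2 * j = a + 2 * (j + Suc r)" using r by simp
        have "c (Suc k + 2 * j) = Suc (Suc k + 2 * j) \<and> c (Suc (Suc k + 2 * j)) = Suc k + 2 * j"
          unfolding e using p(2) j by (simp add: flat_def del: mult_Suc_right)
        moreover have "v i = c i" if "k < i" for i
          using pv pc c1(4) that r by auto
        ultimately show "v (Suc k + 2 * j) = Suc (Suc k + 2 * j)" "v (Suc (Suc k + 2 * j)) = Suc k + 2 * j"
          by auto
      next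
        fix j assume j: "Suc k + 2 * (p - Suc r) \<le> j \<and> j < b"
        moreover have "Suc k + 2 * (p - Suc r) = a + 2 * p" using r rp by simp
        ultimately have "c j = j" using less(5) by (simp add: canon_def)
        then show "v j = j" using c1(4) pv pc k ab r j by auto
      qed
      have clv: "closed_ivl (Suc k) b v" using cn' by (rule canon_closed)
      have "strs (Suc k) b y = b - Suc k - 2 * (p - Suc r)" "b - Suc k < b - a"
        using st less(6) r rp p ab k by simp_all
      then obtain v' where v': "reach (Suc k) b v v'" "\<forall>j. Suc k \<le> j \<and> j < b \<longrightarrow> v' j = y j"
        using less(1)[of b "Suc k" v "p - Suc r"] cls(2) less(2) pv cn' by blast
      note pv' = reach_props[OF v'(1) pv[THEN conjunct1] clv]
      have "c1 k = a" using pc c1(2) link_inv[of c1 a] by auto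
      then have "v' a = k" "v' k = a" using pv' pv pc c1(2) k ab clc by auto
      then have "v' j = y j" if j: "a \<le> j" "j < b" for j
      proof -
        have yk: "y k = a" "y a = k" using link_inv[OF less(2)] by (auto simp: k_def)
        consider "j = a" | "j = k" | "a < j" "j < k" | "k < j" using j by linarith
        then show ?thesis
        proof cases
          case 3
          then have "v j = y j" "v' j = v j" using v(2) pv' pv pc by auto
          then show ?thesis by simp
        qed (use j yk v'(2) \<open>v' a = k\<close> \<open>v' k = a\<close> in auto)
      qed
      moreover have "reach a b c v'"
        using reach_trans[OF R reach_trans[OF reach_mono[OF v(1)] reach_mono[OF v'(1)]]] k by simp
      ultimately show ?thesis by blast
    qed
  qed
qed

lemma reach_within:
  assumes "u \<in> inf_link_states" "y \<in> inf_link_states" "closed_ivl a b u" "closed_ivl a b y" "a \<le> b"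
    "strs a b u = strs a b y" "\<And>k. \<not> (a \<le> k \<and> k < b) \<Longrightarrow> u k = y k"
  shows "reach a b u y"
proof -
  obtain c p where c: "reach a b u c" "canon a b p c"
    using reach_canon assms by blast
  note pc = reach_props[OF c(1) assms(1,3)]
  have "strs a b y = b - a - 2 * p" using canon_strs[OF c(2)] pc assms(6) by simp
  then obtain v where v: "reach a b c v" "\<forall>k. a \<le> k \<and> k < b \<longrightarrow> v k = y k"
    using reach_from_canon[OF assms(2,4) pc[THEN conjunct1] c(2)] by blast
  have "closed_ivl a b c" using pc by blast
  note pv = reach_props[OF v(1) pc[THEN conjunct1] this]
  have "v k = y k" for k
    using v(2) pv pc assms(7)[of k] by (cases "a \<le> k \<and> k < b") auto
  then have "v = y" by blast
  then show ?thesis using reach_trans[OF c(1) v(1)] by simp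
qed

section \<open>Words and projectors\<close>

text \<open>
  The action of a word on a single state: the result \<open>Some (k, v)\<close> stands for \<open>\<delta>\<^sup>k\<close> times \<open>v\<close>, and \<open>None\<close> for 0.
  Neither depends on the value of \<open>\<delta>\<close>.
\<close>

primrec wact :: "nat list \<Rightarrow> inf_link \<Rightarrow> (nat \<times> inf_link) option" where
  "wact [] u = Some (0, u)"
| "wact (i # g) u = (case wact g u of None \<Rightarrow> None
     | Some (k, v) \<Rightarrow> if both_strings i v then None else Some (if v i = Suc i then Suc k else k, E i v))"

lemma wact_Cons_Some:
  "wact (i # g) u = Some (k, v) \<longleftrightarrow>
    (\<exists>k' v'. wact g u = Some (k', v') \<and> \<not> both_strings i v' \<and> k = (if v' i = Suc i then Suc k' else k') \<and> v = E i v')"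
  by (auto split: option.split)

lemma wact_append:
  "wact (g @ h) u = (case wact h u of None \<Rightarrow> None | Some (k, v) \<Rightarrow>
     (case wact g v of None \<Rightarrow> None | Some (j, z) \<Rightarrow> Some (k + j, z)))"
  by (induction g) (auto split: option.split)

lemma wact_append_Some:
  assumes "wact h u = Some (k, v)" "wact g v = Some (j, z)"
  shows "wact (g @ h) u = Some (k + j, z)"
  using assms by (simp add: wact_append)

definition inside :: "nat \<Rightarrow> nat \<Rightarrow> nat list \<Rightarrow> bool" where
  "inside a b g \<longleftrightarrow> (\<forall>i\<in>set g. a \<le> i \<and> Suc i < b)"

lemma inside_simps [simp]: "inside a b []" "inside a b (i # g) \<longleftrightarrow> a \<le> i \<and> Suc i < b \<and> inside a b g"
  "inside a b (g @ h) \<longleftrightarrow> inside a b g \<and> inside a b h" "inside a b (rev g) \<longleftrightarrow> inside a b g"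
  by (auto simp: inside_def)

lemma inside_mono: "inside a' b' g \<Longrightarrow> a \<le> a' \<Longrightarrow> b' \<le> b \<Longrightarrow> inside a b g"
  unfolding inside_def by fastforce

lemma wact_link: "wact g u = Some (k, v) \<Longrightarrow> u \<in> inf_link_states \<Longrightarrow> v \<in> inf_link_states"
  by (induction g arbitrary: k v) (auto simp: wact_Cons_Some E_states simp del: wact.simps(2))

lemma wact_props:
  assumes "wact g u = Some (k, v)" "inside a b g" "u \<in> inf_link_states" "closed_ivl a b u"
  shows "closed_ivl a b v \<and> strs a b v = strs a b u \<and> (\<forall>k. \<not> (a \<le> k \<and> k < b) \<longrightarrow> v k = u k)"
  using assms
proof (induction g arbitrary: k v)
  case Nil then show ?case by simp
next
  case (Cons i g)
  then obtain k' v' where v': "wact g u = Some (k', v')" "\<not> both_strings i v'" "v = E i v'"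
    by (auto simp: wact_Cons_Some simp del: wact.simps(2))
  have "v' \<in> inf_link_states" using wact_link v'(1) Cons.prems(3) by blast
  then show ?case using Cons v' E_outside[of v' a b i]
    by (auto simp: E_closed strs_E simp del: wact.simps)
qed

lemma both_strings_local: "(\<And>k. a \<le> k \<Longrightarrow> k < b \<Longrightarrow> u' k = u k) \<Longrightarrow> a \<le> i \<Longrightarrow> Suc i < b \<Longrightarrow> both_strings i u' = both_strings i u"
  by (simp add: both_strings_def)

lemma E_local:
  assumes "\<And>k. a \<le> k \<Longrightarrow> k < b \<Longrightarrow> u' k = u k" "a \<le> i" "Suc i < b" "a \<le> k" "k < b"
  shows "E i u' k = E i u k"
  using assms by (simp add: E_def)

lemma wact_local:
  assumes "wact g u = Some (k, v)" "inside a b g" "\<And>k. a \<le> k \<Longrightarrow> k < b \<Longrightarrow> u' k = u k"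
  shows "\<exists>v'. wact g u' = Some (k, v') \<and> (\<forall>k. a \<le> k \<and> k < b \<longrightarrow> v' k = v k)"
  using assms
proof (induction g arbitrary: k v)
  case Nil then show ?case by simp
next
  case (Cons i g)
  then obtain k1 v1 where v1: "wact g u = Some (k1, v1)" "\<not> both_strings i v1" "v = E i v1"
    "k = (if v1 i = Suc i then Suc k1 else k1)"
    by (auto simp: wact_Cons_Some simp del: wact.simps(2))
  then obtain v' where v': "wact g u' = Some (k1, v')" "\<And>k. a \<le> k \<Longrightarrow> k < b \<Longrightarrow> v' k = v1 k"
    using Cons by auto
  have i: "a \<le> i" "Suc i < b" using Cons.prems(2) by simp_all
  have "\<not> both_strings i v'" using both_strings_local[of a b v' v1 i] v'(2) v1(2) i by blast
  moreover have "v' i = v1 i" using v'(2) i by simp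
  ultimately have "wact (i # g) u' = Some (k, E i v')" using v' v1(4) by simp
  moreover have "E i v' j = v j" if "a \<le> j" "j < b" for j
    using E_local[of a b v' v1 i j] v'(2) i that v1(3) by blast
  ultimately show ?case by blast
qed

lemma reach_word:
  assumes "reach a b u v"
  shows "\<exists>g. inside a b g \<and> wact g u = Some (0, v)"
  using assms
proof (induction rule: rtranclp_induct)
  case base
  have "wact [] u = Some (0, u)" by simp
  then show ?case using inside_simps(1) by blast
next
  case (step v w)
  then obtain g i where "inside a b g" "wact g u = Some (0, v)" "a \<le> i" "Suc i < b" "v i \<noteq> Suc i" "\<not> both_strings i v" "w = E i v"
    by (auto simp: step_def)
  then have "inside a b (i # g) \<and> wact (i # g) u = Some (0, w)" by simp
  then show ?case by blast
qed

text \<open>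
  The relation \<open>e\<^sub>i e\<^sub>i\<^sub>+\<^sub>1 e\<^sub>i = e\<^sub>i\<close> on states with the cup \<open>{i, i+1}\<close>. Unlike \<open>e\<^sub>i\<close> itself, which acts by \<open>\<delta>\<close>,
  the word \<open>e\<^sub>i e\<^sub>i\<^sub>+\<^sub>1\<close> is a projector also for \<open>\<delta> = 0\<close>.
\<close>

lemma cup_pair_word:
  assumes w: "w \<in> inf_link_states" "w a = Suc a"
  shows "wact [a, Suc a] w = Some (0, w)"
proof -
  note inv = link_inv[OF w(1)]
  have wS: "w (Suc a) = a" using inv[of a] w(2) by simp
  let ?v = "E (Suc a) w"
  have va: "?v a = (if w (Suc (Suc a)) = Suc (Suc a) then a else w (Suc (Suc a)))"
    using w(2) by (simp add: E_def)
  have ne: "w (Suc (Suc a)) \<noteq> a" "w (Suc (Suc a)) \<noteq> Suc a"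
    using inv[of "Suc (Suc a)"] w(2) wS by auto
  have "\<not> both_strings (Suc a) w" "w (Suc a) \<noteq> Suc (Suc a)" "\<not> both_strings a ?v" "?v a \<noteq> Suc a"
    using wS va ne by (auto simp: both_strings_def)
  moreover have "E a ?v = w"
  proof
    fix k
    have "w k = a \<longleftrightarrow> k = Suc a" "w k = Suc a \<longleftrightarrow> k = a" "w k = Suc (Suc a) \<longleftrightarrow> k = w (Suc (Suc a))"
      using inv wS w(2) by metis+
    then show "E a ?v k = w k"
      using w(2) wS va ne inv[of "Suc (Suc a)"] by (auto simp: E_def)
  qed
  ultimately show ?thesis by simp
qed

text \<open>
  The projectors onto the cups \<open>{a, a+1}, {a+2, a+3}, ...\<close>. The leftmost one acts first, because the
  projector onto \<open>{a, a+1}\<close> also disturbs the point \<open>a + 2\<close>.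
\<close>

primrec flat_word :: "nat \<Rightarrow> nat \<Rightarrow> nat list" where
  "flat_word a 0 = []"
| "flat_word a (Suc m) = flat_word (a + 2) m @ [a, Suc a]"

lemma inside_flat_word: "inside a (Suc (a + 2 * m)) (flat_word a m)"
proof (induction m arbitrary: a)
  case (Suc m)
  then have "inside a (Suc (a + 2 * Suc m)) (flat_word (a + 2) m)"
    using inside_mono[OF Suc[of "a + 2"]] by simp
  then show ?case by simp
qed simp

lemma flat_word_id:
  assumes "w \<in> inf_link_states" "flat a m w"
  shows "wact (flat_word a m) w = Some (0, w)"
  using assms(2)
proof (induction m arbitrary: a)
  case (Suc m)
  then have "wact [a, Suc a] w = Some (0, w)" "wact (flat_word (a + 2) m) w = Some (0, w)"
    using cup_pair_word[OF assms(1)] by (simp_all add: flat_Suc del: wact.simps)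
  then show ?case using wact_append_Some by fastforce
qed simp

lemma wact_keep_below:
  assumes "wact g u = Some (k, v)" "\<forall>i\<in>set g. b \<le> i" "x < b" "u x < b" "u \<in> inf_link_states"
  shows "v x = u x"
  using assms
proof (induction g arbitrary: k v)
  case Nil then show ?case by simp
next
  case (Cons i g)
  then obtain k' v' where v': "wact g u = Some (k', v')" "\<not> both_strings i v'" "v = E i v'"
    by (auto simp: wact_Cons_Some simp del: wact.simps(2))
  then have "v' x = u x" using Cons by auto
  then show ?case using v'(3) Cons.prems by (simp add: E_def)
qed

lemma flat_word_flat:
  assumes "u \<in> inf_link_states" "wact (flat_word a m) u = Some (k, v)"
  shows "flat a m v"
  using assms
proof (induction m arbitrary: a u k)
  case 0 then show ?case by (simp add: flat_def)
next
  case (Suc m)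
  obtain k1 u1 k2 where 1: "wact [a, Suc a] u = Some (k1, u1)" "wact (flat_word (a + 2) m) u1 = Some (k2, v)"
    using Suc.prems(2) by (auto simp: wact_append split: option.splits simp del: wact.simps)
  have u1: "u1 \<in> inf_link_states" using wact_link 1 Suc.prems(1) by blast
  have c: "u1 a = Suc a" "u1 (Suc a) = a"
    using 1(1) wact_Cons_Some[of a "[Suc a]"] by (auto simp del: wact.simps)
  have g: "\<forall>i\<in>set (flat_word (a + 2) m). a + 2 \<le> i"
    using inside_flat_word[of "a + 2" m] by (auto simp: inside_def)
  have "v a = Suc a" "v (Suc a) = a"
    using wact_keep_below[OF 1(2) g _ _ u1] c by auto
  then show ?case using Suc.IH[OF u1 1(2)] by (simp add: flat_Suc)
qed

text \<open>
  The points from \<open>i\<close> to \<open>w i\<close> form a closed interval without strings. Flatten \<open>w\<close> there, project onto the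
  flat cups, and rebuild \<open>w\<close>; the last move depends only on the flat cups and thus creates the cup of \<open>w\<close>
  in every state that survives the projection.
\<close>

lemma cup_projector:
  assumes w: "w \<in> inf_link_states" "i < w i"
  shows "\<exists>g. (\<forall>l\<in>set g. i \<le> l) \<and> wact g w = Some (0, w) \<and>
    (\<forall>u k v. u \<in> inf_link_states \<longrightarrow> wact g u = Some (k, v) \<longrightarrow> v i = w i)"
proof -
  let ?b = "Suc (w i)"
  have cl: "closed_ivl i ?b w"
    unfolding closed_ivl_def
  proof (intro allI impI)
    fix k assume k: "i \<le> k \<and> k < ?b"
    show "i \<le> w k \<and> w k < ?b"
      using k w link_nest[OF w(1), of i k] link_inv[OF w(1), of i]
      by (cases "k = i"; cases "k = w i") auto
  qed
  have "strs i ?b w = 0"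
    unfolding strs_eq_0_iff
  proof (intro allI impI)
    fix k assume k: "i \<le> k \<and> k < ?b"
    show "w k \<noteq> k"
      using k w link_nest[OF w(1), of i k] link_inv[OF w(1), of i]
      by (cases "k = i"; cases "k = w i") auto
  qed
  have ib: "i \<le> ?b" using w by simp
  obtain c m where c: "reach i ?b w c" "canon i ?b m c" using reach_canon[OF w(1) cl ib] by blast
  note pc = reach_props[OF c(1) w(1) cl]
  have bm: "?b = i + 2 * m" using canon_strs[OF c(2)] pc \<open>strs i ?b w = 0\<close> c(2) by (simp add: canon_def)
  have bk: "reach i ?b c w"
    by (rule reach_within) (use pc w cl ib in auto)
  obtain r where r: "inside i ?b r" "wact r w = Some (0, c)" using reach_word[OF c(1)] by blast
  obtain r' where r': "inside i ?b r'" "wact r' c = Some (0, w)" using reach_word[OF bk] by blast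
  let ?Q = "flat_word i m"
  have fl: "flat i m c" using c(2) by (simp add: canon_def)
  show ?thesis
  proof (intro exI[of _ "r' @ ?Q @ r"] conjI allI impI)
    show "\<forall>l\<in>set (r' @ ?Q @ r). i \<le> l"
      using r(1) r'(1) inside_flat_word[of i m] unfolding inside_def by auto
    have "wact (?Q @ r) w = Some (0 + 0, c)"
      using wact_append_Some[OF r(2) flat_word_id[OF _ fl]] pc by blast
    then show "wact (r' @ ?Q @ r) w = Some (0, w)"
      using wact_append_Some[of "?Q @ r" w 0 c r' 0 w] r'(2) by simp
  next
    fix u k v assume u: "u \<in> inf_link_states" "wact (r' @ ?Q @ r) u = Some (k, v)"
    obtain k1 u1 k2 u2 where 1: "wact r u = Some (k1, u1)" "wact ?Q u1 = Some (k2, u2)"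
      "\<exists>k3. wact r' u2 = Some (k3, v)"
      using u(2) by (auto simp: wact_append split: option.splits)
    have "u1 \<in> inf_link_states" using wact_link 1(1) u(1) by blast
    then have f2: "flat i m u2" using flat_word_flat 1(2) by blast
    have "u2 k = c k" if "i \<le> k" "k < ?b" for k
    proof -
      define j where "j = (k - i) div 2"
      have "j < m" "k = i + 2 * j \<or> k = Suc (i + 2 * j)" using that bm by (auto simp: j_def)
      then show ?thesis using f2 fl by (auto simp: flat_def)
    qed
    then obtain v' where "wact r' u2 = Some (0, v')" "\<forall>k. i \<le> k \<and> k < ?b \<longrightarrow> v' k = w k"
      using wact_local[OF r'(2,1), of u2] by blast
    then show "v i = w i" using 1(3) w(2) by auto
  qed
qed

section \<open>Equivalence of link states\<close>

text \<open>
  Equivalence of link states, stated with one closed interval outside which the states agree.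
\<close>

definition sim :: "inf_link \<Rightarrow> inf_link \<Rightarrow> bool" where
  "sim w u \<longleftrightarrow> u \<in> inf_link_states \<and>
    (\<exists>n. closed_ivl 0 n w \<and> closed_ivl 0 n u \<and> (\<forall>k\<ge>n. u k = w k) \<and> strs 0 n u = strs 0 n w)"

text \<open>
  Among the cups that cross \<open>N\<close>, the one with the leftmost left end contains all others.
\<close>

lemma closed_cofinal:
  assumes "w \<in> inf_link_states"
  obtains n where "N \<le> n" "closed_ivl 0 n w"
proof (cases "\<exists>k. k < N \<and> N \<le> w k")
  case False
  then have "closed_ivl 0 N w" by (auto simp: closed_ivl_def not_le)
  then show ?thesis using that by blast
next
  case True
  define k where "k = (LEAST k. k < N \<and> N \<le> w k)"
  have k: "k < N" "N \<le> w k" using LeastI_ex[OF True] by (auto simp: k_def)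
  have min: "w j < N" if "j < k" for j using not_less_Least[of j "\<lambda>k. k < N \<and> N \<le> w k"] that k by (auto simp: k_def)
  (* the minimality of k makes the cup at k contain every other cup that crosses N *)
  have "closed_ivl 0 (Suc (w k)) w"
    unfolding closed_ivl_def
  proof (intro allI impI)
    fix j assume j: "0 \<le> j \<and> j < Suc (w k)"
    consider "j < k" | "j = k" | "k < j" "j < w k" | "j = w k" using j by linarith
    then show "0 \<le> w j \<and> w j < Suc (w k)"
      using min[of j] k link_nest[OF assms, of k j] link_inv[OF assms, of k] by cases auto
  qed
  then show ?thesis using that[of "Suc (w k)"] k by simp
qed

lemma closed_ivl_tail:
  assumes "u \<in> inf_link_states" "w \<in> inf_link_states" "closed_ivl 0 n u" "\<forall>k\<ge>n. u k = w k" "n \<le> m" "closed_ivl 0 m w"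
  shows "closed_ivl 0 m u"
  unfolding closed_ivl_def
proof (intro allI impI)
  fix k assume "0 \<le> k \<and> k < m"
  then show "0 \<le> u k \<and> u k < m"
    using assms(3-6) by (cases "k < n") (auto simp: closed_ivl_def not_less intro: less_le_trans)
qed

lemma strs_cong: "(\<And>k. a \<le> k \<Longrightarrow> k < b \<Longrightarrow> u k = v k) \<Longrightarrow> strs a b u = strs a b v"
  unfolding strs_def by (rule arg_cong[of _ _ card]) auto

text \<open>
  Beyond the interval both states are equal, so all longer closed intervals work as well.
\<close>

lemma sim_iff:
  assumes "w \<in> inf_link_states"
  shows "sim w u \<longleftrightarrow> u \<in> inf_link_states \<and>
    (\<exists>N. (\<forall>k\<ge>N. u k = w k) \<and> (\<forall>n\<ge>N. closed_ivl 0 n w \<longrightarrow> closed_ivl 0 n u \<and> strs 0 n u = strs 0 n w))"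
proof
  assume "sim w u"
  then obtain n where n: "u \<in> inf_link_states" "closed_ivl 0 n w" "closed_ivl 0 n u" "\<forall>k\<ge>n. u k = w k" "strs 0 n u = strs 0 n w"
    by (auto simp: sim_def)
  have "closed_ivl 0 m u \<and> strs 0 m u = strs 0 m w" if "n \<le> m" "closed_ivl 0 m w" for m
    using closed_ivl_tail[OF n(1) assms n(3,4) that] strs_split[of 0 n m u] strs_split[of 0 n m w] n(5) that(1)
      strs_cong[of n m u w] n(4) by auto
  with n show "u \<in> inf_link_states \<and>
    (\<exists>N. (\<forall>k\<ge>N. u k = w k) \<and> (\<forall>n\<ge>N. closed_ivl 0 n w \<longrightarrow> closed_ivl 0 n u \<and> strs 0 n u = strs 0 n w))" by blast
next
  assume "u \<in> inf_link_states \<and>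
    (\<exists>N. (\<forall>k\<ge>N. u k = w k) \<and> (\<forall>n\<ge>N. closed_ivl 0 n w \<longrightarrow> closed_ivl 0 n u \<and> strs 0 n u = strs 0 n w))"
  then obtain N where N: "u \<in> inf_link_states" "\<forall>k\<ge>N. u k = w k"
    "\<forall>n\<ge>N. closed_ivl 0 n w \<longrightarrow> closed_ivl 0 n u \<and> strs 0 n u = strs 0 n w" by blast
  obtain n where "N \<le> n" "closed_ivl 0 n w" using closed_cofinal[OF assms] by blast
  with N show "sim w u" unfolding sim_def by auto
qed

lemma sim_refl: "w \<in> inf_link_states \<Longrightarrow> sim w w"
  unfolding sim_def using closed_cofinal[of w 0] by metis

lemma sim_sym: "w \<in> inf_link_states \<Longrightarrow> sim w u \<Longrightarrow> sim u w"
  unfolding sim_def by metis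

lemma sim_trans:
  assumes "w \<in> inf_link_states" "sim w u" "sim u v"
  shows "sim w v"
proof -
  have u: "u \<in> inf_link_states" using assms by (simp add: sim_def)
  obtain N where N: "\<forall>k\<ge>N. u k = w k" "\<forall>n\<ge>N. closed_ivl 0 n w \<longrightarrow> closed_ivl 0 n u \<and> strs 0 n u = strs 0 n w"
    using assms(1,2) sim_iff by blast
  obtain M where M: "v \<in> inf_link_states" "\<forall>k\<ge>M. v k = u k" "\<forall>n\<ge>M. closed_ivl 0 n u \<longrightarrow> closed_ivl 0 n v \<and> strs 0 n v = strs 0 n u"
    using assms(3) u sim_iff by blast
  show ?thesis unfolding sim_iff[OF assms(1)]
    using N M by (intro conjI exI[of _ "max N M"]) auto
qed

lemma reach_sim:
  assumes "w \<in> inf_link_states" "closed_ivl 0 n w" "reach 0 n w u"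
  shows "sim w u"
  using reach_props[OF assms(3,1,2)] assms(2) unfolding sim_def by auto

lemma sim_E:
  assumes "w \<in> inf_link_states" "\<not> both_strings i w"
  shows "sim w (E i w)"
proof -
  obtain n where "i + 2 \<le> n" "closed_ivl 0 n w" using closed_cofinal[OF assms(1)] by blast
  then show ?thesis using reach_sim[OF assms(1)] reach_E[OF assms(1), of 0 i n] assms(2) by auto
qed

lemma sim_wact: "w \<in> inf_link_states \<Longrightarrow> wact g w = Some (k, v) \<Longrightarrow> sim w v"
proof (induction g arbitrary: k v)
  case Nil then show ?case by (simp add: sim_refl)
next
  case (Cons i g)
  then obtain k' v' where v': "wact g w = Some (k', v')" "\<not> both_strings i v'" "v = E i v'"
    by (auto simp: wact_Cons_Some simp del: wact.simps(2))
  then show ?case using Cons sim_trans sim_E wact_link by metis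
qed

lemma sim_reach:
  assumes "w \<in> inf_link_states" "sim w u"
  obtains N where "\<And>n. N \<le> n \<Longrightarrow> closed_ivl 0 n w \<Longrightarrow> reach 0 n w u"
proof -
  obtain N where N: "u \<in> inf_link_states" "\<forall>k\<ge>N. u k = w k" "\<forall>n\<ge>N. closed_ivl 0 n w \<longrightarrow> closed_ivl 0 n u \<and> strs 0 n u = strs 0 n w"
    using assms sim_iff by blast
  show ?thesis
    by (rule that[of N], rule reach_within) (use assms N in auto)
qed

lemma sim_word:
  assumes "w \<in> inf_link_states" "sim w u"
  obtains g where "wact g w = Some (0, u)"
  using sim_reach[OF assms] closed_cofinal[OF assms(1)] reach_word by metis

section \<open>Components of two glued link states\<close>

definition arcs :: "nat \<Rightarrow> inf_link \<Rightarrow> inf_link \<Rightarrow> (nat \<times> nat) set" where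
  "arcs n x y = {(i, j). i < n \<and> (j = x i \<or> j = y i)}"

abbreviation conn :: "nat \<Rightarrow> inf_link \<Rightarrow> inf_link \<Rightarrow> (nat \<times> nat) set" where
  "conn n x y \<equiv> (arcs n x y)\<^sup>*"

definition strings_connected :: "nat \<Rightarrow> inf_link \<Rightarrow> inf_link \<Rightarrow> bool" where
  "strings_connected n x y \<longleftrightarrow> (\<forall>s<n. x s = s \<longrightarrow> (\<exists>j. (s, j) \<in> conn n x y \<and> y j = j))"

definition loop_classes :: "nat \<Rightarrow> inf_link \<Rightarrow> inf_link \<Rightarrow> nat set set" where
  "loop_classes n x y = {C. \<exists>i<n. C = conn n x y `` {i} \<and> (\<forall>j\<in>C. x j \<noteq> j \<and> y j \<noteq> j)}"

definition form :: "complex \<Rightarrow> nat \<Rightarrow> inf_link \<Rightarrow> inf_link \<Rightarrow> complex" where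
  "form \<delta> n x y = (if strings_connected n x y then \<delta> ^ card (loop_classes n x y) else 0)"

lemma arcs_sym: "arcs n x y = arcs n y x" by (auto simp: arcs_def)

lemma conn_lt:
  assumes "closed_ivl 0 n x" "closed_ivl 0 n y" "(i, j) \<in> conn n x y" "i < n"
  shows "j < n"
  using assms(3,4) assms(1,2) by (induction rule: rtrancl_induct) (auto simp: arcs_def closed_ivl_def)

lemma conn_sym:
  assumes "x \<in> inf_link_states" "y \<in> inf_link_states" "closed_ivl 0 n x" "closed_ivl 0 n y" "(i, j) \<in> conn n x y"
  shows "(j, i) \<in> conn n x y"
proof -
  have "sym (arcs n x y)"
    using assms(1-4) link_inv[OF assms(1)] link_inv[OF assms(2)] by (auto simp: sym_def arcs_def closed_ivl_def)
  then show ?thesis using assms(5) sym_rtrancl symD by metis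
qed

lemma link_form_form:
  assumes "closed_ivl 0 n x" "closed_ivl 0 n y"
  shows "link_form \<delta> (map x [0..<n]) (map y [0..<n]) = form \<delta> n x y"
proof -
  have "{(i, j). i < n \<and> (j = map x [0..<n] ! i \<or> j = map y [0..<n] ! i)} = arcs n x y"
    by (auto simp: arcs_def)
  then have g: "glued (map x [0..<n]) (map y [0..<n]) = conn n x y" by (simp add: glued_def)
  have lt: "j < n" if "(i, j) \<in> conn n x y" "i < n" for i j using conn_lt[OF assms that] .
  have m: "map x [0..<n] ! i = x i" "map y [0..<n] ! i = y i" if "i < n" for i using that by simp_all
  have "(\<exists>j. (i, j) \<in> conn n x y \<and> map y [0..<n] ! j = j) \<longleftrightarrow> (\<exists>j. (i, j) \<in> conn n x y \<and> y j = j)" if "i < n" for i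
    using lt[OF _ that] m by metis
  then have "(\<forall>i<n. map x [0..<n] ! i = i \<longrightarrow> (\<exists>j. (i, j) \<in> conn n x y \<and> map y [0..<n] ! j = j)) \<longleftrightarrow> strings_connected n x y"
    unfolding strings_connected_def using m by metis
  moreover have "(\<forall>j\<in>conn n x y `` {i}. map x [0..<n] ! j \<noteq> j \<and> map y [0..<n] ! j \<noteq> j) \<longleftrightarrow>
      (\<forall>j\<in>conn n x y `` {i}. x j \<noteq> j \<and> y j \<noteq> j)" if "i < n" for i
    using lt[OF _ that] m by (metis Image_singleton_iff)
  then have "{C. \<exists>i<n. C = conn n x y `` {i} \<and> (\<forall>j\<in>C. map x [0..<n] ! j \<noteq> j \<and> map y [0..<n] ! j \<noteq> j)} = loop_classes n x y"
    unfolding loop_classes_def by blast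
  ultimately show ?thesis
    unfolding link_form_def form_def num_loops_def g by simp
qed

text \<open>
  A component with a string is a path, which has only two ends. In terms of \<open>p = x y\<close>: the component
  of the string \<open>s\<close> of \<open>x\<close> is its orbit under \<open>p\<close>. A string of \<open>y\<close> in it makes an odd power of \<open>p\<close> fix \<open>s\<close>,
  while \<open>s' = p\<^sup>j s\<close> being a string of \<open>x\<close> makes \<open>p\<^sup>2\<^sup>j\<close> fix \<open>s\<close>. Together, \<open>p\<^sup>j\<close> fixes \<open>s\<close>.
\<close>

lemma conn_string_unique:
  assumes x: "x \<in> inf_link_states" and y: "y \<in> inf_link_states"
    and s: "x s = s" and s': "x s' = s'" "(s, s') \<in> conn n x y" and t: "y t = t" "(s, t) \<in> conn n x y"
  shows "s = s'"
proof -
  note ix = link_inv[OF x] and iy = link_inv[OF y]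
  define p where "p z = x (y z)" for z
  define p' where "p' z = y (x z)" for z
  have pp': "p (p' z) = z" "p' (p z) = z" for z by (simp_all add: p_def p'_def ix iy)
  have ppk: "(p ^^ k) ((p' ^^ k) z) = z" for k z
    by (induction k arbitrary: z) (simp_all add: funpow_swap1[of p] pp')
  have sw: "x (p z) = p' (x z)" "x (p' z) = p (x z)" "y (p z) = p' (y z)" "y (p' z) = p (y z)" for z
    by (simp_all add: p_def p'_def ix iy)
  have xp: "x ((p ^^ k) z) = (p' ^^ k) (x z)" for k z by (induction k) (simp_all add: sw)
  have xp': "x ((p' ^^ k) z) = (p ^^ k) (x z)" for k z by (induction k) (simp_all add: sw)
  have yp: "y ((p ^^ k) z) = (p' ^^ k) (y z)" for k z by (induction k) (simp_all add: sw)
  have yp': "y ((p' ^^ k) z) = (p ^^ k) (y z)" for k z by (induction k) (simp_all add: sw)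
  have ys: "y s = p' s" by (simp add: p'_def s)
  have walk: "\<exists>k. z = (p ^^ k) s \<or> z = (p' ^^ k) s" if "(s, z) \<in> conn n x y" for z
    using that
  proof (induction rule: rtrancl_induct)
    case base show ?case by (intro exI[of _ 0]) simp
  next
    case (step z z')
    then obtain k where k: "z = (p ^^ k) s \<or> z = (p' ^^ k) s" by blast
    have "z' = x z \<or> z' = y z" using step by (auto simp: arcs_def)
    then show ?case
    proof
      assume "z' = x z"
      then show ?thesis using k xp xp' s by metis
    next
      assume z': "z' = y z"
      show ?thesis
      proof (cases "z = (p ^^ k) s")
        case True
        then have "z' = (p' ^^ Suc k) s" using z' yp ys by (simp add: funpow_swap1)
        then show ?thesis by blast
      next
        case False
        then have z: "z' = (p ^^ k) (p' s)" using k z' yp' ys by simp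
        show ?thesis
        proof (cases k)
          case 0 then have "z' = (p' ^^ 1) s" using z by simp
          then show ?thesis by blast
        next
          case (Suc m) then have "z' = (p ^^ m) s" using z by (simp add: funpow_swap1 pp')
          then show ?thesis by blast
        qed
      qed
    qed
  qed
  have odd: "\<exists>k. (p ^^ (2 * k + 1)) s = s"
  proof -
    obtain k where "t = (p ^^ k) s \<or> t = (p' ^^ k) s" using walk t by blast
    then show ?thesis
    proof
      assume e: "t = (p ^^ k) s"
      then have "(p' ^^ Suc k) s = (p ^^ k) s" using t yp[of k s] ys by (simp add: funpow_swap1)
      then have "(p ^^ Suc k) ((p ^^ k) s) = s" using ppk[of "Suc k" s] by simp
      then have "(p ^^ (Suc k + k)) s = s" by (simp only: funpow_add comp_apply)
      then show ?thesis by (intro exI[of _ k]) (simp add: mult_2)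
    next
      assume e: "t = (p' ^^ k) s"
      then have f: "(p ^^ k) (p' s) = (p' ^^ k) s" using t yp'[of k s] ys by simp
      show ?thesis
      proof (cases k)
        case 0
        then have "p s = s" using f pp'(1)[of s] by simp
        then show ?thesis by (intro exI[of _ 0]) simp
      next
        case (Suc m)
        then have "(p ^^ m) s = (p' ^^ k) s" using f by (simp add: funpow_swap1 pp')
        then have "(p ^^ k) ((p ^^ m) s) = s" using ppk[of k s] by simp
        then have "(p ^^ (k + m)) s = s" by (simp only: funpow_add comp_apply)
        then show ?thesis using Suc by (intro exI[of _ m]) (simp add: mult_2)
      qed
    qed
  qed
  then obtain k where k: "(p ^^ (2 * k + 1)) s = s" by blast
  obtain j where j: "s' = (p ^^ j) s \<or> s' = (p' ^^ j) s" using walk s' by blast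
  then have eq: "(p ^^ j) s = (p' ^^ j) s" "s' = (p ^^ j) s" using xp[of j s] xp'[of j s] s s' by auto
  then have "(p ^^ (j + j)) s = s" using ppk[of j s] by (simp only: funpow_add comp_apply)
  then have e: "(p ^^ (2 * j)) s = s" by (simp add: mult_2)
  have iter: "(p ^^ (m * c)) s = s" if "(p ^^ c) s = s" for c m
    using that by (induction m) (simp_all add: funpow_add)
  have "(p ^^ (j * (2 * k + 1))) s = s" using iter k by blast
  moreover have "j * (2 * k + 1) = j + k * (2 * j)" by (simp add: algebra_simps)
  (* j = j (2 k + 1) - k (2 j) *)
  ultimately have "(p ^^ j) ((p ^^ (k * (2 * j))) s) = s" by (simp only: funpow_add comp_apply)
  then show ?thesis using iter[OF e, of k] eq by simp
qed

lemma finite_strings: "finite {s. s < n \<and> (u :: inf_link) s = s}" by (rule finite_subset[of _ "{..<n}"]) auto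

text \<open>
  Different strings of \<open>x\<close> are connected to different strings of \<open>y\<close>, and both states have the same number
  of strings, so no string of \<open>y\<close> is left over.
\<close>

lemma strings_connected_sym:
  assumes x: "x \<in> inf_link_states" and y: "y \<in> inf_link_states"
    and cl: "closed_ivl 0 n x" "closed_ivl 0 n y" and st: "strs 0 n x = strs 0 n y" and th: "strings_connected n x y"
  shows "strings_connected n y x"
proof -
  let ?S = "{s. s < n \<and> x s = s}" and ?T = "{s. s < n \<and> y s = s}"
  have "\<forall>s\<in>?S. \<exists>j. (s, j) \<in> conn n x y \<and> y j = j" using th by (auto simp: strings_connected_def)
  then obtain f where f: "\<And>s. s \<in> ?S \<Longrightarrow> (s, f s) \<in> conn n x y \<and> y (f s) = f s" by metis
  have "inj_on f ?S"
  proof (rule inj_onI)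
    fix s s' assume a: "s \<in> ?S" "s' \<in> ?S" "f s = f s'"
    have "(s, s') \<in> conn n x y"
      using f[OF a(1)] f[OF a(2)] a(3) conn_sym[OF x y cl] by (metis rtrancl_trans)
    then show "s = s'" using conn_string_unique[OF x y, of s s' n "f s"] f[OF a(1)] a by auto
  qed
  moreover have "f ` ?S \<subseteq> ?T"
  proof
    fix t assume "t \<in> f ` ?S"
    then obtain r where r: "r \<in> ?S" "t = f r" by (rule imageE)
    then have "t < n" using f[OF r(1)] conn_lt[OF cl, of r t] by simp
    then show "t \<in> ?T" using f[OF r(1)] r(2) by simp
  qed
  moreover have "card ?S = card ?T" using st by (simp add: strs_def)
  ultimately have "f ` ?S = ?T"
    using card_subset_eq[OF finite_strings[of n y], of "f ` ?S"] card_image[of f ?S] by simp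
  have "\<exists>j. (t, j) \<in> conn n y x \<and> x j = j" if "t < n" "y t = t" for t
  proof -
    have "t \<in> f ` ?S" unfolding \<open>f ` ?S = ?T\<close> using that by simp
    then obtain s where s: "s \<in> ?S" "t = f s" by (rule imageE)
    then have "(t, s) \<in> conn n x y" using f[OF s(1)] conn_sym[OF x y cl, of s t] by simp
    then show ?thesis unfolding arcs_sym[of n y x] using s(1) by blast
  qed
  then show ?thesis by (simp add: strings_connected_def)
qed

lemma loop_classes_sym: "loop_classes n x y = loop_classes n y x"
  unfolding loop_classes_def arcs_sym[of n x y] by blast

lemma form_sym:
  assumes "x \<in> inf_link_states" "y \<in> inf_link_states" "closed_ivl 0 n x" "closed_ivl 0 n y" "strs 0 n x = strs 0 n y"
  shows "form \<delta> n x y = form \<delta> n y x"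
  using strings_connected_sym[OF assms] strings_connected_sym[OF assms(2,1,4,3) assms(5)[symmetric]] loop_classes_sym[of n x y]
  by (auto simp: form_def)

text \<open>
  In the glued picture the strings of \<open>y\<close> at \<open>i\<close> and \<open>Suc i\<close> are connected to each other by the cup of \<open>x\<close>.
\<close>

lemma not_connected_both_strings:
  assumes x: "x \<in> inf_link_states" and y: "y \<in> inf_link_states"
    and cl: "closed_ivl 0 n x" "closed_ivl 0 n y" and st: "strs 0 n x = strs 0 n y"
    and i: "x i = Suc i" "Suc i < n" "both_strings i y"
  shows "\<not> strings_connected n x y"
proof
  assume "strings_connected n x y"
  then have "strings_connected n y x" using strings_connected_sym x y cl st by blast
  moreover have "i < n" "y i = i" using i by (auto simp: both_strings_def)
  ultimately obtain j where j: "(i, j) \<in> conn n y x" "x j = j" unfolding strings_connected_def by blast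
  have "x (Suc i) = i" using link_inv[OF x, of i] i by simp
  have "j \<in> {i, Suc i}" using j(1)
    by (induction rule: rtrancl_induct) (use i \<open>x (Suc i) = i\<close> in \<open>auto simp: arcs_def both_strings_def\<close>)
  then show False using j(2) i \<open>x (Suc i) = i\<close> by auto
qed

section \<open>The form and a single generator\<close>

text \<open>
  The state \<open>x\<close> has the cup \<open>{i, i+1}\<close> and \<open>e\<^sub>i\<close> acts on \<open>v\<close> without closing a loop. Gluing \<open>x\<close> to \<open>v\<close> or to
  \<open>e\<^sub>i v\<close> gives the same components on all other points: the detour through \<open>i\<close> and \<open>Suc i\<close> is replaced by the
  new cup of \<open>e\<^sub>i v\<close>. In the second picture \<open>{i, i+1}\<close> is in addition a loop of its own.
\<close>

locale turnback =
  fixes n i x v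
  assumes x: "x \<in> inf_link_states" and v: "v \<in> inf_link_states"
    and clx: "closed_ivl 0 n x" and clv: "closed_ivl 0 n v"
    and i: "Suc i < n" "x i = Suc i" "v i \<noteq> Suc i" "\<not> both_strings i v"
begin

abbreviation "y \<equiv> E i v"
abbreviation "R \<equiv> conn n x v"
abbreviation "S \<equiv> conn n x y"
definition "M = {..<n} - {i, Suc i}"

lemma y: "y \<in> inf_link_states" and cly: "closed_ivl 0 n y"
  using E_states v i E_closed clv by auto

lemma xS: "x (Suc i) = i" using link_inv[OF x, of i] i by simp

lemma vS: "v (Suc i) \<noteq> i" using link_inv[OF v, of "Suc i"] i by auto

lemma M_x: "j \<in> M \<Longrightarrow> x j \<in> M"
proof -
  assume j: "j \<in> M"
  have "j \<noteq> i" "j \<noteq> Suc i" using j by (simp_all add: M_def)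
  then have "x j \<noteq> i" "x j \<noteq> Suc i" using link_inv[OF x, of j] i(2) xS by metis+
  moreover have "x j < n" using clx j unfolding closed_ivl_def M_def by simp
  ultimately show ?thesis by (simp add: M_def)
qed

lemma M_y: "j \<in> M \<Longrightarrow> y j \<in> M"
proof -
  assume j: "j \<in> M"
  have "j \<noteq> i" "j \<noteq> Suc i" using j by (simp_all add: M_def)
  then have "y j \<noteq> i" "y j \<noteq> Suc i" using link_inv[OF y, of j] E_cup[of i v] by metis+
  moreover have "y j < n" using cly j unfolding closed_ivl_def M_def by simp
  ultimately show ?thesis by (simp add: M_def)
qed

lemma y_M: "j \<in> M \<Longrightarrow> y j = (if v j = i then (if v (Suc i) = Suc i then j else v (Suc i))
      else if v j = Suc i then (if v i = i then j else v i) else v j)"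
  by (simp add: M_def E_def)

lemma v_out: "v j = i \<longleftrightarrow> j = v i" "v j = Suc i \<longleftrightarrow> j = v (Suc i)"
  using link_inv[OF v] by metis+

lemma v_lt: "j < n \<Longrightarrow> v j < n" using clv by (auto simp: closed_ivl_def)

lemma S_M: "(j, k) \<in> S \<Longrightarrow> j \<in> M \<Longrightarrow> k \<in> M"
proof (induction rule: rtrancl_induct)
  case (step k k')
  then show ?case using M_x M_y by (auto simp: arcs_def)
qed simp

lemma step_S: "j \<in> M \<Longrightarrow> (j, x j) \<in> S" "j \<in> M \<Longrightarrow> (j, y j) \<in> S"
  by (auto simp: arcs_def M_def intro!: r_into_rtrancl)

lemma step_R: "j < n \<Longrightarrow> (j, x j) \<in> R" "j < n \<Longrightarrow> (j, v j) \<in> R"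
  by (auto simp: arcs_def intro!: r_into_rtrancl)

lemma R_i: "(i, Suc i) \<in> R" "(Suc i, i) \<in> R"
  using step_R(1)[of i] step_R(1)[of "Suc i"] i xS by auto

lemma R_y: "j \<in> M \<Longrightarrow> (j, y j) \<in> R"
proof -
  assume j: "j \<in> M"
  then have jn: "j < n" by (simp add: M_def)
  consider "v j \<noteq> i" "v j \<noteq> Suc i" | "v j = i" | "v j = Suc i" by blast
  then show ?thesis
  proof cases
    case 1 then show ?thesis using y_M[OF j] step_R(2)[OF jn] by simp
  next
    case 2
    then have "(j, i) \<in> R" using step_R(2)[OF jn] by simp
    then have "(j, v (Suc i)) \<in> R" using R_i step_R(2)[of "Suc i"] i by (meson rtrancl_trans)
    then show ?thesis using y_M[OF j] 2 by simp
  next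
    case 3
    then have "(j, Suc i) \<in> R" using step_R(2)[OF jn] by simp
    then have "(j, v i) \<in> R" using R_i step_R(2)[of i] i by (meson rtrancl_trans Suc_lessD)
    then show ?thesis using y_M[OF j] 3 by simp
  qed
qed

lemma S_R: "(j, k) \<in> S \<Longrightarrow> j \<in> M \<Longrightarrow> (j, k) \<in> R"
proof (induction rule: rtrancl_induct)
  case (step k k')
  then have "k \<in> M" using S_M by blast
  then have "(k, k') \<in> R" using step.hyps(2) R_y step_R(1) by (auto simp: arcs_def)
  then show ?case using step by (meson rtrancl_trans)
qed simp

text \<open>
  A path of the first picture is followed in the second one. While it visits \<open>i\<close> or \<open>Suc i\<close>, both points at
  which it can leave are kept connected.
\<close>

lemma R_S_aux:
  "(j, k) \<in> R \<Longrightarrow> j \<in> M \<Longrightarrow>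
    (if k \<in> M then (j, k) \<in> S else k < n \<and> (\<forall>m\<in>{v i, v (Suc i)} \<inter> M. (j, m) \<in> S))"
proof (induction rule: rtrancl_induct)
  case (step k k')
  note IH = step.IH[OF step.prems]
  have k': "k < n" "k' = x k \<or> k' = v k" using step.hyps(2) by (auto simp: arcs_def)
  show ?case
  proof (cases "k \<in> M")
    case True
    then have jk: "(j, k) \<in> S" using IH by simp
    have jy: "(j, y k) \<in> S" using jk step_S(2)[OF True] by (meson rtrancl_trans)
    show ?thesis
    proof (cases "k' = x k")
      case t: True
      then have "k' \<in> M" "(j, k') \<in> S" using M_x[OF True] jk step_S(1)[OF True] by (auto intro: rtrancl_trans)
      then show ?thesis by simp
    next
      case False
      then have k'v: "k' = v k" using k' by blast
      have k'n: "k' < n" using k'v v_lt k' by simp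
      consider "v k \<noteq> i" "v k \<noteq> Suc i" | "v k = i" | "v k = Suc i" by blast
      then show ?thesis
      proof cases
        case 1
        then show ?thesis using jy y_M[OF True] k'v k'n by (simp add: M_def)
      next
        case 2
        have "(j, m) \<in> S" if "m \<in> {v i, v (Suc i)} \<inter> M" for m
          using that jk jy y_M[OF True] 2 v_out(1)[of k] by (auto simp: M_def split: if_splits)
        then show ?thesis using 2 k'v k'n by (simp add: M_def)
      next
        case 3
        have "(j, m) \<in> S" if "m \<in> {v i, v (Suc i)} \<inter> M" for m
          using that jk jy y_M[OF True] 3 v_out(2)[of k] by (auto simp: M_def split: if_splits)
        then show ?thesis using 3 k'v k'n by (simp add: M_def)
      qed
    qed
  next
    case False
    then have k: "k = i \<or> k = Suc i" using k' by (auto simp: M_def)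
    have "v i = i \<or> v i \<in> M" "v (Suc i) = Suc i \<or> v (Suc i) \<in> M"
      using v_lt[of i] v_lt[of "Suc i"] i vS by (simp_all add: M_def)
    then have "k' \<in> {i, Suc i} \<or> (k' \<in> {v i, v (Suc i)} \<and> k' \<in> M)"
      using k'(2) k i(2) xS by (elim disjE) simp_all
    then consider "k' \<in> {i, Suc i}" | "k' \<in> {v i, v (Suc i)}" "k' \<in> M" by blast
    then show ?thesis
    proof cases
      case 1
      then have "k' \<notin> M" "k' < n" using i(1) by (auto simp: M_def)
      then show ?thesis using IH False by simp
    next
      case 2
      then show ?thesis using IH False by simp
    qed
  qed
qed simp

lemma R_iff_S: "j \<in> M \<Longrightarrow> k \<in> M \<Longrightarrow> (j, k) \<in> R \<longleftrightarrow> (j, k) \<in> S"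
  using R_S_aux S_R by metis

lemma S_i: "S `` {i} = {i, Suc i}" "S `` {Suc i} = {i, Suc i}"
proof -
  have "k \<in> {i, Suc i}" if "(j, k) \<in> S" "j \<in> {i, Suc i}" for j k
    using that by (induction rule: rtrancl_induct) (use i xS in \<open>auto simp: arcs_def\<close>)
  moreover have "(i, Suc i) \<in> S" "(Suc i, i) \<in> S"
    using i xS by (auto simp: arcs_def intro!: r_into_rtrancl)
  ultimately show "S `` {i} = {i, Suc i}" "S `` {Suc i} = {i, Suc i}" by auto
qed

lemma string_M: "j \<in> M \<Longrightarrow> y j = j \<Longrightarrow> \<exists>k. (j, k) \<in> R \<and> v k = k"
proof -
  assume j: "j \<in> M" "y j = j"
  have jn: "j < n" using j by (simp add: M_def)
  consider "v j \<noteq> i" "v j \<noteq> Suc i" | "v j = i" | "v j = Suc i" by blast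
  then show ?thesis
  proof cases
    case 1 then show ?thesis using y_M[OF j(1)] j by auto
  next
    case 2
    have "v (Suc i) \<noteq> j" using v_out(1)[of j] 2 link_eq_iff[OF v, of i "Suc i"] by auto
    then have "v (Suc i) = Suc i" using y_M[OF j(1)] j(2) 2 by (auto split: if_splits)
    moreover have "(j, i) \<in> R" using step_R(2)[OF jn] 2 by simp
    then have "(j, Suc i) \<in> R" using R_i by (meson rtrancl_trans)
    ultimately show ?thesis by blast
  next
    case 3
    have "v i \<noteq> j" using v_out(2)[of j] 3 link_eq_iff[OF v, of i "Suc i"] by auto
    then have "v i = i" using y_M[OF j(1)] j(2) 3 by (auto split: if_splits)
    moreover have "(j, Suc i) \<in> R" using step_R(2)[OF jn] 3 by simp
    then have "(j, i) \<in> R" using R_i by (meson rtrancl_trans)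
    ultimately show ?thesis by blast
  qed
qed

lemma string_R: "j \<in> M \<Longrightarrow> (j, k) \<in> R \<Longrightarrow> v k = k \<Longrightarrow> \<exists>m. (j, m) \<in> S \<and> y m = m"
proof -
  assume a: "j \<in> M" "(j, k) \<in> R" "v k = k"
  have kn: "k < n" using a conn_lt[OF clx clv a(2)] by (simp add: M_def)
  consider "k \<in> M" | "k = i" | "k = Suc i" using kn by (auto simp: M_def)
  then show ?thesis
  proof cases
    case 1
    then have "y k = k" using y_M a(3) by (auto simp: M_def)
    then show ?thesis using R_iff_S 1 a by blast
  next
    case 2
    have m: "v (Suc i) \<in> M" using 2 a(3) i vS v_lt by (auto simp: M_def both_strings_def)
    then have "y (v (Suc i)) = v (Suc i)" using y_M[OF m] link_inv[OF v, of "Suc i"] 2 a(3) by auto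
    then show ?thesis using R_S_aux[OF a(2,1)] 2 m by (auto simp: M_def)
  next
    case 3
    have m: "v i \<in> M" using 3 a(3) i v_lt by (auto simp: M_def both_strings_def)
    then have "y (v i) = v i" using y_M[OF m] link_inv[OF v, of i] 3 a(3) by auto
    then show ?thesis using R_S_aux[OF a(2,1)] 3 m by (auto simp: M_def)
  qed
qed

lemma strings_connected_iff: "strings_connected n x v \<longleftrightarrow> strings_connected n x y"
proof -
  have "(\<exists>j. (s, j) \<in> R \<and> v j = j) \<longleftrightarrow> (\<exists>j. (s, j) \<in> S \<and> y j = j)" if "s < n" "x s = s" for s
  proof -
    have s: "s \<in> M" using that i xS by (auto simp: M_def)
    show ?thesis
    proof
      assume "\<exists>j. (s, j) \<in> R \<and> v j = j"
      then show "\<exists>j. (s, j) \<in> S \<and> y j = j" using string_R s by blast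
    next
      assume "\<exists>j. (s, j) \<in> S \<and> y j = j"
      then obtain j where j: "(s, j) \<in> S" "y j = j" by blast
      then obtain k where "(j, k) \<in> R" "v k = k" using string_M S_M s by blast
      then show "\<exists>j. (s, j) \<in> R \<and> v j = j" using S_R[OF j(1) s] by (meson rtrancl_trans)
    qed
  qed
  then show ?thesis unfolding strings_connected_def by blast
qed

lemma class_S: "j \<in> M \<Longrightarrow> S `` {j} = R `` {j} - {i, Suc i}"
proof -
  assume j: "j \<in> M"
  have "k \<in> M" if "(j, k) \<in> R" "k \<noteq> i" "k \<noteq> Suc i" for k
    using conn_lt[OF clx clv that(1)] that j by (auto simp: M_def)
  then show ?thesis using R_iff_S[OF j] S_M j by (auto simp: M_def)
qed

lemma class_no_string: "j \<in> M \<Longrightarrow>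
  (\<forall>k\<in>R `` {j}. x k \<noteq> k \<and> v k \<noteq> k) \<longleftrightarrow> (\<forall>k\<in>S `` {j}. x k \<noteq> k \<and> y k \<noteq> k)"
proof -
  assume j: "j \<in> M"
  have mem: "k \<in> S `` {j} \<longleftrightarrow> k \<in> R `` {j} \<and> k \<noteq> i \<and> k \<noteq> Suc i" for k
    unfolding class_S[OF j] by blast
  have "x i \<noteq> i" "x (Suc i) \<noteq> Suc i" using i xS by simp_all
  then have "(\<forall>k\<in>R `` {j}. x k \<noteq> k) \<longleftrightarrow> (\<forall>k\<in>S `` {j}. x k \<noteq> k)"
    using mem by metis
  moreover have "(\<forall>k\<in>R `` {j}. v k \<noteq> k) \<longleftrightarrow> (\<forall>k\<in>S `` {j}. y k \<noteq> k)"
  proof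
    assume a: "\<forall>k\<in>R `` {j}. v k \<noteq> k"
    show "\<forall>k\<in>S `` {j}. y k \<noteq> k"
    proof (intro ballI notI)
      fix k assume k: "k \<in> S `` {j}" "y k = k"
      then have jk: "(j, k) \<in> S" by simp
      obtain m where m: "(k, m) \<in> R" "v m = m" using string_M[OF S_M[OF jk j] k(2)] by blast
      have "(j, m) \<in> R" using S_R[OF jk j] m(1) by (rule rtrancl_trans)
      then show False using a m(2) by blast
    qed
  next
    assume a: "\<forall>k\<in>S `` {j}. y k \<noteq> k"
    show "\<forall>k\<in>R `` {j}. v k \<noteq> k"
    proof (intro ballI notI)
      fix k assume "k \<in> R `` {j}" "v k = k"
      then obtain m where "(j, m) \<in> S" "y m = m" using string_R[OF j] by blast
      then show False using a by blast
    qed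
  qed
  ultimately show ?thesis by blast
qed

lemma R_class_eq:
  assumes "(j, k) \<in> R"
  shows "R `` {j} = R `` {k}"
proof (intro equalityI subsetI)
  fix m assume "m \<in> R `` {j}"
  then show "m \<in> R `` {k}" using conn_sym[OF x v clx clv assms] rtrancl_trans[of k j _ m] by simp
next
  fix m assume "m \<in> R `` {k}"
  then show "m \<in> R `` {j}" using assms rtrancl_trans[of j k _ m] by simp
qed

text \<open>
  Deleting \<open>i\<close> and \<open>Suc i\<close> maps the loops of the first picture injectively to those of the second, and
  misses only the loop \<open>{i, i+1}\<close>.
\<close>

lemma card_loops: "card (loop_classes n x y) = Suc (card (loop_classes n x v))"
proof -
  let ?f = "\<lambda>C. C - {i, Suc i}"
  let ?LR = "loop_classes n x v" and ?LS = "loop_classes n x y"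
  have rep: "\<exists>j\<in>M. C = R `` {j} \<and> (\<forall>k\<in>C. x k \<noteq> k \<and> v k \<noteq> k)" if C: "C \<in> ?LR" for C
  proof -
    obtain j where j: "j < n" "C = R `` {j}" "\<forall>k\<in>C. x k \<noteq> k \<and> v k \<noteq> k"
      using C by (auto simp: loop_classes_def)
    show ?thesis
    proof (cases "j \<in> M")
      case False
      then have "j = i \<or> j = Suc i" using j by (auto simp: M_def)
      then have ji: "(j, i) \<in> R" using R_i by auto
      then have "v i \<noteq> i" using j(2,3) by blast
      then have m: "v i \<in> M" using i v_lt by (auto simp: M_def)
      have "(j, v i) \<in> R" using ji step_R(2)[of i] i by (meson rtrancl_trans Suc_lessD)
      then have "R `` {j} = R `` {v i}" by (rule R_class_eq)
      then show ?thesis using m j by blast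
    qed (use j in blast)
  qed
  have "?LS = insert {i, Suc i} (?f ` ?LR)"
  proof (intro equalityI subsetI)
    fix C assume C: "C \<in> ?LS"
    then obtain j where j: "j < n" "C = S `` {j}" "\<forall>k\<in>C. x k \<noteq> k \<and> y k \<noteq> k"
      by (auto simp: loop_classes_def)
    show "C \<in> insert {i, Suc i} (?f ` ?LR)"
    proof (cases "j \<in> M")
      case False
      then have "j = i \<or> j = Suc i" using j by (auto simp: M_def)
      then have "C = {i, Suc i}" unfolding j(2) using S_i by (elim disjE) simp_all
      then show ?thesis by (simp only: insertI1)
    next
      case True
      have "\<forall>k\<in>R `` {j}. x k \<noteq> k \<and> v k \<noteq> k" using class_no_string[OF True] j(2,3) by simp
      then have "R `` {j} \<in> ?LR" using j(1) unfolding loop_classes_def by blast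
      moreover have "C = ?f (R `` {j})" unfolding j(2) by (rule class_S[OF True])
      ultimately show ?thesis by blast
    qed
  next
    fix C assume "C \<in> insert {i, Suc i} (?f ` ?LR)"
    then consider "C = {i, Suc i}" | D where "D \<in> ?LR" "C = ?f D" by blast
    then show "C \<in> ?LS"
    proof cases
      case 1
      have "\<forall>k\<in>S `` {i}. x k \<noteq> k \<and> y k \<noteq> k" unfolding S_i using i xS by simp
      then have "S `` {i} \<in> ?LS" unfolding loop_classes_def using i(1) Suc_lessD by blast
      then show ?thesis unfolding 1 S_i .
    next
      case 2
      then obtain j where j: "j \<in> M" "D = R `` {j}" "\<forall>k\<in>D. x k \<noteq> k \<and> v k \<noteq> k" using rep by blast
      then have "C = S `` {j}" using class_S 2 by simp
      moreover have "\<forall>k\<in>C. x k \<noteq> k \<and> y k \<noteq> k"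
        using class_no_string[OF j(1)] j(3) unfolding calculation j(2) by simp
      moreover have "j < n" using j(1) by (simp add: M_def)
      ultimately show ?thesis unfolding loop_classes_def by blast
    qed
  qed
  moreover have "inj_on ?f ?LR"
  proof (rule inj_onI)
    fix C D assume C: "C \<in> ?LR" and D: "D \<in> ?LR" and e: "?f C = ?f D"
    obtain j where j: "j \<in> M" "C = R `` {j}" using rep[OF C] by blast
    obtain k where k: "k \<in> M" "D = R `` {k}" using rep[OF D] by blast
    have "j \<in> ?f C" using j by (simp add: M_def)
    then have "j \<in> ?f D" unfolding e .
    then have "(k, j) \<in> R" using k by simp
    then show "C = D" using R_class_eq j k by simp
  qed
  moreover have "{i, Suc i} \<notin> ?f ` ?LR" by auto
  moreover have "finite ?LR"
    by (rule finite_subset[of _ "(\<lambda>j. R `` {j}) ` {..<n}"]) (auto simp: loop_classes_def)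
  ultimately show ?thesis by (simp add: card_image)
qed

lemma form_E: "form \<delta> n x y = \<delta> * form \<delta> n x v"
  by (simp add: form_def strings_connected_iff card_loops)

end

text \<open>
  The coefficient with which \<open>e\<^sub>i\<close> maps \<open>u\<close> to \<open>E i u\<close>.
\<close>

definition weight :: "complex \<Rightarrow> nat \<Rightarrow> inf_link \<Rightarrow> complex" where
  "weight \<delta> i u = (if both_strings i u then 0 else if u i = Suc i then \<delta> else 1)"

lemma form_cup:
  assumes "x \<in> inf_link_states" "v \<in> inf_link_states" "closed_ivl 0 n x" "closed_ivl 0 n v"
    "strs 0 n x = strs 0 n v" "Suc i < n" "x i = Suc i"
  shows "weight \<delta> i v * form \<delta> n x (E i v) = \<delta> * form \<delta> n x v"
proof (cases "both_strings i v \<or> v i = Suc i")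
  case True
  then show ?thesis
    using not_connected_both_strings[OF assms(1-5) assms(7,6)] E_loop[OF assms(2)] by (auto simp: weight_def form_def both_strings_def)
next
  case False
  then interpret turnback n i x v by unfold_locales (use assms in auto)
  show ?thesis using False form_E by (simp add: weight_def)
qed

text \<open>
  If neither state has the cup \<open>{i, i+1}\<close>, both sides are compared with the pair \<open>E i u\<close>, \<open>E i v\<close>, which has
  exactly one more loop than either.
\<close>

lemma form_adjoint:
  assumes u: "u \<in> inf_link_states" "closed_ivl 0 n u" and v: "v \<in> inf_link_states" "closed_ivl 0 n v"
    and s: "strs 0 n u = strs 0 n v" and i: "Suc i < n"
  shows "weight \<delta> i u * form \<delta> n (E i u) v = weight \<delta> i v * form \<delta> n u (E i v)"
proof -
  have Eprop: "E i z \<in> inf_link_states \<and> closed_ivl 0 n (E i z) \<and> strs 0 n (E i z) = strs 0 n z"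
    if "z \<in> inf_link_states" "closed_ivl 0 n z" "\<not> both_strings i z" for z
    using that i E_states E_closed strs_E by auto
  have half: "weight \<delta> i a * form \<delta> n (E i a) b = weight \<delta> i b * form \<delta> n a (E i b)"
    if a: "a \<in> inf_link_states" "closed_ivl 0 n a" and b: "b \<in> inf_link_states" "closed_ivl 0 n b"
      and st: "strs 0 n a = strs 0 n b" and c: "a i = Suc i" for a b
  proof -
    have "weight \<delta> i b * form \<delta> n a (E i b) = \<delta> * form \<delta> n a b"
      using form_cup[OF a(1) b(1) a(2) b(2) st i c] .
    moreover have "weight \<delta> i a = \<delta>" "E i a = a" using c E_loop[OF a(1) c] by (auto simp: weight_def both_strings_def)
    ultimately show ?thesis by simp
  qed
  have both_strings: "0 = weight \<delta> i b * form \<delta> n a (E i b)"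
    if a: "a \<in> inf_link_states" "closed_ivl 0 n a" and b: "b \<in> inf_link_states" "closed_ivl 0 n b"
      and st: "strs 0 n a = strs 0 n b" and d: "both_strings i a" for a b
  proof (cases "both_strings i b")
    case False
    have "\<not> strings_connected n (E i b) a"
      by (rule not_connected_both_strings[of _ _ _ i]) (use Eprop[OF b False] a st d i in auto)
    then show ?thesis using form_sym[of a "E i b" n \<delta>] Eprop[OF b False] a st by (simp add: form_def)
  qed (simp add: weight_def)
  consider "both_strings i u" | "both_strings i v" | "u i = Suc i" | "v i = Suc i"
    | "\<not> both_strings i u" "\<not> both_strings i v" "u i \<noteq> Suc i" "v i \<noteq> Suc i" by blast
  then show ?thesis
  proof cases
    case 1 then show ?thesis using both_strings[OF u v s] by (simp add: weight_def)
  next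
    case 2
    have "weight \<delta> i u * form \<delta> n (E i u) v = weight \<delta> i u * form \<delta> n v (E i u)"
    proof (cases "both_strings i u")
      case False
      then show ?thesis using form_sym[of v "E i u" n \<delta>] Eprop[OF u False] v s by simp
    qed (simp add: weight_def)
    moreover have "weight \<delta> i v = 0" using 2 by (simp add: weight_def)
    ultimately show ?thesis using both_strings[OF v u s[symmetric] 2] by simp
  next
    case 3 then show ?thesis using half[OF u v s] by blast
  next
    case 4
    have nd: "\<not> both_strings i v" "weight \<delta> i v = \<delta>" "E i v = v" using 4 E_loop[OF v(1)] by (auto simp: both_strings_def weight_def)
    have "weight \<delta> i u * form \<delta> n (E i u) v = weight \<delta> i u * form \<delta> n v (E i u)"
    proof (cases "both_strings i u")
      case False
      then show ?thesis using form_sym[of v "E i u" n \<delta>] Eprop[OF u False] v s by simp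
    qed (simp add: weight_def)
    then show ?thesis using half[OF v u s[symmetric] 4] form_sym[OF u(1) v(1) u(2) v(2) s] nd by simp
  next
    case 5
    note pu = Eprop[OF u 5(1)] and pv = Eprop[OF v 5(2)]
    interpret A: turnback n i "E i u" v by unfold_locales (use pu v i 5 in auto)
    interpret B: turnback n i "E i v" u by unfold_locales (use pv u i 5 in auto)
    have "card (loop_classes n (E i u) v) = card (loop_classes n u (E i v))"
      using A.card_loops B.card_loops loop_classes_sym[of n "E i u" "E i v"] loop_classes_sym[of n "E i v" u] by simp
    moreover have "strings_connected n (E i u) v \<longleftrightarrow> strings_connected n u (E i v)"
    proof -
      have "strings_connected n (E i u) v \<longleftrightarrow> strings_connected n (E i u) (E i v)" by (rule A.strings_connected_iff)
      also have "\<dots> \<longleftrightarrow> strings_connected n (E i v) (E i u)" using strings_connected_sym pu pv s by metis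
      also have "\<dots> \<longleftrightarrow> strings_connected n (E i v) u" using B.strings_connected_iff by simp
      also have "\<dots> \<longleftrightarrow> strings_connected n u (E i v)" using strings_connected_sym pv u s by metis
      finally show ?thesis .
    qed
    ultimately show ?thesis using 5 by (simp add: weight_def form_def)
  qed
qed

section \<open>Pairing with a canonical state\<close>

text \<open>
  The word \<open>e\<^sub>0 e\<^sub>2 e\<^sub>4 ...\<close> of \<open>p\<close> letters. On a closed initial interval, it maps every state with \<open>p\<close> cups
  there to a multiple of the canonical one.
\<close>

definition cap_word :: "nat \<Rightarrow> nat list" where
  "cap_word p = map (\<lambda>k. 2 * k) [0..<p]"

lemma conn_self:
  assumes "c \<in> inf_link_states" "closed_ivl 0 n c" "i < n"
  shows "conn n c c `` {i} = {i, c i}"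
proof -
  have "j \<in> {i, c i}" if "(i, j) \<in> conn n c c" for j
    using that link_inv[OF assms(1)] by (induction rule: rtrancl_induct) (auto simp: arcs_def)
  moreover have "(i, c i) \<in> conn n c c" using assms by (auto simp: arcs_def intro!: r_into_rtrancl)
  ultimately show ?thesis by auto
qed

lemma card_loops_canon:
  assumes c: "c \<in> inf_link_states" "canon 0 n p c"
  shows "card (loop_classes n c c) = p"
proof -
  have cl: "closed_ivl 0 n c" using canon_closed c by blast
  have fl: "c (2 * k) = Suc (2 * k)" "c (Suc (2 * k)) = 2 * k" if "k < p" for k
    using c that by (auto simp: canon_def flat_def)
  have p: "2 * p \<le> n" using c by (simp add: canon_def)
  have st: "c k = k" if "2 * p \<le> k" "k < n" for k using c that by (simp add: canon_def)
  have "loop_classes n c c = (\<lambda>k. {2 * k, Suc (2 * k)}) ` {..<p}"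
  proof (intro equalityI subsetI)
    fix C assume "C \<in> loop_classes n c c"
    then obtain i where i: "i < n" "C = conn n c c `` {i}" "\<forall>j\<in>C. c j \<noteq> j" by (auto simp: loop_classes_def)
    then have C: "C = {i, c i}" using conn_self[OF c(1) cl i(1)] by simp
    have "i < 2 * p" using i(1,3) st[of i] C by (metis insertI1 not_le)
    then have k: "i div 2 < p" by simp
    have "i = 2 * (i div 2) \<or> i = Suc (2 * (i div 2))" by presburger
    then have "C = {2 * (i div 2), Suc (2 * (i div 2))}" using C fl[OF k] by (metis insert_commute)
    then show "C \<in> (\<lambda>k. {2 * k, Suc (2 * k)}) ` {..<p}" using k by blast
  next
    fix C assume "C \<in> (\<lambda>k. {2 * k, Suc (2 * k)}) ` {..<p}"
    then obtain k where k: "k < p" "C = {2 * k, Suc (2 * k)}" by blast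
    then have "2 * k < n" "C = conn n c c `` {2 * k}" using p conn_self[OF c(1) cl, of "2 * k"] fl[OF k(1)] by simp_all
    moreover have "\<forall>j\<in>C. c j \<noteq> j \<and> c j \<noteq> j" using k fl by simp
    ultimately show "C \<in> loop_classes n c c" unfolding loop_classes_def by blast
  qed
  moreover have "inj_on (\<lambda>k. {2 * k, Suc (2 * k)}) {..<p}"
  proof (rule inj_onI)
    fix j k :: nat assume "{2 * j, Suc (2 * j)} = {2 * k, Suc (2 * k)}"
    then have "2 * j \<in> {2 * k, Suc (2 * k)}" by (metis insertI1)
    then show "j = k" by (simp, presburger)
  qed
  ultimately show ?thesis by (simp add: card_image)
qed

text \<open>
  The canonical state has all cups that the letters impose. So each letter either closes a loop, or adds
  a loop to the picture glued with the canonical state, unless it kills because two strings of that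
  picture are connected to each other.
\<close>

lemma cap_word_count:
  assumes c: "c \<in> inf_link_states" "canon 0 n p c"
    and u: "u \<in> inf_link_states" "closed_ivl 0 n u" "strs 0 n u = strs 0 n c"
    and g: "\<forall>i\<in>set g. \<exists>k<p. i = 2 * k"
  shows "case wact g u of None \<Rightarrow> \<not> strings_connected n c u
    | Some (k, v) \<Rightarrow> (strings_connected n c v \<longleftrightarrow> strings_connected n c u) \<and>
        card (loop_classes n c v) + k = card (loop_classes n c u) + length g"
  using g
proof (induction g)
  case Nil then show ?case by simp
next
  case (Cons i g)
  have cl: "closed_ivl 0 n c" using canon_closed c by blast
  obtain k0 where k0: "k0 < p" "i = 2 * k0" using Cons.prems by auto
  have i: "Suc i < n" "c i = Suc i" using c k0 by (auto simp: canon_def flat_def)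
  have ins: "inside 0 n g"
    unfolding inside_def
  proof
    fix j assume "j \<in> set g"
    then obtain k where "k < p" "j = 2 * k" using Cons.prems by auto
    then show "0 \<le> j \<and> Suc j < n" using c by (auto simp: canon_def)
  qed
  show ?case
  proof (cases "wact g u")
    case None then show ?thesis using Cons by simp
  next
    case (Some a)
    obtain k v where a: "a = (k, v)" by fastforce
    have w: "wact g u = Some (k, v)" using Some a by simp
    then have IH: "strings_connected n c v \<longleftrightarrow> strings_connected n c u"
        "card (loop_classes n c v) + k = card (loop_classes n c u) + length g"
      using Cons by simp_all
    have v: "v \<in> inf_link_states" using wact_link w u by blast
    have pv: "closed_ivl 0 n v" "strs 0 n v = strs 0 n u" using wact_props[OF w ins u(1,2)] by auto
    consider "both_strings i v" | "\<not> both_strings i v" "v i = Suc i" | "\<not> both_strings i v" "v i \<noteq> Suc i" by blast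
    then show ?thesis
    proof cases
      case 1
      then have "\<not> strings_connected n c v" using not_connected_both_strings[OF c(1) v cl pv(1) _ i(2,1)] pv u by simp
      then show ?thesis using w 1 IH by simp
    next
      case 2
      then show ?thesis using w IH E_loop[OF v] by simp
    next
      case 3
      interpret turnback n i c v by unfold_locales (use c v cl pv i 3 in auto)
      show ?thesis using w 3 IH strings_connected_iff card_loops by simp
    qed
  qed
qed

lemma cap_word_flat:
  assumes "wact (cap_word p) u = Some (k, v)" "u \<in> inf_link_states"
  shows "flat 0 p v"
proof -
  have "v j = Suc j \<and> v (Suc j) = j"
    if "wact g u = Some (k, v)" "\<forall>i\<in>set g. even i" "j \<in> set g" for g j k v
    using that
  proof (induction g arbitrary: k v)
    case (Cons i g)
    then obtain k' v' where v': "wact g u = Some (k', v')" "v = E i v'"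
      by (auto simp: wact_Cons_Some simp del: wact.simps(2))
    show ?case
    proof (cases "j = i")
      case False
      then have "v' j = Suc j \<and> v' (Suc j) = j" using Cons v' by auto
      moreover have "even i" "even j" using Cons.prems by auto
      then have "Suc j \<noteq> i" "j \<noteq> Suc i" by auto
      ultimately show ?thesis using v'(2) False by (auto simp: E_def)
    qed (use v' in simp)
  qed simp
  moreover have "\<forall>i\<in>set (cap_word p). even i" by (auto simp: cap_word_def)
  ultimately have "v j = Suc j \<and> v (Suc j) = j" if "j \<in> set (cap_word p)" for j
    using assms(1) that by blast
  moreover have "2 * k \<in> set (cap_word p)" if "k < p" for k using that by (simp add: cap_word_def)
  ultimately show ?thesis unfolding flat_def by simp
qed

text \<open>
  Pairing with the canonical state is realised by a word: no cups are left for the points after the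
  imposed ones, so the result is canonical, and the loops closed on the way are those of the form.
\<close>

lemma cap_word_canon:
  assumes c: "c \<in> inf_link_states" "canon 0 n p c"
    and u: "u \<in> inf_link_states" "closed_ivl 0 n u" "strs 0 n u = strs 0 n c" "\<forall>k\<ge>n. u k = c k"
  shows "wact (cap_word p) u = (if strings_connected n c u then Some (card (loop_classes n c u), c) else None)"
proof -
  have g: "\<forall>i\<in>set (cap_word p). \<exists>k<p. i = 2 * k" by (auto simp: cap_word_def)
  have p: "2 * p \<le> n" using c by (simp add: canon_def)
  then have ins: "inside 0 n (cap_word p)" by (auto simp: inside_def cap_word_def)
  note cnt = cap_word_count[OF c u(1-3) g]
  show ?thesis
  proof (cases "wact (cap_word p) u")
    case None then show ?thesis using cnt by simp
  next
    case (Some a)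
    obtain k v where a: "a = (k, v)" by fastforce
    have w: "wact (cap_word p) u = Some (k, v)" using Some a by simp
    have v: "v \<in> inf_link_states" using wact_link w u by blast
    have pv: "strs 0 n v = strs 0 n u" "\<And>k. n \<le> k \<Longrightarrow> v k = u k" using wact_props[OF w ins u(1,2)] by auto
    have fl: "flat 0 p v" using cap_word_flat w u by blast
    have fc: "flat 0 p c" using c by (simp add: canon_def)
    have low: "v j = c j" if "j < 2 * p" for j
    proof -
      have "j div 2 < p" "j = 2 * (j div 2) \<or> j = Suc (2 * (j div 2))" using that by (simp, presburger)
      then show ?thesis using fl fc unfolding flat_def by (metis add_0)
    qed
    then have "strs 0 (2 * p) v = strs 0 (2 * p) c" by (intro strs_cong) simp
    then have "strs (2 * p) n v = strs (2 * p) n c"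
      using strs_split[of 0 "2 * p" n v] strs_split[of 0 "2 * p" n c] p pv(1) u(3) by simp
    moreover have "strs (2 * p) n c = n - 2 * p"
      using c p by (subst strs_all_iff) (auto simp: canon_def)
    ultimately have "\<forall>k. 2 * p \<le> k \<and> k < n \<longrightarrow> v k = k" using strs_all_iff[OF p, of v] by simp
    then have "v j = c j" for j
      using low[of j] pv(2)[of j] u(4) c(2) unfolding canon_def
      by (metis add_0 linorder_not_less)
    then have vc: "v = c" by blast
    have "strings_connected n c c" unfolding strings_connected_def by blast
    then have "strings_connected n c u" "p + k = card (loop_classes n c u) + p"
      using cnt w vc card_loops_canon[OF c] by (simp_all add: cap_word_def)
    then show ?thesis using w vc by simp
  qed
qed

section \<open>Linear maps on finitely supported functions\<close>

lemma lookup_scl [simp]: "Poly_Mapping.lookup (scl c x) b = c * Poly_Mapping.lookup x b"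
  by (simp add: scl_def Poly_Mapping.map.rep_eq when_def)

lemma keys_scl: "Poly_Mapping.keys (scl c x) \<subseteq> Poly_Mapping.keys x"
  by (auto simp: in_keys_iff)

lemma scl_simps [simp]: "scl c 0 = 0" "scl 0 x = 0" "scl 1 x = x" "scl c (scl d x) = scl (c * d) x"
  "scl c (Poly_Mapping.single b d) = Poly_Mapping.single b (c * d)"
  by (rule poly_mapping_eqI; simp add: lookup_single when_def)+

lemma scl_add: "scl c (x + y) = scl c x + scl c y" "scl (c + d) x = scl c x + scl d x"
  by (rule poly_mapping_eqI; simp add: lookup_add algebra_simps)+

lemma scl_sum: "scl c (sum f A) = (\<Sum>a\<in>A. scl c (f a))"
  by (induction A rule: infinite_finite_induct) (simp_all add: scl_add)

lemma scl_neg: "scl (- 1) x = - x"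
  by (rule poly_mapping_eqI) simp

text \<open>
  The linear functional with values \<open>f\<close> on the basis.
\<close>

definition lin_val :: "('b \<Rightarrow> complex) \<Rightarrow> ('b \<Rightarrow>\<^sub>0 complex) \<Rightarrow> complex" where
  "lin_val f x = (\<Sum>u\<in>Poly_Mapping.keys x. Poly_Mapping.lookup x u * f u)"

lemma lin_val_superset:
  assumes "finite A" "Poly_Mapping.keys x \<subseteq> A"
  shows "lin_val f x = (\<Sum>u\<in>A. Poly_Mapping.lookup x u * f u)"
  unfolding lin_val_def by (rule sum.mono_neutral_left) (use assms in \<open>auto simp: in_keys_iff\<close>)

lemma lin_val_add: "lin_val f (x + y) = lin_val f x + lin_val f y"
proof -
  let ?A = "Poly_Mapping.keys x \<union> Poly_Mapping.keys y"
  have "lin_val f (x + y) = (\<Sum>u\<in>?A. Poly_Mapping.lookup (x + y) u * f u)"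
    by (rule lin_val_superset) (use keys_add[of x y] in auto)
  also have "\<dots> = (\<Sum>u\<in>?A. Poly_Mapping.lookup x u * f u) + (\<Sum>u\<in>?A. Poly_Mapping.lookup y u * f u)"
    by (simp add: lookup_add sum.distrib algebra_simps)
  also have "\<dots> = lin_val f x + lin_val f y" by (simp add: lin_val_superset[of ?A])
  finally show ?thesis .
qed

lemma lin_val_scl: "lin_val f (scl c x) = c * lin_val f x"
  by (subst lin_val_superset[of "Poly_Mapping.keys x"]) (simp_all add: keys_scl lin_val_def sum_distrib_left mult_ac)

lemma lin_val_0 [simp]: "lin_val f 0 = 0" by (simp add: lin_val_def)

lemma lin_val_neg: "lin_val f (- x) = - lin_val f x" using lin_val_scl[of f "-1" x] by (simp add: scl_neg)

lemma lin_val_diff: "lin_val f (x - y) = lin_val f x - lin_val f y" using lin_val_add[of f x "-y"] by (simp add: lin_val_neg)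

lemma lin_val_single [simp]: "lin_val f (Poly_Mapping.single b c) = c * f b"
  by (subst lin_val_superset[of "{b}"]) auto

lemma lin_val_sum: "lin_val f (sum g A) = (\<Sum>a\<in>A. lin_val f (g a))"
  by (induction A rule: infinite_finite_induct) (simp_all add: lin_val_add)

lemma lookup_lin_ext: "Poly_Mapping.lookup (lin_ext f x) d = lin_val (\<lambda>b. Poly_Mapping.lookup (f b) d) x"
  by (simp add: lin_ext_def lin_val_def lookup_sum)

lemma lin_ext_add: "lin_ext f (x + y) = lin_ext f x + lin_ext f y"
  by (rule poly_mapping_eqI) (simp add: lookup_lin_ext lin_val_add lookup_add)

lemma lin_ext_scl: "lin_ext f (scl c x) = scl c (lin_ext f x)"
  by (rule poly_mapping_eqI) (simp add: lookup_lin_ext lin_val_scl)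

lemma lin_ext_0 [simp]: "lin_ext f 0 = 0" by (simp add: lin_ext_def)

lemma lin_ext_single [simp]: "lin_ext f (Poly_Mapping.single b c) = scl c (f b)"
  by (rule poly_mapping_eqI) (simp add: lookup_lin_ext)

lemma lin_val_lin_ext: "lin_val h (lin_ext f x) = lin_val (\<lambda>b. lin_val h (f b)) x"
  unfolding lin_ext_def lin_val_sum lin_val_scl by (simp add: lin_val_def)

lemma vec_sum: "x = (\<Sum>b\<in>Poly_Mapping.keys x. scl (Poly_Mapping.lookup x b) (Poly_Mapping.single b 1))"
  by (rule poly_mapping_eqI) (simp add: lookup_sum lookup_single when_def in_keys_iff)

lemma lin_ext_cong: "(\<And>b. b \<in> Poly_Mapping.keys x \<Longrightarrow> f b = g b) \<Longrightarrow> lin_ext f x = lin_ext g x"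
  by (simp add: lin_ext_def)

lemma keys_lin_ext: "Poly_Mapping.keys (lin_ext f x) \<subseteq> (\<Union>b\<in>Poly_Mapping.keys x. Poly_Mapping.keys (f b))"
proof
  fix d assume "d \<in> Poly_Mapping.keys (lin_ext f x)"
  then have "lin_val (\<lambda>b. Poly_Mapping.lookup (f b) d) x \<noteq> 0" by (simp add: in_keys_iff lookup_lin_ext)
  then obtain b where "b \<in> Poly_Mapping.keys x" "Poly_Mapping.lookup (f b) d \<noteq> 0"
    unfolding lin_val_def by (metis (no_types, lifting) mult_zero_right sum.neutral)
  then show "d \<in> (\<Union>b\<in>Poly_Mapping.keys x. Poly_Mapping.keys (f b))" by (auto simp: in_keys_iff)
qed

section \<open>The action on vectors\<close>

definition act :: "complex \<Rightarrow> nat list \<Rightarrow> inf_vec \<Rightarrow> inf_vec" where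
  "act \<delta> g = word_act \<delta> (Word g)"

abbreviation sg :: "inf_link \<Rightarrow> inf_vec" where "sg u \<equiv> Poly_Mapping.single u 1"

lemma act_Nil [simp]: "act \<delta> [] x = x" by (simp add: act_def word_act_def)

lemma act_Cons: "act \<delta> (i # g) x = lin_ext (e_link \<delta> i) (act \<delta> g x)" by (simp add: act_def word_act_def)

lemma act_append: "act \<delta> (g @ h) x = act \<delta> g (act \<delta> h x)"
  by (induction g) (simp_all add: act_Cons)

lemma act_add: "act \<delta> g (x + y) = act \<delta> g x + act \<delta> g y"
  by (induction g) (simp_all add: act_Cons lin_ext_add)

lemma act_scl: "act \<delta> g (scl c x) = scl c (act \<delta> g x)"
  by (induction g) (simp_all add: act_Cons lin_ext_scl)

lemma act_0 [simp]: "act \<delta> g 0 = 0"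
  by (induction g) (simp_all add: act_Cons)

lemma act_sum: "act \<delta> g (sum f A) = (\<Sum>a\<in>A. act \<delta> g (f a))"
  by (induction A rule: infinite_finite_induct) (simp_all add: act_add)

lemma act_diff: "act \<delta> g (x - y) = act \<delta> g x - act \<delta> g y"
  using act_add[of \<delta> g "x - y" y] by simp

lemma act_eq_lin_ext: "act \<delta> g x = lin_ext (\<lambda>u. act \<delta> g (sg u)) x"
  by (subst vec_sum[of x]) (simp only: act_sum act_scl lin_ext_def)

lemma e_link_weight: "u \<in> inf_link_states \<Longrightarrow> e_link \<delta> i u = Poly_Mapping.single (E i u) (weight \<delta> i u)"
  by (simp add: e_link_E weight_def)

text \<open>
  The link between vectors and the combinatorics of words.
\<close>

lemma act_wact:
  assumes "u \<in> inf_link_states"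
  shows "act \<delta> g (sg u) = (case wact g u of None \<Rightarrow> 0 | Some (k, v) \<Rightarrow> Poly_Mapping.single v (\<delta> ^ k))"
proof (induction g)
  case (Cons i g)
  show ?case
  proof (cases "wact g u")
    case (Some a)
    obtain k v where a: "a = (k, v)" by fastforce
    then have "v \<in> inf_link_states" using wact_link Some assms by blast
    then show ?thesis using Cons Some a by (simp add: act_Cons e_link_weight weight_def mult.commute)
  qed (use Cons in \<open>simp add: act_Cons\<close>)
qed simp

definition link_vecs :: "inf_vec set" where "link_vecs = {x. Poly_Mapping.keys x \<subseteq> inf_link_states}"

lemma act_eqI:
  assumes "x \<in> link_vecs" "\<And>u. u \<in> inf_link_states \<Longrightarrow> act \<delta> g (sg u) = scl c (act \<delta> h (sg u))"
  shows "act \<delta> g x = scl c (act \<delta> h x)"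
proof -
  have "act \<delta> g x = lin_ext (\<lambda>u. scl c (act \<delta> h (sg u))) x"
    unfolding act_eq_lin_ext[of \<delta> g x]
    by (rule lin_ext_cong) (use assms in \<open>auto simp: link_vecs_def\<close>)
  also have "\<dots> = scl c (act \<delta> h x)"
    unfolding act_eq_lin_ext[of \<delta> h x] by (simp add: lin_ext_def scl_sum mult.commute)
  finally show ?thesis .
qed

text \<open>
  The mirror image of \<open>cup_pair_word\<close>.
\<close>

lemma cup_pair_word_left:
  assumes w: "w \<in> inf_link_states" "w (Suc a) = Suc (Suc a)"
  shows "wact [Suc a, a] w = Some (0, w)"
proof -
  note inv = link_inv[OF w(1)]
  have wS: "w (Suc (Suc a)) = Suc a" using inv[of "Suc a"] w(2) by simp
  let ?v = "E a w"
  have va: "?v (Suc (Suc a)) = (if w a = a then Suc (Suc a) else w a)"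
    using w(2) wS by (simp add: E_def)
  have ne: "w a \<noteq> Suc a" "w a \<noteq> Suc (Suc a)"
    using inv[of a] w(2) wS by auto
  have "\<not> both_strings a w" "w a \<noteq> Suc a" "\<not> both_strings (Suc a) ?v" "?v (Suc a) \<noteq> Suc (Suc a)"
    using wS w(2) va ne by (auto simp: both_strings_def)
  moreover have "E (Suc a) ?v = w"
  proof
    fix k
    have "w k = Suc a \<longleftrightarrow> k = Suc (Suc a)" "w k = Suc (Suc a) \<longleftrightarrow> k = Suc a" "w k = a \<longleftrightarrow> k = w a"
      using inv wS w(2) by metis+
    then show "E (Suc a) ?v k = w k"
      using w(2) wS va ne inv[of a] by (auto simp: E_def)
  qed
  ultimately show ?thesis by simp
qed

lemma E_fixed_iff:
  assumes u: "u \<in> inf_link_states" and k: "k \<noteq> j" "k \<noteq> Suc j"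
  shows "E j u k = k \<longleftrightarrow> u k = k \<or> (u k = j \<and> u (Suc j) = Suc j) \<or> (u k = Suc j \<and> u j = j)"
proof -
  have "u j = k \<longleftrightarrow> u k = j" "u (Suc j) = k \<longleftrightarrow> u k = Suc j" using link_inv[OF u] by metis+
  then show ?thesis using k by (auto simp: E_def)
qed

lemma both_strings_E:
  assumes u: "u \<in> inf_link_states" and ij: "Suc i < j \<or> Suc j < i"
    and d: "\<not> both_strings i u" "\<not> both_strings j u"
  shows "both_strings i (E j u) \<longleftrightarrow> (u i = i \<and> u (Suc i) = j \<and> u (Suc j) = Suc j) \<or> (u i = i \<and> u (Suc i) = Suc j \<and> u j = j)
     \<or> (u (Suc i) = Suc i \<and> u i = j \<and> u (Suc j) = Suc j) \<or> (u (Suc i) = Suc i \<and> u i = Suc j \<and> u j = j)"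
proof -
  have ne: "i \<noteq> j" "i \<noteq> Suc j" "Suc i \<noteq> j" "Suc i \<noteq> Suc j" using ij by auto
  have A: "\<not> (u i = x \<and> u (Suc i) = x)" for x using link_eq_iff[OF u, of i "Suc i"] by auto
  have "\<not> (u i = i \<and> u (Suc i) = Suc i)" "\<not> (u j = j \<and> u (Suc j) = Suc j)" using d by (auto simp: both_strings_def)
  then show ?thesis
    unfolding both_strings_def E_fixed_iff[OF u ne(1,2)] E_fixed_iff[OF u ne(3,4)]
    using A[of j] A[of "Suc j"] by argo
qed

lemma both_strings_E_swap:
  assumes u: "u \<in> inf_link_states" and ij: "Suc i < j \<or> Suc j < i"
    and d: "\<not> both_strings i u" "\<not> both_strings j u"
  shows "both_strings i (E j u) \<longleftrightarrow> both_strings j (E i u)"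
proof -
  have inv: "u a = b \<longleftrightarrow> u b = a" for a b using link_inv[OF u] by metis
  have ji: "Suc j < i \<or> Suc i < j" using ij by blast
  show ?thesis unfolding both_strings_E[OF u ij d] both_strings_E[OF u ji d(2,1)]
    using inv[of i j] inv[of i "Suc j"] inv[of "Suc i" j] inv[of "Suc i" "Suc j"] by argo
qed
text \<open>
  Here \<open>k\<close> was joined to one of \<open>i\<close>, \<open>Suc i\<close>, and the outcome depends on the partner of the other one,
  called \<open>h'\<close>. The remaining points are treated by exchanging \<open>i\<close> and \<open>j\<close>, or are not affected.
\<close>

lemma E_commute_aux:
  assumes u: "u \<in> inf_link_states" and ij: "Suc i < j \<or> Suc j < i"
    and k: "k \<notin> {i, Suc i, j, Suc j}" "u k = i \<or> u k = Suc i"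
  shows "E i (E j u) k = E j (E i u) k"
proof -
  have inv: "u a = b \<longleftrightarrow> u b = a" for a b using link_inv[OF u] by metis
  have ne: "i \<noteq> j" "i \<noteq> Suc j" "Suc i \<noteq> j" "j \<noteq> i" "j \<noteq> Suc i" "Suc j \<noteq> i" "k \<noteq> i" "k \<noteq> Suc i" "k \<noteq> j" "k \<noteq> Suc j"
    "i \<noteq> k" "Suc i \<noteq> k" "j \<noteq> k" "Suc j \<noteq> k" using ij k by auto
  from k(2) obtain h h' where h: "u k = h" "u h = k" "h = i \<and> h' = Suc i \<or> h = Suc i \<and> h' = i"
    using inv by blast
  have hn: "h' \<noteq> h" "h \<noteq> j" "h \<noteq> Suc j" "h' \<noteq> j" "h' \<noteq> Suc j" "h' \<noteq> k" "h \<noteq> k" using h(3) ne by auto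
  have Ei: "E i v m = (if v h' = h' then m else v h')" if "v m = h" "m \<noteq> i" "m \<noteq> Suc i" "v h = m" for v m
    using h(3) that by (auto simp: E_def)
  have Ei': "E i v m = v m" if "v m \<noteq> h" "v m \<noteq> h'" "m \<noteq> i" "m \<noteq> Suc i" for v m
    using h(3) that by (auto simp: E_def)
  have vk: "E j u k = h" "E j u h = k" using h hn ne by (auto simp: E_def)
  have L: "E i (E j u) k = (if E j u h' = h' then k else E j u h')"
    using Ei[of "E j u" k] vk ne by simp
  have wk: "E i u k = (if u h' = h' then k else u h')" using Ei[of u k] h ne by simp
  have uj: "u j \<noteq> h" "u (Suc j) \<noteq> h" using h hn ne inv[of j h] inv[of "Suc j" h] by auto
  consider "u h' = h'" | "u h' = j" | "u h' = Suc j" | "u h' \<noteq> h'" "u h' \<noteq> j" "u h' \<noteq> Suc j" by blast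
  then show ?thesis
  proof cases
    case 1
    then have "E j u h' = h'" using hn by (simp add: E_def)
    moreover have "E j (E i u) k = k" using wk 1 ne by (simp add: E_def[of j])
    ultimately show ?thesis using L by simp
  next
    case 2
    then have uh: "u j = h'" using inv by blast
    have "u (Suc j) \<noteq> h'" using uh link_eq_iff[OF u, of j "Suc j"] by auto
    then have w: "E i u (Suc j) = u (Suc j)" using Ei'[of u "Suc j"] uj ne by simp
    have "E j (E i u) k = (if u (Suc j) = Suc j then k else u (Suc j))"
      using wk 2 hn w ne by (simp add: E_def[of j])
    moreover have "E j u h' = (if u (Suc j) = Suc j then h' else u (Suc j))" using 2 hn by (simp add: E_def)
    ultimately show ?thesis using L \<open>u (Suc j) \<noteq> h'\<close> by auto
  next
    case 3
    then have uh: "u (Suc j) = h'" using inv by blast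
    have "u j \<noteq> h'" using uh link_eq_iff[OF u, of j "Suc j"] by auto
    then have w: "E i u j = u j" using Ei'[of u j] uj ne by simp
    have "E j (E i u) k = (if u j = j then k else u j)"
      using wk 3 hn w ne by (simp add: E_def[of j])
    moreover have "E j u h' = (if u j = j then h' else u j)" using 3 hn by (simp add: E_def)
    ultimately show ?thesis using L \<open>u j \<noteq> h'\<close> by auto
  next
    case 4
    then have "E j u h' = u h'" using hn by (simp add: E_def)
    moreover have "E j (E i u) k = u h'" using wk 4 ne by (simp add: E_def[of j])
    ultimately show ?thesis using L 4 by simp
  qed
qed

text \<open>
  The weights agree as a product only: if \<open>i\<close>, \<open>Suc i\<close> are joined to \<open>j\<close>, \<open>Suc j\<close>, then whichever generator
  acts second closes the loop.
\<close>

lemma E_commute: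
  assumes u: "u \<in> inf_link_states" and ij: "Suc i < j \<or> Suc j < i"
    and d: "\<not> both_strings i u" "\<not> both_strings j u"
  shows "both_strings i (E j u) \<longleftrightarrow> both_strings j (E i u)" "weight \<delta> i (E j u) * weight \<delta> j u = weight \<delta> j (E i u) * weight \<delta> i u"
    "\<not> both_strings i (E j u) \<Longrightarrow> E i (E j u) = E j (E i u)"
proof -
  have inv: "u a = b \<longleftrightarrow> u b = a" for a b using link_inv[OF u] by metis
  have ne: "i \<noteq> j" "i \<noteq> Suc j" "Suc i \<noteq> j" "j \<noteq> i" "j \<noteq> Suc i" "Suc j \<noteq> i" using ij by auto
  show dd: "both_strings i (E j u) \<longleftrightarrow> both_strings j (E i u)"
    by (rule both_strings_E_swap[OF u ij d])
  have loop: "E b u a = Suc a \<longleftrightarrow> u a = Suc a \<or> (u a = b \<and> u (Suc a) = Suc b) \<or> (u a = Suc b \<and> u (Suc a) = b)"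
    if "Suc a < b \<or> Suc b < a" for a b
  proof -
    have "u (Suc b) = Suc a \<longleftrightarrow> u (Suc a) = Suc b" "u b = Suc a \<longleftrightarrow> u (Suc a) = b" using link_inv[OF u] by metis+
    moreover have "a \<noteq> b" "a \<noteq> Suc b" "b \<noteq> Suc a" using that by auto
    moreover have "u (Suc b) = Suc b \<Longrightarrow> u (Suc a) \<noteq> Suc b" "u b = b \<Longrightarrow> u (Suc a) \<noteq> b"
      using calculation by auto
    ultimately show ?thesis unfolding E_def by simp
  qed
  have cross: "(u i = j \<and> u (Suc i) = Suc j) \<longleftrightarrow> (u j = i \<and> u (Suc j) = Suc i)"
     "(u i = Suc j \<and> u (Suc i) = j) \<longleftrightarrow> (u j = Suc i \<and> u (Suc j) = i)"
    using inv by metis+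
  have li: "E j u i = Suc i \<longleftrightarrow> u i = Suc i \<or> (u i = j \<and> u (Suc i) = Suc j) \<or> (u i = Suc j \<and> u (Suc i) = j)"
    using loop[of i j] ij by argo
  have lj: "E i u j = Suc j \<longleftrightarrow> u j = Suc j \<or> (u i = j \<and> u (Suc i) = Suc j) \<or> (u i = Suc j \<and> u (Suc i) = j)"
    unfolding cross using loop[of j i] ij by argo
  show "weight \<delta> i (E j u) * weight \<delta> j u = weight \<delta> j (E i u) * weight \<delta> i u"
  proof (cases "both_strings i (E j u)")
    case False
    define P where "P \<longleftrightarrow> (u i = j \<and> u (Suc i) = Suc j) \<or> (u i = Suc j \<and> u (Suc i) = j)"
    have "P \<Longrightarrow> u i \<noteq> Suc i" unfolding P_def using ne by auto
    moreover have "P \<Longrightarrow> u j \<noteq> Suc j" unfolding P_def cross using ne by auto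
    moreover have "weight \<delta> i (E j u) = (if u i = Suc i \<or> P then \<delta> else 1)"
      using False unfolding weight_def li P_def by simp
    moreover have "weight \<delta> j (E i u) = (if u j = Suc j \<or> P then \<delta> else 1)"
      using False dd unfolding weight_def lj P_def by simp
    ultimately show ?thesis using d by (simp add: weight_def[of \<delta> i u] weight_def[of \<delta> j u])
  qed (use dd in \<open>simp add: weight_def\<close>)
  show "E i (E j u) = E j (E i u)" if "\<not> both_strings i (E j u)"
  proof
    fix k
    consider "k = i \<or> k = Suc i" | "k = j \<or> k = Suc j"
      | "k \<notin> {i, Suc i, j, Suc j}" "u k = i \<or> u k = Suc i"
      | "k \<notin> {i, Suc i, j, Suc j}" "u k = j \<or> u k = Suc j"
      | "k \<notin> {i, Suc i, j, Suc j}" "u k \<notin> {i, Suc i, j, Suc j}" by blast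
    then show "E i (E j u) k = E j (E i u) k"
    proof cases
      case 1
      then have "E i u k \<noteq> j" "E i u k \<noteq> Suc j" "k \<noteq> j" "k \<noteq> Suc j" using ne by auto
      then show ?thesis using 1 by (auto simp: E_def[of j "E i u"])
    next
      case 2
      then have "E j u k \<noteq> i" "E j u k \<noteq> Suc i" "k \<noteq> i" "k \<noteq> Suc i" using ne by auto
      then show ?thesis using 2 by (auto simp: E_def[of i "E j u"])
    next
      case 3 then show ?thesis by (rule E_commute_aux[OF u ij])
    next
      case 4
      then have "E j (E i u) k = E i (E j u) k" using E_commute_aux[OF u, of j i k] ij by auto
      then show ?thesis by simp
    next
      case 5 then show ?thesis by (simp add: E_def)
    qed
  qed
qed

lemma e_link_keys: "u \<in> inf_link_states \<Longrightarrow> Poly_Mapping.keys (e_link \<delta> i u) \<subseteq> inf_link_states"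
  by (auto simp: e_link_E E_states split: if_splits)

lemma link_vecs_simps [simp]: "0 \<in> link_vecs" "x \<in> link_vecs \<Longrightarrow> y \<in> link_vecs \<Longrightarrow> x + y \<in> link_vecs" "x \<in> link_vecs \<Longrightarrow> scl c x \<in> link_vecs"
  "x \<in> link_vecs \<Longrightarrow> - x \<in> link_vecs"
  using keys_add[of x y] keys_scl[of c x] by (auto simp: link_vecs_def)

lemma link_vecs_diff [simp]: "x \<in> link_vecs \<Longrightarrow> y \<in> link_vecs \<Longrightarrow> x - y \<in> link_vecs"
  using link_vecs_simps(2)[of x "- y"] by simp

lemma link_vecs_sum: "(\<And>a. a \<in> A \<Longrightarrow> f a \<in> link_vecs) \<Longrightarrow> sum f A \<in> link_vecs"
  by (induction A rule: infinite_finite_induct) simp_all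

lemma act_link_vecs [simp]: "x \<in> link_vecs \<Longrightarrow> act \<delta> g x \<in> link_vecs"
proof (induction g)
  case (Cons i g)
  then have "act \<delta> g x \<in> link_vecs" by simp
  then show ?case using keys_lin_ext[of "e_link \<delta> i" "act \<delta> g x"] e_link_keys[of _ \<delta> i] unfolding link_vecs_def act_Cons by blast
qed simp

lemma act_commute_letter:
  assumes "Suc i < j \<or> Suc j < i" "u \<in> inf_link_states"
  shows "act \<delta> [i, j] (sg u) = act \<delta> [j, i] (sg u)"
proof -
  have A: "act \<delta> [i, j] (sg u) = Poly_Mapping.single (E i (E j u)) (weight \<delta> i (E j u) * weight \<delta> j u)"
    if "Suc i < j \<or> Suc j < i" for i j
  proof (cases "both_strings j u")
    case False
    then show ?thesis using E_states[OF assms(2) False] assms(2) by (simp add: act_Cons e_link_weight mult.commute)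
  qed (simp add: act_Cons e_link_weight assms weight_def)
  show ?thesis
  proof (cases "both_strings i u \<or> both_strings j u")
    case True
    have W: "weight \<delta> a (E b u) * weight \<delta> b u = 0" if "both_strings a u" "Suc a < b \<or> Suc b < a" for a b
    proof -
      have "u b \<noteq> a" "u b \<noteq> Suc a" "u (Suc b) \<noteq> a" "u (Suc b) \<noteq> Suc a"
        using that link_inv[OF assms(2), of b] link_inv[OF assms(2), of "Suc b"] by (auto simp: both_strings_def)
      then have "both_strings a (E b u)" using that by (auto simp: both_strings_def E_def)
      then show ?thesis by (simp add: weight_def)
    qed
    have "weight \<delta> i (E j u) * weight \<delta> j u = 0 \<and> weight \<delta> j (E i u) * weight \<delta> i u = 0"
    proof -
      have "weight \<delta> a (E b u) * weight \<delta> b u = 0 \<and> weight \<delta> b (E a u) * weight \<delta> a u = 0"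
        if "both_strings a u" "Suc a < b \<or> Suc b < a" for a b
        using W[OF that] that(1) by (simp add: weight_def[of \<delta> a u])
      from this[of i j] this[of j i] show ?thesis using True assms(1) by blast
    qed
    then show ?thesis using A[OF assms(1)] A[of j i] assms(1) by auto
  next
    case False
    then have d: "\<not> both_strings i u" "\<not> both_strings j u" by simp_all
    note C = E_commute[OF assms(2,1) d]
    have ji: "Suc j < i \<or> Suc i < j" using assms(1) by blast
    show ?thesis
    proof (cases "both_strings i (E j u)")
      case True
      then have "weight \<delta> i (E j u) = 0" "weight \<delta> j (E i u) = 0" using C(1) by (simp_all add: weight_def)
      then show ?thesis by (simp add: A[OF assms(1)] A[OF ji])
    next
      case False
      then show ?thesis by (simp add: A[OF assms(1)] A[OF ji] C(2) C(3)[OF False])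
    qed
  qed
qed

lemma act_commute:
  assumes "x \<in> link_vecs" "\<forall>i\<in>set g. \<forall>j\<in>set h. Suc i < j \<or> Suc j < i"
  shows "act \<delta> (g @ h) x = act \<delta> (h @ g) x"
proof -
  have one: "act \<delta> (i # h) x = act \<delta> (h @ [i]) x" if "\<forall>j\<in>set h. Suc i < j \<or> Suc j < i" "x \<in> link_vecs" for i h x
    using that
  proof (induction h arbitrary: x)
    case (Cons j h)
    have "act \<delta> (i # j # h) x = act \<delta> [i, j] (act \<delta> h x)" by (simp add: act_Cons)
    also have "\<dots> = scl 1 (act \<delta> [j, i] (act \<delta> h x))"
    proof (rule act_eqI)
      fix u assume "u \<in> inf_link_states"
      then show "act \<delta> [i, j] (sg u) = scl 1 (act \<delta> [j, i] (sg u))"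
        using act_commute_letter[of i j u \<delta>] Cons.prems(1) by simp
    qed (use Cons.prems in simp)
    also have "\<dots> = act \<delta> [j] (act \<delta> (i # h) x)" by (simp add: act_Cons)
    also have "\<dots> = act \<delta> ((j # h) @ [i]) x" using Cons by (simp add: act_Cons)
    finally show ?case .
  qed simp
  show ?thesis using assms(2)
  proof (induction g)
    case (Cons i g)
    have "act \<delta> ((i # g) @ h) x = act \<delta> [i] (act \<delta> (h @ g) x)" using Cons by (simp add: act_Cons)
    also have "\<dots> = act \<delta> (i # h) (act \<delta> g x)" by (simp add: act_Cons act_append)
    also have "\<dots> = act \<delta> (h @ [i]) (act \<delta> g x)" using one Cons.prems assms(1) by simp
    also have "\<dots> = act \<delta> (h @ (i # g)) x" by (simp add: act_Cons act_append)
    finally show ?case .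
  qed simp
qed

section \<open>The relations of the algebra hold\<close>

lemma free_act_add_left: "free_act \<delta> (a + b) x = free_act \<delta> a x + free_act \<delta> b x"
  and free_act_scl_left: "free_act \<delta> (scl c a) x = scl c (free_act \<delta> a x)"
  and free_act_single: "free_act \<delta> (Poly_Mapping.single u c) x = scl c (word_act \<delta> u x)"
proof -
  have "free_act \<delta> a x = lin_ext (\<lambda>u. word_act \<delta> u x) a" for a by (simp add: free_act_def lin_ext_def)
  then show "free_act \<delta> (a + b) x = free_act \<delta> a x + free_act \<delta> b x"
    "free_act \<delta> (scl c a) x = scl c (free_act \<delta> a x)"
    "free_act \<delta> (Poly_Mapping.single u c) x = scl c (word_act \<delta> u x)"
    by (simp_all add: lin_ext_add lin_ext_scl)
qed

lemma word_act_act: "word_act \<delta> u = act \<delta> (letters u)"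
  by (simp add: act_def)

lemma free_act_word: "free_act \<delta> (Poly_Mapping.single (Word g) 1) x = act \<delta> g x"
  by (simp add: free_act_single word_act_act)

lemma free_act_add: "free_act \<delta> a (x + y) = free_act \<delta> a x + free_act \<delta> a y"
  by (simp add: free_act_def word_act_act act_add scl_add sum.distrib)

lemma free_act_0 [simp]: "free_act \<delta> a 0 = 0" "free_act \<delta> 0 x = 0"
  by (simp_all add: free_act_def word_act_act)

lemma free_act_sum: "free_act \<delta> a (sum f A) = (\<Sum>i\<in>A. free_act \<delta> a (f i))"
  by (induction A rule: infinite_finite_induct) (simp_all add: free_act_add)

lemma free_act_sum_left: "free_act \<delta> (sum f A) x = (\<Sum>i\<in>A. free_act \<delta> (f i) x)"
  by (induction A rule: infinite_finite_induct) (simp_all add: free_act_add_left)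

lemma free_act_neg: "free_act \<delta> (- a) x = - free_act \<delta> a x"
  using free_act_scl_left[of \<delta> "-1" a x] by (simp add: scl_neg)

lemma free_act_link_vecs: "x \<in> link_vecs \<Longrightarrow> free_act \<delta> a x \<in> link_vecs"
  unfolding free_act_def by (intro link_vecs_sum) (simp add: word_act_act)

lemma free_act_one [simp]: "free_act \<delta> 1 x = x"
proof -
  have "(1 :: free_alg) = Poly_Mapping.single (Word []) 1" by (simp add: zero_tl_word_def[symmetric])
  show ?thesis unfolding \<open>1 = Poly_Mapping.single (Word []) 1\<close> free_act_word by simp
qed

lemma free_act_mult: "free_act \<delta> (a * b) x = free_act \<delta> a (free_act \<delta> b x)"
proof -
  have single: "free_act \<delta> (Poly_Mapping.single u c * Poly_Mapping.single v d) x =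
    free_act \<delta> (Poly_Mapping.single u c) (free_act \<delta> (Poly_Mapping.single v d) x)" for u v c d
    by (simp add: mult_single free_act_single word_act_act plus_tl_word_def act_append act_scl)
  let ?s = "\<lambda>a u. Poly_Mapping.single u (Poly_Mapping.lookup a u)"
  have s: "a = (\<Sum>u\<in>Poly_Mapping.keys a. ?s a u)" for a :: free_alg
    using vec_sum[of a] by simp
  have "free_act \<delta> (a * b) x = (\<Sum>u\<in>Poly_Mapping.keys a. \<Sum>v\<in>Poly_Mapping.keys b. free_act \<delta> (?s a u * ?s b v) x)"
    by (subst s[of a], subst s[of b]) (simp only: sum_product free_act_sum_left)
  also have "\<dots> = (\<Sum>u\<in>Poly_Mapping.keys a. \<Sum>v\<in>Poly_Mapping.keys b. free_act \<delta> (?s a u) (free_act \<delta> (?s b v) x))"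
    by (simp only: single)
  also have "\<dots> = free_act \<delta> (\<Sum>u\<in>Poly_Mapping.keys a. ?s a u) (free_act \<delta> (\<Sum>v\<in>Poly_Mapping.keys b. ?s b v) x)"
    by (simp only: free_act_sum free_act_sum_left) (rule sum.swap)
  also have "\<dots> = free_act \<delta> a (free_act \<delta> b x)" by (simp only: s[symmetric])
  finally show ?thesis .
qed

lemma ring_free_ring: "ring free_ring"
proof (rule ringI)
  show "abelian_group free_ring"
  proof (rule abelian_groupI)
    fix x :: free_alg
    show "\<exists>y\<in>carrier free_ring. y \<oplus>\<^bsub>free_ring\<^esub> x = \<zero>\<^bsub>free_ring\<^esub>"
      by (intro bexI[of _ "- x"]) (simp_all add: free_ring_def)
  qed (simp_all add: free_ring_def algebra_simps)
  show "monoid free_ring" by (rule monoidI) (simp_all add: free_ring_def mult.assoc)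
qed (simp_all add: free_ring_def algebra_simps)

text \<open>
  The elements of the free algebra that act by 0. They form an ideal containing the relators, so the
  action descends to the quotient algebra.
\<close>

definition annih :: "complex \<Rightarrow> free_alg set" where
  "annih \<delta> = {a. \<forall>x\<in>link_vecs. free_act \<delta> a x = 0}"

lemma ideal_annih: "ideal (annih \<delta>) free_ring"
proof (rule idealI)
  show "ring free_ring" by (rule ring_free_ring)
  show "subgroup (annih \<delta>) (add_monoid free_ring)"
  proof
    fix a assume a: "a \<in> annih \<delta>"
    have "inv\<^bsub>add_monoid free_ring\<^esub> a = - a"
      using abelian_group.minus_equality[OF ring.is_abelian_group[OF ring_free_ring], of "- a" a]
      by (simp add: free_ring_def a_inv_def)
    then show "inv\<^bsub>add_monoid free_ring\<^esub> a \<in> annih \<delta>" using a by (simp add: annih_def free_act_neg)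
  qed (auto simp: annih_def free_ring_def free_act_add_left)
qed (auto simp: annih_def free_ring_def free_act_mult free_act_link_vecs)

lemma relators_annih: "tl_relators \<delta> \<subseteq> annih \<delta>"
proof -
  have ga: "free_act \<delta> (gen i) x = act \<delta> [i] x" for i x by (simp add: gen_def free_act_word)
  have zero: "a - b \<in> annih \<delta>" if "\<And>x. x \<in> link_vecs \<Longrightarrow> free_act \<delta> a x = free_act \<delta> b x" for a b
    using that free_act_add_left[of \<delta> a "- b"] by (auto simp: annih_def free_act_neg)
  have cup: "act \<delta> [i, j, i] x = act \<delta> [i] x" if "j = Suc i \<or> i = Suc j" "x \<in> link_vecs" for i j x
  proof -
    have "act \<delta> [i, j, i] x = scl 1 (act \<delta> [i] x)"
    proof (rule act_eqI[OF that(2)])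
      fix u assume u: "u \<in> inf_link_states"
      show "act \<delta> [i, j, i] (sg u) = scl 1 (act \<delta> [i] (sg u))"
      proof (cases "both_strings i u")
        case True then show ?thesis using u by (simp add: act_Cons e_link_weight weight_def)
      next
        case False
        note E = E_states[OF u False]
        have w: "wact [i, j] (E i u) = Some (0, E i u)"
          using that(1)
        proof
          assume "j = Suc i" then show ?thesis using cup_pair_word[OF E, of i] by (simp del: wact.simps)
        next
          assume "i = Suc j" then show ?thesis using cup_pair_word_left[OF E, of j] by (simp del: wact.simps)
        qed
        have "act \<delta> [i] (sg u) = scl (weight \<delta> i u) (sg (E i u))" using u by (simp add: act_Cons e_link_weight)
        moreover have "act \<delta> [i, j] (sg (E i u)) = sg (E i u)" unfolding act_wact[OF E] w by simp
        moreover have "act \<delta> [i, j, i] (sg u) = act \<delta> [i, j] (act \<delta> [i] (sg u))" by (simp add: act_Cons)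
        ultimately show ?thesis by (simp only: act_scl scl_simps(3))
      qed
    qed
    then show ?thesis by simp
  qed
  have "gen i * gen i - scl \<delta> (gen i) \<in> annih \<delta>" for i
  proof (rule zero)
    fix x :: inf_vec assume x: "x \<in> link_vecs"
    have "act \<delta> [i, i] x = scl \<delta> (act \<delta> [i] x)"
    proof (rule act_eqI[OF x])
      fix u assume u: "u \<in> inf_link_states"
      show "act \<delta> [i, i] (sg u) = scl \<delta> (act \<delta> [i] (sg u))"
      proof (cases "both_strings i u")
        case True then show ?thesis using u by (simp add: act_Cons e_link_weight weight_def)
      next
        case False
        note E = E_states[OF u False]
        have "E i (E i u) = E i u" "weight \<delta> i (E i u) = \<delta>" using E_loop[OF E] by (auto simp: weight_def both_strings_def)
        then show ?thesis using u E by (simp add: act_Cons e_link_weight mult.commute)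
      qed
    qed
    then show "free_act \<delta> (gen i * gen i) x = free_act \<delta> (scl \<delta> (gen i)) x"
      by (simp add: free_act_mult ga free_act_scl_left act_Cons)
  qed
  moreover have "gen i * gen j * gen i - gen i \<in> annih \<delta>" if "j = Suc i \<or> i = Suc j" for i j
    by (rule zero) (use cup[OF that] in \<open>simp add: free_act_mult ga act_Cons\<close>)
  moreover have "gen i * gen j - gen j * gen i \<in> annih \<delta>" if "Suc i < j \<or> Suc j < i" for i j
    by (rule zero) (use act_commute[of _ "[i]" "[j]" \<delta>] that in \<open>simp add: free_act_mult ga act_Cons\<close>)
  ultimately show ?thesis unfolding tl_relators_def by blast
qed

section \<open>Subrepresentations and the cyclic representations\<close>

definition rel_ideal :: "complex \<Rightarrow> free_alg set" where
  "rel_ideal \<delta> = genideal free_ring (tl_relators \<delta>)"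

definition coset :: "complex \<Rightarrow> free_alg \<Rightarrow> free_alg set" where
  "coset \<delta> a = (\<lambda>i. i + a) ` rel_ideal \<delta>"

lemma rel_ideal_ideal: "ideal (rel_ideal \<delta>) free_ring"
  unfolding rel_ideal_def by (rule ring.genideal_ideal[OF ring_free_ring]) (simp add: free_ring_def)

lemma rel_ideal_annih: "rel_ideal \<delta> \<subseteq> annih \<delta>"
  unfolding rel_ideal_def by (rule ring.genideal_minimal[OF ring_free_ring ideal_annih relators_annih])

lemma zero_rel_ideal: "0 \<in> rel_ideal \<delta>"
  using additive_subgroup.zero_closed[OF ideal.axioms(1)[OF rel_ideal_ideal[of \<delta>]]] by (simp add: free_ring_def)

lemma carrier_TL: "carrier (TL \<delta>) = range (coset \<delta>)"
proof -
  have "a_r_coset free_ring (rel_ideal \<delta>) a = coset \<delta> a" for a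
    by (auto simp: a_r_coset_def r_coset_def coset_def free_ring_def)
  moreover have "carrier (TL \<delta>) = (\<Union>a\<in>carrier free_ring. {a_r_coset free_ring (rel_ideal \<delta>) a})"
    by (simp add: TL_def FactRing_def rel_ideal_def A_RCOSETS_def RCOSETS_def a_r_coset_def)
  ultimately show ?thesis by (auto simp: free_ring_def)
qed

lemma smult_coset:
  assumes "x \<in> link_vecs"
  shows "coset \<delta> a \<odot>\<^bsub>link_module \<delta>\<^esub> x = free_act \<delta> a x"
proof -
  have "free_act \<delta> b x = free_act \<delta> a x" if "b \<in> coset \<delta> a" for b
    using that rel_ideal_annih[of \<delta>] assms by (auto simp: coset_def annih_def free_act_add_left)
  moreover have "a \<in> coset \<delta> a" using zero_rel_ideal by (force simp: coset_def)
  ultimately have "(\<lambda>b. free_act \<delta> b x) ` coset \<delta> a = {free_act \<delta> a x}" by blast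
  then show ?thesis by (simp add: link_module_def)
qed

lemma link_module_simps [simp]: "carrier (link_module \<delta>) = link_vecs" "add (link_module \<delta>) = (+)" "zero (link_module \<delta>) = 0"
  by (simp_all add: link_module_def link_vecs_def)

text \<open>
  Submodules in terms of the free algebra. Negatives come from the scalars of the free algebra.
\<close>

definition subrep :: "complex \<Rightarrow> inf_vec set \<Rightarrow> bool" where
  "subrep \<delta> N \<longleftrightarrow> N \<subseteq> link_vecs \<and> 0 \<in> N \<and> (\<forall>x\<in>N. \<forall>y\<in>N. x + y \<in> N) \<and> (\<forall>a. \<forall>x\<in>N. free_act \<delta> a x \<in> N)"

lemma free_act_const: "free_act \<delta> (Poly_Mapping.single (Word []) c) x = scl c x"
  by (simp add: free_act_single word_act_act)

lemma subrepD:
  assumes "subrep \<delta> N"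
  shows "N \<subseteq> link_vecs" "0 \<in> N" "x \<in> N \<Longrightarrow> y \<in> N \<Longrightarrow> x + y \<in> N" "x \<in> N \<Longrightarrow> free_act \<delta> a x \<in> N"
    "x \<in> N \<Longrightarrow> act \<delta> g x \<in> N" "x \<in> N \<Longrightarrow> scl c x \<in> N" "x \<in> N \<Longrightarrow> - x \<in> N" "x \<in> N \<Longrightarrow> y \<in> N \<Longrightarrow> x - y \<in> N"
    "(\<And>a. a \<in> A \<Longrightarrow> f a \<in> N) \<Longrightarrow> sum f A \<in> N"
proof -
  show b: "N \<subseteq> link_vecs" "0 \<in> N" "x \<in> N \<Longrightarrow> y \<in> N \<Longrightarrow> x + y \<in> N" "x \<in> N \<Longrightarrow> free_act \<delta> a x \<in> N"
    for x y a using assms by (auto simp: subrep_def)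
  show "x \<in> N \<Longrightarrow> act \<delta> g x \<in> N" using b(4)[of x "Poly_Mapping.single (Word g) 1"] by (simp add: free_act_word)
  show s: "x \<in> N \<Longrightarrow> scl c x \<in> N" for x c using b(4)[of x "Poly_Mapping.single (Word []) c"] by (simp add: free_act_const)
  show n: "x \<in> N \<Longrightarrow> - x \<in> N" for x using s[of x "-1"] by (simp add: scl_neg)
  show "x \<in> N \<Longrightarrow> y \<in> N \<Longrightarrow> x - y \<in> N" using b(3)[of x "- y"] n[of y] by simp
  show "(\<And>a. a \<in> A \<Longrightarrow> f a \<in> N) \<Longrightarrow> sum f A \<in> N"
    by (induction A rule: infinite_finite_induct) (simp_all add: b)
qed

lemma submodule_iff_subrep: "submodule N (TL \<delta>) (link_module \<delta>) \<longleftrightarrow> subrep \<delta> N"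
proof
  assume N: "submodule N (TL \<delta>) (link_module \<delta>)"
  interpret submodule N "TL \<delta>" "link_module \<delta>" by (rule N)
  have "N \<subseteq> link_vecs" using subset by simp
  moreover have "free_act \<delta> a x \<in> N" if "x \<in> N" for a x
  proof -
    have "coset \<delta> a \<in> carrier (TL \<delta>)" by (simp add: carrier_TL)
    then have "coset \<delta> a \<odot>\<^bsub>link_module \<delta>\<^esub> x \<in> N" using smult_closed that by blast
    moreover have "x \<in> link_vecs" using that \<open>N \<subseteq> link_vecs\<close> by blast
    ultimately show ?thesis using smult_coset[of x \<delta> a] by metis
  qed
  ultimately show "subrep \<delta> N" using one_closed m_closed by (auto simp: subrep_def)
next
  assume N: "subrep \<delta> N"
  show "submodule N (TL \<delta>) (link_module \<delta>)"
  proof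
    fix x assume x: "x \<in> N"
    then have xl: "x \<in> link_vecs" using subrepD(1)[OF N] by blast
    have "inv\<^bsub>add_monoid (link_module \<delta>)\<^esub> x = - x"
      unfolding m_inv_def by (rule the_equality) (use xl in \<open>auto simp: eq_neg_iff_add_eq_0\<close>)
    then show "inv\<^bsub>add_monoid (link_module \<delta>)\<^esub> x \<in> N" using subrepD(7)[OF N x] by simp
  next
    fix A x assume "A \<in> carrier (TL \<delta>)" "x \<in> N"
    then show "A \<odot>\<^bsub>link_module \<delta>\<^esub> x \<in> N" using subrepD(1,4)[OF N] smult_coset by (auto simp: carrier_TL)
  qed (use subrepD(1,2,3)[OF N] in auto)
qed

definition eq_span :: "inf_link \<Rightarrow> inf_vec set" where
  "eq_span w = {x. Poly_Mapping.keys x \<subseteq> {u. sim w u}}"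

lemma sim_link: "sim w u \<Longrightarrow> u \<in> inf_link_states" by (simp add: sim_def)

lemma span_single: "sg u \<in> eq_span w \<longleftrightarrow> sim w u" by (simp add: eq_span_def)

lemma span_link_vecs: "eq_span w \<subseteq> link_vecs" by (auto simp: eq_span_def link_vecs_def sim_link)

lemma span_basic: "0 \<in> eq_span w" "x \<in> eq_span w \<Longrightarrow> y \<in> eq_span w \<Longrightarrow> x + y \<in> eq_span w" "x \<in> eq_span w \<Longrightarrow> scl c x \<in> eq_span w"
  using keys_add[of x y] keys_scl[of c x] by (auto simp: eq_span_def)

lemma span_sum: "(\<And>a. a \<in> A \<Longrightarrow> f a \<in> eq_span w) \<Longrightarrow> sum f A \<in> eq_span w"
  by (induction A rule: infinite_finite_induct) (simp_all add: span_basic)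

lemma act_span:
  assumes "w \<in> inf_link_states" "x \<in> eq_span w"
  shows "act \<delta> g x \<in> eq_span w"
proof -
  have "act \<delta> g (sg u) \<in> eq_span w" if "u \<in> Poly_Mapping.keys x" for u
  proof -
    have u: "sim w u" using assms that by (auto simp: eq_span_def)
    then have "wact g u = Some (k, v) \<Longrightarrow> sim w v" for k v
      using sim_wact sim_trans assms(1) sim_link by metis
    then show ?thesis using act_wact[OF sim_link[OF u], of \<delta> g] by (auto split: option.splits simp: eq_span_def)
  qed
  then show ?thesis unfolding act_eq_lin_ext[of \<delta> g x] lin_ext_def
    by (intro span_sum span_basic(3)) auto
qed

lemma subrep_span: "w \<in> inf_link_states \<Longrightarrow> subrep \<delta> (eq_span w)"
  unfolding subrep_def free_act_def word_act_act
  by (auto simp: span_link_vecs[THEN subsetD] span_basic act_span intro!: span_sum)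

text \<open>
  Every state equivalent to \<open>u\<close> is the image of \<open>u\<close> under a word with coefficient 1.
\<close>

lemma subrep_contains_span:
  assumes w: "w \<in> inf_link_states" and N: "subrep \<delta> N" "sim w u" "sg u \<in> N"
  shows "eq_span w \<subseteq> N"
proof
  fix x assume x: "x \<in> eq_span w"
  have u: "u \<in> inf_link_states" using N sim_link by blast
  have "sg v \<in> N" if "v \<in> Poly_Mapping.keys x" for v
  proof -
    have "sim w v" using x that by (auto simp: eq_span_def)
    then have "sim u v" using sim_trans[OF u sim_sym[OF w N(2)]] by blast
    then obtain g where "wact g u = Some (0, v)" using sim_word u by blast
    then have "act \<delta> g (sg u) = sg v" using act_wact[OF u] by simp
    then show ?thesis using subrepD(5)[OF N(1,3)] by metis
  qed
  then show "x \<in> N" by (subst vec_sum) (intro subrepD(9)[OF N(1)] subrepD(6)[OF N(1)], simp)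
qed

lemma X_simps:
  assumes "w \<in> inf_link_states"
  shows "carrier (X \<delta> w) = eq_span w" "add (X \<delta> w) = (+)" "zero (X \<delta> w) = 0"
    "x \<in> eq_span w \<Longrightarrow> coset \<delta> a \<odot>\<^bsub>X \<delta> w\<^esub> x = free_act \<delta> a x"
proof -
  have "submodule_gen (TL \<delta>) (link_module \<delta>) {sg w} = eq_span w"
    unfolding submodule_gen_def submodule_iff_subrep
    using subrep_contains_span[OF assms _ sim_refl[OF assms]] subrep_span[OF assms, of \<delta>] span_single[of w w] sim_refl[OF assms]
    by (intro equalityI) auto
  then show "carrier (X \<delta> w) = eq_span w" by (simp add: X_def)
  show "add (X \<delta> w) = (+)" "zero (X \<delta> w) = 0" by (simp_all add: X_def link_module_def)
  show "coset \<delta> a \<odot>\<^bsub>X \<delta> w\<^esub> x = free_act \<delta> a x" if "x \<in> eq_span w"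
    using smult_coset[of x \<delta> a] that span_link_vecs by (auto simp: X_def)
qed

lemma module_iso_sym:
  assumes iso: "module_iso R M N"
    and "\<And>x y. x \<in> carrier M \<Longrightarrow> y \<in> carrier M \<Longrightarrow> x \<oplus>\<^bsub>M\<^esub> y \<in> carrier M"
    and "\<And>a x. a \<in> carrier R \<Longrightarrow> x \<in> carrier M \<Longrightarrow> a \<odot>\<^bsub>M\<^esub> x \<in> carrier M"
  shows "module_iso R N M"
proof -
  obtain h where h: "h \<in> iso (add_monoid M) (add_monoid N)"
    "\<And>a x. a \<in> carrier R \<Longrightarrow> x \<in> carrier M \<Longrightarrow> h (a \<odot>\<^bsub>M\<^esub> x) = a \<odot>\<^bsub>N\<^esub> h x"
    using iso by (auto simp: module_iso_def)
  have bij: "bij_betw h (carrier M) (carrier N)"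
    and add: "\<And>x y. x \<in> carrier M \<Longrightarrow> y \<in> carrier M \<Longrightarrow> h (x \<oplus>\<^bsub>M\<^esub> y) = h x \<oplus>\<^bsub>N\<^esub> h y"
    using h(1) by (auto simp: iso_def hom_def)
  define k where "k = inv_into (carrier M) h"
  have kb: "bij_betw k (carrier N) (carrier M)" unfolding k_def using bij by (rule bij_betw_inv_into)
  have kc: "k y \<in> carrier M" "h (k y) = y" if "y \<in> carrier N" for y
    using that bij kb by (auto simp: k_def bij_betw_apply bij_betw_inv_into_right)
  have kh: "k (h x) = x" if "x \<in> carrier M" for x
    using that bij by (simp add: k_def bij_betw_inv_into_left)
  have "k (x \<oplus>\<^bsub>N\<^esub> y) = k x \<oplus>\<^bsub>M\<^esub> k y" if "x \<in> carrier N" "y \<in> carrier N" for x y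
    using kh[of "k x \<oplus>\<^bsub>M\<^esub> k y"] add[of "k x" "k y"] kc that assms(2) by simp
  then have "k \<in> iso (add_monoid N) (add_monoid M)" using kb kc by (auto simp: iso_def hom_def)
  moreover have "k (a \<odot>\<^bsub>N\<^esub> y) = a \<odot>\<^bsub>M\<^esub> k y" if "a \<in> carrier R" "y \<in> carrier N" for a y
    using kh[of "a \<odot>\<^bsub>M\<^esub> k y"] h(2)[of a "k y"] kc that assms(3) by simp
  ultimately show ?thesis by (auto simp: module_iso_def)
qed

lemma module_iso_refl: "module_iso R M M"
  unfolding module_iso_def by (rule bexI[of _ "\<lambda>x. x"]) (auto simp: iso_def hom_def bij_betw_def)

lemma X_iso_witness:
  assumes w: "w \<in> inf_link_states" "w' \<in> inf_link_states" and iso: "module_iso (TL \<delta>) (X \<delta> w) (X \<delta> w')"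
  obtains x' where "x' \<in> eq_span w'" "\<And>a. free_act \<delta> a (sg w) = 0 \<longleftrightarrow> free_act \<delta> a x' = 0"
proof -
  obtain h where h: "bij_betw h (eq_span w) (eq_span w')"
    "\<And>a x. x \<in> eq_span w \<Longrightarrow> h (coset \<delta> a \<odot>\<^bsub>X \<delta> w\<^esub> x) = coset \<delta> a \<odot>\<^bsub>X \<delta> w'\<^esub> h x"
    using iso by (auto simp: module_iso_def iso_def X_simps w carrier_TL)
  have hw: "h x \<in> eq_span w'" if "x \<in> eq_span w" for x using h(1) that by (rule bij_betw_apply)
  have ha: "h (free_act \<delta> a x) = free_act \<delta> a (h x)" if "x \<in> eq_span w" for a x
    using h(2)[OF that, of a] X_simps(4)[OF w(1) that] X_simps(4)[OF w(2) hw[OF that]] by simp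
  have s: "sg w \<in> eq_span w" using sim_refl w by (simp add: span_single)
  have h0: "h 0 = 0" using ha[OF s, of 0] by simp
  have "free_act \<delta> a (sg w) = 0 \<longleftrightarrow> free_act \<delta> a (h (sg w)) = 0" for a
    using ha[OF s, of a] h0 h(1) subrepD(4)[OF subrep_span[OF w(1)] s] span_basic(1)
    by (metis bij_betw_def inj_onD)
  then show ?thesis using that hw[OF s] by blast
qed

lemma X_iso_sym:
  assumes w: "w \<in> inf_link_states" "w' \<in> inf_link_states" and iso: "module_iso (TL \<delta>) (X \<delta> w) (X \<delta> w')"
  shows "module_iso (TL \<delta>) (X \<delta> w') (X \<delta> w)"
  by (rule module_iso_sym[OF iso])
    (use subrepD[OF subrep_span[OF w(1)]] in \<open>auto simp: X_simps w carrier_TL\<close>)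

section \<open>Restriction to finite link states\<close>

lemma closed_0: "closed_ivl 0 n u \<longleftrightarrow> (\<forall>i<n. u i < n)" by (simp add: closed_ivl_def)

lemma restr_length_closed: "closed_ivl 0 n u \<Longrightarrow> restr_length u n = n"
  unfolding restr_length_def closed_0[symmetric] by (rule Least_equality) simp_all

lemma restr_length_props:
  assumes "u \<in> inf_link_states"
  shows "m \<le> restr_length u m" "closed_ivl 0 (restr_length u m) u"
proof -
  obtain n where "m \<le> n \<and> closed_ivl 0 n u" using closed_cofinal[OF assms] by blast
  then have "m \<le> restr_length u m \<and> closed_ivl 0 (restr_length u m) u"
    unfolding restr_length_def closed_0[symmetric] by (rule LeastI)
  then show "m \<le> restr_length u m" "closed_ivl 0 (restr_length u m) u" by simp_all
qed

text \<open>
  The cups match left ends with right ends. Hence equal numbers of cups mean equal numbers of strings.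
\<close>

lemma openers_strs:
  assumes u: "u \<in> inf_link_states" "closed_ivl 0 n u"
  shows "n = 2 * card {i. i < n \<and> i < u i} + strs 0 n u"
proof -
  let ?O = "{i. i < n \<and> i < u i}" and ?C = "{i. i < n \<and> u i < i}" and ?S = "{i. i < n \<and> u i = i}"
  note inv = link_inv[OF u(1)]
  have "bij_betw u ?O ?C"
    by (rule bij_betwI[of _ _ _ u]) (use inv u(2) in \<open>auto simp: closed_ivl_def\<close>)
  then have c: "card ?C = card ?O" using bij_betw_same_card[of u ?O ?C] by simp
  have "card {..<n} = card (?O \<union> (?C \<union> ?S))" by (rule arg_cong[of _ _ card]) auto
  also have "\<dots> = card ?O + card (?C \<union> ?S)" by (rule card_Un_disjoint) auto
  also have "card (?C \<union> ?S) = card ?C + card ?S" by (rule card_Un_disjoint) auto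
  finally show ?thesis using c by (simp add: strs_def)
qed

lemma link_states_map:
  assumes u: "u \<in> inf_link_states" "closed_ivl 0 n u"
  shows "map u [0..<n] \<in> link_states m p \<longleftrightarrow> m = n \<and> p = card {i. i < n \<and> i < u i}"
proof -
  have lt: "u i < n" if "i < n" for i using u(2) that by (simp add: closed_0)
  have "link_state_on {..<n} ((!) (map u [0..<n]))"
    using u(1) lt unfolding inf_link_states_def link_state_on_def by (auto simp: link_inv)
  moreover have "card {i. i < n \<and> i < map u [0..<n] ! i} = card {i. i < n \<and> i < u i}"
    by (rule arg_cong[of _ _ card]) auto
  ultimately show ?thesis by (cases "m = n") (simp_all add: link_states_def eq_commute[of p])
qed

text \<open>
  Finite link states are handled as infinite ones with a prescribed tail.
\<close>

lemma link_states_extend: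
  assumes w: "w \<in> inf_link_states" "closed_ivl 0 n w" and y: "y \<in> link_states n p"
  obtains v where "v \<in> inf_link_states" "closed_ivl 0 n v" "\<forall>k\<ge>n. v k = w k" "y = map v [0..<n]"
proof -
  have len: "length y = n" and on: "link_state_on {..<n} ((!) y)" using y by (auto simp: link_states_def)
  define v where "v k = (if k < n then y ! k else w k)" for k
  have lt: "v k < n" if "k < n" for k using on that by (simp add: v_def link_state_on_def)
  have ge: "n \<le> w k" if "n \<le> k" for k using closed_ivl_inv[OF w, of k] that by simp
  have 1: "v (v i) = i" for i
    using on ge[of i] link_inv[OF w(1)] by (auto simp: v_def link_state_on_def)
  have 2: "\<not> (i < j \<and> j < v i \<and> v i < v j) \<and> \<not> (i < j \<and> j < v i \<and> v j = j)" for i j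
  proof (cases "i < n")
    case True
    show ?thesis
    proof (cases "j < n")
      case jn: True
      then show ?thesis using on True by (auto simp: v_def link_state_on_def)
    next
      case False
      then show ?thesis using lt[OF True] by auto
    qed
  next
    case False
    then show ?thesis using w(1) by (auto simp: v_def inf_link_states_def link_state_on_def)
  qed
  have "v \<in> inf_link_states" unfolding inf_link_states_def link_state_on_def using 1 2 by simp
  moreover have "y = map v [0..<n]" by (rule nth_equalityI) (simp_all add: len v_def)
  moreover have "closed_ivl 0 n v" using lt by (simp add: closed_0)
  moreover have "\<forall>k\<ge>n. v k = w k" by (simp add: v_def)
  ultimately show ?thesis using that[of v] by blast
qed

text \<open>
  From \<open>N\<close> on, the restrictions of \<open>u\<close> and \<open>w\<close> have the same length and the same number of strings.
\<close>

definition bounded_by :: "inf_link \<Rightarrow> nat \<Rightarrow> inf_link \<Rightarrow> bool" where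
  "bounded_by w N u \<longleftrightarrow> u \<in> inf_link_states \<and> (\<forall>k\<ge>N. u k = w k) \<and>
     (\<forall>n\<ge>N. closed_ivl 0 n u \<longleftrightarrow> closed_ivl 0 n w) \<and> (\<forall>n\<ge>N. closed_ivl 0 n w \<longrightarrow> strs 0 n u = strs 0 n w)"

lemma bounded_by_mono: "bounded_by w N u \<Longrightarrow> N \<le> M \<Longrightarrow> bounded_by w M u"
  unfolding bounded_by_def by auto

lemma sim_bounded:
  assumes "w \<in> inf_link_states" "sim w u"
  obtains N where "bounded_by w N u"
proof -
  have u: "u \<in> inf_link_states" using assms sim_link by blast
  obtain N where N: "\<forall>k\<ge>N. u k = w k" "\<forall>n\<ge>N. closed_ivl 0 n w \<longrightarrow> closed_ivl 0 n u \<and> strs 0 n u = strs 0 n w"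
    using assms sim_iff by blast
  obtain M where M: "\<forall>n\<ge>M. closed_ivl 0 n u \<longrightarrow> closed_ivl 0 n w"
    using sim_sym[OF assms] sim_iff[OF u] by blast
  have "bounded_by w (max N M) u" unfolding bounded_by_def using u N M by auto
  then show ?thesis by (rule that)
qed

lemma span_bounded:
  assumes "w \<in> inf_link_states" "x \<in> eq_span w"
  obtains N where "\<And>u. u \<in> Poly_Mapping.keys x \<Longrightarrow> bounded_by w N u"
proof -
  have "\<forall>u\<in>Poly_Mapping.keys x. \<exists>N. bounded_by w N u"
    using assms sim_bounded by (metis (mono_tags) mem_Collect_eq eq_span_def subsetD)
  then obtain f where f: "\<And>u. u \<in> Poly_Mapping.keys x \<Longrightarrow> bounded_by w (f u) u" by metis
  have "bounded_by w (Max (insert 0 (f ` Poly_Mapping.keys x))) u" if "u \<in> Poly_Mapping.keys x" for u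
    using bounded_by_mono[OF f[OF that]] that by simp
  then show ?thesis by (rule that)
qed

lemma bounded_restr_length:
  assumes "bounded_by w N u" "N \<le> m"
  shows "restr_length u m = restr_length w m"
  unfolding restr_length_def closed_0[symmetric]
  using assms unfolding bounded_by_def by (intro arg_cong[of _ _ Least] ext) auto

lemma link_equiv_iff_sim:
  assumes w: "w \<in> inf_link_states" "w' \<in> inf_link_states"
  shows "link_equiv w w' \<longleftrightarrow> sim w w'"
proof
  assume e: "link_equiv w w'"
  then have "finite {i. w i \<noteq> w' i}" by (simp add: link_equiv_def)
  then obtain M where M: "\<forall>i\<in>{i. w i \<noteq> w' i}. i \<le> M" using finite_nat_set_iff_bounded_le by blast
  obtain n0 where n0: "\<forall>m\<ge>n0. \<exists>m' p. restr w m \<in> link_states m' p \<and> restr w' m \<in> link_states m' p"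
    using e by (auto simp: link_equiv_def)
  obtain n where n: "max (Suc M) n0 \<le> n" "closed_ivl 0 n w" using closed_cofinal[OF w(1)] by blast
  obtain m' p where p: "restr w n \<in> link_states m' p" "restr w' n \<in> link_states m' p" using n0 n by auto
  have "m' = n" "p = card {i. i < n \<and> i < w i}"
    using p(1) link_states_map[OF w(1) n(2)] restr_length_closed[OF n(2)] by (simp_all add: restr_def)
  moreover have "m' = restr_length w' n" "p = card {i. i < restr_length w' n \<and> i < w' i}"
    using p(2) link_states_map[OF w(2) restr_length_props(2)[OF w(2)], of n] by (simp_all add: restr_def)
  ultimately have c: "closed_ivl 0 n w'" "card {i. i < n \<and> i < w' i} = card {i. i < n \<and> i < w i}"
    using restr_length_props(2)[OF w(2), of n] by simp_all
  have "strs 0 n w' = strs 0 n w" using openers_strs[OF w(1) n(2)] openers_strs[OF w(2) c(1)] c(2) by simp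
  moreover have "\<forall>k\<ge>n. w' k = w k"
  proof (intro allI impI)
    fix k assume k: "n \<le> k"
    show "w' k = w k"
    proof (rule ccontr)
      assume "w' k \<noteq> w k"
      then have "k \<le> M" using M by auto
      then show False using k n(1) by simp
    qed
  qed
  ultimately show "sim w w'" unfolding sim_def using w n c by blast
next
  assume s: "sim w w'"
  then obtain N where N: "bounded_by w N w'" using sim_bounded w by blast
  have "finite {i. w i \<noteq> w' i}"
    by (rule finite_subset[of _ "{..<N}"]) (use N in \<open>auto simp: bounded_by_def not_le[symmetric]\<close>)
  moreover have "\<exists>m' p. restr w m \<in> link_states m' p \<and> restr w' m \<in> link_states m' p" if "N \<le> m" for m
  proof -
    let ?n = "restr_length w m"
    have r: "restr_length w' m = ?n" using bounded_restr_length[OF N that] .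
    note p = restr_length_props[OF w(1), of m]
    have c: "closed_ivl 0 ?n w'" "strs 0 ?n w' = strs 0 ?n w"
      using N p that unfolding bounded_by_def by (meson order_trans)+
    then have "card {i. i < ?n \<and> i < w' i} = card {i. i < ?n \<and> i < w i}"
      using openers_strs[OF w(1) p(2)] openers_strs[OF w(2) c(1)] by linarith
    then show ?thesis using link_states_map[OF w(1) p(2)] link_states_map[OF w(2) c(1)] r by (auto simp: restr_def)
  qed
  ultimately show "link_equiv w w'" unfolding link_equiv_def by blast
qed

lemma bilin_form_lin_val: "bilin_form \<delta> x y = lin_val (\<lambda>u. lin_val (link_form \<delta> u) y) x"
  by (simp add: bilin_form_def lin_val_def sum_distrib_left mult.assoc)

lemma lin_val_swap: "lin_val (\<lambda>u. lin_val (f u) y) x = lin_val (\<lambda>v. lin_val (\<lambda>u. f u v) x) y"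
  unfolding lin_val_def sum_distrib_left by (subst sum.swap) (simp add: mult_ac)

lemma lin_val_cong: "(\<And>u. u \<in> Poly_Mapping.keys x \<Longrightarrow> f u = g u) \<Longrightarrow> lin_val f x = lin_val g x"
  by (simp add: lin_val_def)

abbreviation fits :: "inf_link \<Rightarrow> nat \<Rightarrow> inf_link \<Rightarrow> bool" where
  "fits w n v \<equiv> v \<in> inf_link_states \<and> closed_ivl 0 n v \<and> strs 0 n v = strs 0 n w \<and> (\<forall>k\<ge>n. v k = w k)"

text \<open>
  Membership in the radical is tested on closed initial intervals only. Far enough out, restriction is
  injective on the states that occur in \<open>x\<close>, so the restricted vector determines the space of finite link
  states that has to be tested against.
\<close>

lemma inf_radical_iff:
  assumes w: "w \<in> inf_link_states"
  shows "x \<in> inf_radical \<delta> w \<longleftrightarrow> x \<in> eq_span w \<and>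
    (\<exists>N. \<forall>n\<ge>N. closed_ivl 0 n w \<longrightarrow> (\<forall>v. fits w n v \<longrightarrow> lin_val (\<lambda>u. form \<delta> n u v) x = 0))"
proof (cases "x \<in> eq_span w")
  case False then show ?thesis by (simp add: inf_radical_def X_simps[OF w])
next
  case x: True
  obtain N where N: "\<And>u. u \<in> Poly_Mapping.keys x \<Longrightarrow> bounded_by w N u" using span_bounded[OF w x] by blast
  have restr: "restr u m = map u [0..<restr_length w m]" if "u \<in> Poly_Mapping.keys x" "N \<le> m" for u m
    using bounded_restr_length[OF N] that by (simp add: restr_def)
  have pair: "bilin_form \<delta> (restr_vec x m) (Poly_Mapping.single (map v [0..<n]) 1) = lin_val (\<lambda>u. form \<delta> n u v) x"
    if "N \<le> m" "n = restr_length w m" "closed_ivl 0 n v" for m n v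
  proof -
    have "closed_ivl 0 n u" if u: "u \<in> Poly_Mapping.keys x" for u
      using N[OF u] restr_length_props[OF w, of m] \<open>N \<le> m\<close> \<open>n = _\<close> unfolding bounded_by_def by (meson order_trans)
    then show ?thesis unfolding bilin_form_lin_val restr_vec_def lin_val_lin_ext
      by (intro lin_val_cong) (use restr that link_form_form in simp)
  qed
  have keys: "Poly_Mapping.keys (restr_vec x m) \<subseteq> (\<lambda>u. map u [0..<restr_length w m]) ` Poly_Mapping.keys x" if "N \<le> m" for m
    using keys_lin_ext[of "\<lambda>u. Poly_Mapping.single (restr u m) 1" x] restr[OF _ that] unfolding restr_vec_def by auto
  show ?thesis
  proof
    assume "x \<in> inf_radical \<delta> w"
    then obtain M where M: "\<forall>m\<ge>M. \<exists>m' p. restr_vec x m \<in> radical \<delta> m' p" by (auto simp: inf_radical_def)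
    have "lin_val (\<lambda>u. form \<delta> n u v) x = 0" if n: "max N M \<le> n" "closed_ivl 0 n w" and v: "fits w n v" for n v
    proof (cases "x = 0")
      case False
      then obtain u where u: "u \<in> Poly_Mapping.keys x" by fastforce
      have rn: "restr_length w n = n" using restr_length_closed n(2) by blast
      obtain m' p where p: "restr_vec x n \<in> radical \<delta> m' p" using M n by auto
      have "Poly_Mapping.lookup (restr_vec x n) (map u [0..<n]) = lin_val (\<lambda>u'. if u' = u then 1 else 0) x"
        unfolding restr_vec_def lookup_lin_ext
      proof (rule lin_val_cong)
        fix u' assume u': "u' \<in> Poly_Mapping.keys x"
        have "u' = u" if e: "map u' [0..<n] = map u [0..<n]"
        proof
          fix k
          show "u' k = u k"
          proof (cases "k < n")
            case True
            then show ?thesis using e by simp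
          next
            case False then show ?thesis using N[OF u] N[OF u'] n(1) by (simp add: bounded_by_def)
          qed
        qed
        then show "Poly_Mapping.lookup (Poly_Mapping.single (restr u' n) (1 :: complex)) (map u [0..<n]) = (if u' = u then 1 else 0)"
          using restr[OF u', of n] n(1) rn by (auto simp: lookup_single when_def)
      qed
      also have "\<dots> = Poly_Mapping.lookup x u" using u by (simp add: lin_val_def if_distrib sum.delta cong: if_cong)
      finally have "map u [0..<n] \<in> Poly_Mapping.keys (restr_vec x n)" using u by (simp add: in_keys_iff)
      moreover have "Poly_Mapping.keys (restr_vec x n) \<subseteq> link_states m' p" using p by (simp add: radical_def V_def)
      ultimately have us: "map u [0..<n] \<in> link_states m' p" by blast
      have ub: "u \<in> inf_link_states" "closed_ivl 0 n u" "strs 0 n u = strs 0 n w" using N[OF u] n by (auto simp: bounded_by_def)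
      have mp: "m' = n" "p = card {i. i < n \<and> i < u i}" using us link_states_map[OF ub(1,2)] by simp_all
      have "card {i. i < n \<and> i < u i} = card {i. i < n \<and> i < v i}"
        using openers_strs[OF ub(1,2)] openers_strs[of v n] ub(3) v by auto
      then have "map v [0..<n] \<in> link_states m' p" using link_states_map[of v n m' p] v mp by simp
      then have "Poly_Mapping.single (map v [0..<n]) 1 \<in> V m' p" by (simp add: V_def)
      then have "bilin_form \<delta> (restr_vec x n) (Poly_Mapping.single (map v [0..<n]) 1) = 0" using p by (simp add: radical_def)
      then show ?thesis using pair[of n n v] n rn v by simp
    qed simp
    then show "x \<in> eq_span w \<and> (\<exists>N. \<forall>n\<ge>N. closed_ivl 0 n w \<longrightarrow> (\<forall>v. fits w n v \<longrightarrow> lin_val (\<lambda>u. form \<delta> n u v) x = 0))"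
      using x by blast
  next
    assume "x \<in> eq_span w \<and> (\<exists>N. \<forall>n\<ge>N. closed_ivl 0 n w \<longrightarrow> (\<forall>v. fits w n v \<longrightarrow> lin_val (\<lambda>u. form \<delta> n u v) x = 0))"
    then obtain M where M: "\<And>n v. M \<le> n \<Longrightarrow> closed_ivl 0 n w \<Longrightarrow> fits w n v \<Longrightarrow> lin_val (\<lambda>u. form \<delta> n u v) x = 0" by blast
    have "\<exists>m' p. restr_vec x m \<in> radical \<delta> m' p" if m: "max N M \<le> m" for m
    proof -
      define n where "n = restr_length w m"
      have n: "m \<le> n" "closed_ivl 0 n w" unfolding n_def by (rule restr_length_props[OF w])+
      define p where "p = card {i. i < n \<and> i < w i}"
      have ub: "u \<in> inf_link_states" "closed_ivl 0 n u" "strs 0 n u = strs 0 n w" if "u \<in> Poly_Mapping.keys x" for u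
        using N[OF that] n m by (auto simp: bounded_by_def)
      have "map u [0..<n] \<in> link_states n p" if "u \<in> Poly_Mapping.keys x" for u
        using link_states_map[OF ub(1,2)[OF that]] openers_strs[OF ub(1,2)[OF that]] openers_strs[OF w n(2)] ub(3)[OF that]
        by (simp add: p_def)
      then have "restr_vec x m \<in> V n p" using keys[of m] m by (auto simp: V_def n_def)
      moreover have "bilin_form \<delta> (restr_vec x m) y = 0" if y: "y \<in> V n p" for y
      proof -
        have "lin_val (\<lambda>u. link_form \<delta> u b) (restr_vec x m) = 0" if b: "b \<in> Poly_Mapping.keys y" for b
        proof -
          have bl: "b \<in> link_states n p" using y b by (auto simp: V_def)
          then obtain v where v: "v \<in> inf_link_states" "closed_ivl 0 n v" "\<forall>k\<ge>n. v k = w k" "b = map v [0..<n]"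
            using link_states_extend[OF w n(2)] by blast
          have "strs 0 n v = strs 0 n w"
            using link_states_map[OF v(1,2)] bl v(4) openers_strs[OF v(1,2)] openers_strs[OF w n(2)] by (auto simp: p_def)
          then have "lin_val (\<lambda>u. form \<delta> n u v) x = 0" using M[OF _ n(2)] m n v by auto
          then show ?thesis using pair[of m n v] m v by (simp add: n_def bilin_form_lin_val)
        qed
        then show ?thesis unfolding bilin_form_lin_val lin_val_swap[of "link_form \<delta>"] by (simp add: lin_val_def)
      qed
      ultimately show ?thesis by (auto simp: radical_def)
    qed
    then have "\<forall>m\<ge>max N M. \<exists>m' p. restr_vec x m \<in> radical \<delta> m' p" by blast
    then show "x \<in> inf_radical \<delta> w" using x unfolding inf_radical_def X_simps[OF w] by blast
  qed
qed

section \<open>The radical\<close>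

lemma lin_val_mult_left: "lin_val (\<lambda>u. c * f u) x = c * lin_val f x"
  by (simp add: lin_val_def sum_distrib_left mult_ac)

lemma fits_E:
  assumes "w \<in> inf_link_states" "fits w n v" "\<not> both_strings i v" "Suc i < n"
  shows "fits w n (E i v)"
  using assms E_states[of v i] E_closed[of v 0 n i] strs_E[of v i 0 n] E_outside[of v 0 n i] by auto

lemma fits_sim: "w \<in> inf_link_states \<Longrightarrow> closed_ivl 0 n w \<Longrightarrow> fits w n v \<Longrightarrow> sim w v"
  unfolding sim_def by blast

definition fits_vec :: "inf_link \<Rightarrow> nat \<Rightarrow> inf_vec \<Rightarrow> bool" where
  "fits_vec w n x \<longleftrightarrow> (\<forall>u\<in>Poly_Mapping.keys x. fits w n u)"

lemma bounded_fits: "bounded_by w N u \<Longrightarrow> N \<le> n \<Longrightarrow> closed_ivl 0 n w \<Longrightarrow> fits w n u"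
  by (auto simp: bounded_by_def)

lemma span_fits:
  assumes "w \<in> inf_link_states" "x \<in> eq_span w"
  obtains N where "\<And>n. N \<le> n \<Longrightarrow> closed_ivl 0 n w \<Longrightarrow> fits_vec w n x"
proof -
  obtain N where "\<And>u. u \<in> Poly_Mapping.keys x \<Longrightarrow> bounded_by w N u" using span_bounded[OF assms] by blast
  then have "fits_vec w n x" if "N \<le> n" "closed_ivl 0 n w" for n
    unfolding fits_vec_def using bounded_fits that by blast
  then show ?thesis by (rule that)
qed

lemma fits_vec_link_vecs: "fits_vec w n x \<Longrightarrow> x \<in> link_vecs"
  by (auto simp: fits_vec_def link_vecs_def)

lemma keys_act:
  assumes "x \<in> link_vecs" "v \<in> Poly_Mapping.keys (act \<delta> g x)"
  obtains u k where "u \<in> Poly_Mapping.keys x" "wact g u = Some (k, v)"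
proof -
  have "v \<in> (\<Union>u\<in>Poly_Mapping.keys x. Poly_Mapping.keys (act \<delta> g (sg u)))"
    using keys_lin_ext[of "\<lambda>u. act \<delta> g (sg u)" x] assms(2) act_eq_lin_ext[of \<delta> g x] by auto
  then obtain u where u: "u \<in> Poly_Mapping.keys x" "v \<in> Poly_Mapping.keys (act \<delta> g (sg u))" by blast
  then have "u \<in> inf_link_states" using assms(1) by (auto simp: link_vecs_def)
  then have "v \<in> Poly_Mapping.keys (case wact g u of None \<Rightarrow> 0 | Some (k, v) \<Rightarrow> Poly_Mapping.single v (\<delta> ^ k))"
    using u(2) act_wact by metis
  then obtain k where "wact g u = Some (k, v)" by (auto split: option.splits if_splits)
  then show ?thesis using that u(1) by blast
qed

lemma fits_vec_act:
  assumes "fits_vec w n x" "inside 0 n g"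
  shows "fits_vec w n (act \<delta> g x)"
  unfolding fits_vec_def
proof
  fix v assume "v \<in> Poly_Mapping.keys (act \<delta> g x)"
  then obtain u k where u: "u \<in> Poly_Mapping.keys x" "wact g u = Some (k, v)"
    using keys_act[OF fits_vec_link_vecs[OF assms(1)]] by blast
  then have f: "fits w n u" using assms(1) by (auto simp: fits_vec_def)
  then show "fits w n v" using wact_props[OF u(2) assms(2)] wact_link[OF u(2)] by auto
qed

lemma pairing_letter:
  assumes w: "w \<in> inf_link_states" and x: "fits_vec w n x" and v: "fits w n v" and i: "Suc i < n"
  shows "lin_val (\<lambda>u. form \<delta> n u v) (act \<delta> [i] x) = weight \<delta> i v * lin_val (\<lambda>u. form \<delta> n u (E i v)) x"
proof -
  have "lin_val (\<lambda>u. form \<delta> n u v) (act \<delta> [i] x) = lin_val (\<lambda>u. lin_val (\<lambda>u. form \<delta> n u v) (e_link \<delta> i u)) x"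
    by (simp add: act_Cons lin_val_lin_ext)
  also have "\<dots> = lin_val (\<lambda>u. weight \<delta> i v * form \<delta> n u (E i v)) x"
  proof (rule lin_val_cong)
    fix u assume "u \<in> Poly_Mapping.keys x"
    then have u: "fits w n u" using x by (auto simp: fits_vec_def)
    then show "lin_val (\<lambda>u. form \<delta> n u v) (e_link \<delta> i u) = weight \<delta> i v * form \<delta> n u (E i v)"
      using form_adjoint[of u n v i \<delta>] v i by (simp add: e_link_weight)
  qed
  finally show ?thesis by (simp add: lin_val_mult_left)
qed

abbreviation rad :: "complex \<Rightarrow> inf_link \<Rightarrow> inf_vec set" where "rad \<equiv> inf_radical"

text \<open>
  By self-adjointness, pairing \<open>e\<^sub>i x\<close> with \<open>v\<close> is pairing \<open>x\<close> with a multiple of a state.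
\<close>

lemma subrep_rad:
  assumes w: "w \<in> inf_link_states"
  shows "subrep \<delta> (rad \<delta> w)"
proof -
  have z: "0 \<in> rad \<delta> w" unfolding inf_radical_iff[OF w] by (auto simp: span_basic)
  have add: "x + y \<in> rad \<delta> w" if xy: "x \<in> rad \<delta> w" "y \<in> rad \<delta> w" for x y
  proof -
    obtain N where N: "\<forall>n\<ge>N. closed_ivl 0 n w \<longrightarrow> (\<forall>v. fits w n v \<longrightarrow> lin_val (\<lambda>u. form \<delta> n u v) x = 0)" "x \<in> eq_span w"
      using xy(1) unfolding inf_radical_iff[OF w] by blast
    obtain M where M: "\<forall>n\<ge>M. closed_ivl 0 n w \<longrightarrow> (\<forall>v. fits w n v \<longrightarrow> lin_val (\<lambda>u. form \<delta> n u v) y = 0)" "y \<in> eq_span w"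
      using xy(2) unfolding inf_radical_iff[OF w] by blast
    show ?thesis unfolding inf_radical_iff[OF w] lin_val_add
      using N M by (intro conjI span_basic(2) exI[of _ "max N M"]) auto
  qed
  have scl: "scl c x \<in> rad \<delta> w" if "x \<in> rad \<delta> w" for c x
    using that unfolding inf_radical_iff[OF w] lin_val_scl by (auto intro: span_basic(3))
  have letter: "act \<delta> [i] x \<in> rad \<delta> w" if x: "x \<in> rad \<delta> w" for i x
  proof -
    obtain N where N: "\<forall>n\<ge>N. closed_ivl 0 n w \<longrightarrow> (\<forall>v. fits w n v \<longrightarrow> lin_val (\<lambda>u. form \<delta> n u v) x = 0)" and xs: "x \<in> eq_span w"
      using x unfolding inf_radical_iff[OF w] by blast
    obtain M where M: "\<And>n. M \<le> n \<Longrightarrow> closed_ivl 0 n w \<Longrightarrow> fits_vec w n x" using span_fits[OF w xs] by blast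
    have "lin_val (\<lambda>u. form \<delta> n u v) (act \<delta> [i] x) = 0"
      if n: "max (max N M) (i + 2) \<le> n" "closed_ivl 0 n w" and v: "fits w n v" for n v
    proof -
      have "weight \<delta> i v * lin_val (\<lambda>u. form \<delta> n u (E i v)) x = 0"
      proof (cases "both_strings i v")
        case False
        then have "fits w n (E i v)" using fits_E[OF w v] n by auto
        then have "lin_val (\<lambda>u. form \<delta> n u (E i v)) x = 0" using N n by auto
        then show ?thesis by simp
      qed (simp add: weight_def)
      then show ?thesis using pairing_letter[OF w M v] n by simp
    qed
    then show ?thesis unfolding inf_radical_iff[OF w] using act_span[OF w xs] by blast
  qed
  have word: "act \<delta> g x \<in> rad \<delta> w" if "x \<in> rad \<delta> w" for g x
  proof (induction g)
    case (Cons i g)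
    then show ?case using letter[of "act \<delta> g x" i] by (simp add: act_Cons)
  qed (use that in simp)
  have sum: "sum f A \<in> rad \<delta> w" if "\<And>a. a \<in> A \<Longrightarrow> f a \<in> rad \<delta> w" for f and A :: "tl_word set"
    using that by (induction A rule: infinite_finite_induct) (simp_all add: z add)
  have fa: "free_act \<delta> a x \<in> rad \<delta> w" if "x \<in> rad \<delta> w" for a x
    unfolding free_act_def word_act_act by (intro sum scl word that)
  have "rad \<delta> w \<subseteq> eq_span w"
  proof
    fix x assume "x \<in> rad \<delta> w"
    then show "x \<in> eq_span w" unfolding inf_radical_iff[OF w] by (rule conjunct1)
  qed
  then have "rad \<delta> w \<subseteq> link_vecs" using span_link_vecs by (rule subset_trans)
  then show ?thesis unfolding subrep_def using z add fa by blast
qed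

lemma rad_span: "w \<in> inf_link_states \<Longrightarrow> rad \<delta> w \<subseteq> eq_span w"
  using inf_radical_iff by (metis subsetI)

lemma state_notin_rad:
  assumes "w \<in> inf_link_states" "sg w \<notin> rad \<delta> w" "sim w u"
  shows "sg u \<notin> rad \<delta> w"
proof
  assume "sg u \<in> rad \<delta> w"
  then have "eq_span w \<subseteq> rad \<delta> w" using subrep_contains_span[OF assms(1) subrep_rad[OF assms(1)] assms(3)] by blast
  then show False using assms(2) span_single[of w w] sim_refl[OF assms(1)] by blast
qed

lemma flat_strs:
  assumes "flat 0 p u" "2 * p \<le> n"
  shows "strs 0 n u \<le> n - 2 * p"
proof -
  have "u j \<noteq> j" if "j < 2 * p" for j
  proof -
    have "j div 2 < p" "j = 2 * (j div 2) \<or> j = Suc (2 * (j div 2))" using that by (simp, presburger)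
    then show ?thesis using assms(1) unfolding flat_def by (metis add_0 n_not_Suc_n)
  qed
  then have "strs 0 (2 * p) u = 0" by (simp add: strs_eq_0_iff)
  then show ?thesis using strs_split[of 0 "2 * p" n u] strs_le[of "2 * p" n u] assms(2) by simp
qed

text \<open>
  Self-adjointness, letter by letter, moves a word that builds \<open>v\<close> from \<open>c\<close> to the other argument.
\<close>

lemma pairing_word:
  assumes w: "w \<in> inf_link_states" and r: "wact r c = Some (0, v)" "inside 0 n r" and c: "fits w n c"
    and x: "fits_vec w n x"
  shows "lin_val (\<lambda>u. form \<delta> n u v) x = lin_val (\<lambda>u. form \<delta> n u c) (act \<delta> (rev r) x)"
  using r x
proof (induction r arbitrary: v x)
  case Nil then show ?case by simp
next
  case (Cons i r)
  obtain k v' where v': "wact r c = Some (k, v')" "\<not> both_strings i v'" "v = E i v'" "0 = (if v' i = Suc i then Suc k else k)"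
    using Cons.prems(1) by (auto simp: wact_Cons_Some simp del: wact.simps(2))
  then have k: "k = 0" "v' i \<noteq> Suc i" by (auto split: if_splits)
  have i: "Suc i < n" "inside 0 n r" using Cons.prems by auto
  have fv: "fits w n v'" using wact_props[OF v'(1) i(2)] wact_link[OF v'(1)] c by auto
  have "lin_val (\<lambda>u. form \<delta> n u v) x = lin_val (\<lambda>u. form \<delta> n u v') (act \<delta> [i] x)"
    using pairing_letter[OF w Cons.prems(3) fv i(1), of \<delta>] v' k by (simp add: weight_def)
  also have "\<dots> = lin_val (\<lambda>u. form \<delta> n u c) (act \<delta> (rev r) (act \<delta> [i] x))"
    using Cons.IH[of v' "act \<delta> [i] x"] v'(1) k i fits_vec_act[OF Cons.prems(3), of "[i]"] by simp
  finally show ?case by (simp add: act_append)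
qed

lemma lin_ext_proportional: "lin_ext (\<lambda>u. Poly_Mapping.single c (f u)) y = Poly_Mapping.single c (lin_val f y)"
proof -
  have "scl a (Poly_Mapping.single c b) = Poly_Mapping.single c (a * b)" for a b by simp
  moreover have "(\<Sum>b\<in>A. Poly_Mapping.single c (g b)) = Poly_Mapping.single c (sum g A)" for A g
    by (induction A rule: infinite_finite_induct) (simp_all add: single_add)
  ultimately show ?thesis by (simp add: lin_ext_def lin_val_def)
qed

text \<open>
  Choose a state \<open>v\<close> that pairs nontrivially with \<open>x\<close>, build it from the canonical state \<open>c\<close> by a word \<open>r\<close>, and
  let \<open>g\<close> be the reversed \<open>r\<close> followed by the word of the canonical cups. Then \<open>g\<close> maps \<open>x\<close> to its pairing with
  \<open>v\<close>, times \<open>c\<close>. The image of \<open>g\<close> has all cups of \<open>c\<close>, which leaves no room for more strings.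
\<close>

lemma extraction:
  assumes w: "w \<in> inf_link_states" and x: "x \<in> eq_span w" "x \<notin> rad \<delta> w"
  obtains n g p c \<kappa> where "K \<le> n" "closed_ivl 0 n w" "inside 0 n g" "\<kappa> \<noteq> 0" "canon 0 n p c" "fits w n c"
    "act \<delta> g x = scl \<kappa> (sg c)"
    "\<And>u. u \<in> inf_link_states \<Longrightarrow> closed_ivl 0 n u \<Longrightarrow> strs 0 n w < strs 0 n u \<Longrightarrow> act \<delta> g (sg u) = 0"
proof -
  obtain N where N: "\<And>n. N \<le> n \<Longrightarrow> closed_ivl 0 n w \<Longrightarrow> fits_vec w n x" using span_fits[OF w x(1)] by blast
  obtain n v where n: "max K N \<le> n" "closed_ivl 0 n w" and v: "fits w n v" "lin_val (\<lambda>u. form \<delta> n u v) x \<noteq> 0"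
    using x unfolding inf_radical_iff[OF w] by meson
  obtain c p where c: "reach 0 n w c" "canon 0 n p c" using reach_canon[OF w n(2)] by auto
  note pc = reach_props[OF c(1) w n(2)]
  have fc: "fits w n c" using pc by auto
  have "reach 0 n c v" by (rule reach_within) (use fc v(1) in auto)
  then obtain r where r: "inside 0 n r" "wact r c = Some (0, v)" using reach_word by blast
  have p: "2 * p \<le> n" using c(2) by (simp add: canon_def)
  then have cap_word: "inside 0 n (cap_word p)" by (auto simp: inside_def cap_word_def)
  define y where "y = act \<delta> (rev r) x"
  have fy: "fits_vec w n y" unfolding y_def using fits_vec_act[OF N, of n "rev r"] r n by simp
  have yx: "lin_val (\<lambda>u. form \<delta> n u c) y = lin_val (\<lambda>u. form \<delta> n u v) x"
    unfolding y_def using pairing_word[OF w r(2,1) fc N] n by simp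
  (* on states with the tail of w the word acts as pairing with c *)
  have "act \<delta> (cap_word p) y = lin_ext (\<lambda>u. Poly_Mapping.single c (form \<delta> n u c)) y"
    unfolding act_eq_lin_ext[of \<delta> "cap_word p" y]
  proof (rule lin_ext_cong)
    fix u assume "u \<in> Poly_Mapping.keys y"
    then have u: "fits w n u" using fy by (auto simp: fits_vec_def)
    have "wact (cap_word p) u = (if strings_connected n c u then Some (card (loop_classes n c u), c) else None)"
      by (rule cap_word_canon) (use u fc c in auto)
    then have "act \<delta> (cap_word p) (sg u) = Poly_Mapping.single c (form \<delta> n c u)"
      using act_wact[of u \<delta> "cap_word p"] u by (simp add: form_def)
    then show "act \<delta> (cap_word p) (sg u) = Poly_Mapping.single c (form \<delta> n u c)"
      using form_sym[of u c n \<delta>] u fc by simp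
  qed
  then have A: "act \<delta> (cap_word p @ rev r) x = scl (lin_val (\<lambda>u. form \<delta> n u v) x) (sg c)"
    unfolding lin_ext_proportional yx by (simp add: act_append y_def)
  have B: "act \<delta> (cap_word p @ rev r) (sg u) = 0"
    if u: "u \<in> inf_link_states" "closed_ivl 0 n u" "strs 0 n w < strs 0 n u" for u
  proof (cases "wact (cap_word p @ rev r) u")
    case None then show ?thesis using act_wact[OF u(1)] by simp
  next
    case (Some a)
    obtain k z where a: "a = (k, z)" by fastforce
    obtain k1 u1 k2 where 1: "wact (rev r) u = Some (k1, u1)" "wact (cap_word p) u1 = Some (k2, z)"
      using Some a by (auto simp: wact_append split: option.splits)
    have "flat 0 p z" using cap_word_flat[OF 1(2)] wact_link[OF 1(1) u(1)] by blast
    then have "strs 0 n z \<le> n - 2 * p" using flat_strs p by blast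
    also have "\<dots> = strs 0 n w" using canon_strs[OF c(2)] pc by simp
    finally have "strs 0 n z \<le> strs 0 n w" .
    moreover have "strs 0 n z = strs 0 n u"
      using wact_props[of "cap_word p @ rev r" u k z 0 n] Some a u cap_word r by simp
    ultimately show ?thesis using u(3) by simp
  qed
  have "K \<le> n" "inside 0 n (cap_word p @ rev r)" using n cap_word r by simp_all
  then show ?thesis using that[of n "cap_word p @ rev r" "lin_val (\<lambda>u. form \<delta> n u v) x" p c] n v(2) c(2) fc A B by blast
qed

section \<open>Isomorphism of the cyclic representations\<close>

text \<open>
  A right end is controlled by its left end, which is far out as well beyond a closed interval.
\<close>

lemma agree_tail:
  assumes w: "w \<in> inf_link_states" "w' \<in> inf_link_states"
    and 1: "\<And>i. N \<le> i \<Longrightarrow> i < w i \<Longrightarrow> w' i = w i" and 2: "\<And>i. N \<le> i \<Longrightarrow> i < w' i \<Longrightarrow> w i = w' i"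
  obtains M where "\<And>i. M \<le> i \<Longrightarrow> w i = w' i"
proof -
  obtain n where n: "N \<le> n" "closed_ivl 0 n w" using closed_cofinal[OF w(1)] by blast
  obtain m where m: "N \<le> m" "closed_ivl 0 m w'" using closed_cofinal[OF w(2)] by blast
  have "w i = w' i" if i: "max n m \<le> i" for i
  proof -
    have wi: "N \<le> w i" "N \<le> w' i" using closed_ivl_inv[OF w(1) n(2), of i] closed_ivl_inv[OF w(2) m(2), of i] n m i by auto
    consider "i < w i" | "i < w' i" | "w i < i" | "w' i < i" | "w i = i" "w' i = i" by linarith
    then show ?thesis
    proof cases
      case 1 then show ?thesis using assms(3) i n by simp
    next
      case 2 then show ?thesis using assms(4) i n by simp
    next
      case 3
      then have "w' (w i) = i" using assms(3)[of "w i"] wi link_inv[OF w(1)] by simp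
      then show ?thesis using link_inv[OF w(2), of "w i"] by simp
    next
      case 4
      then have "w (w' i) = i" using assms(4)[of "w' i"] wi link_inv[OF w(2)] by simp
      then show ?thesis using link_inv[OF w(1), of "w' i"] by simp
    qed simp
  qed
  then show ?thesis by (rule that)
qed

lemma free_act_word_diff:
  "free_act \<delta> (Poly_Mapping.single (Word g) 1 - Poly_Mapping.single (Word h) 1) x = act \<delta> g x - act \<delta> h x"
proof -
  have "free_act \<delta> (a - b) x = free_act \<delta> a x - free_act \<delta> b x" for a b
    using free_act_add_left[of \<delta> a "- b" x] by (simp add: free_act_neg)
  then show ?thesis by (simp only: free_act_word)
qed

text \<open>
  The projector onto a far cup of \<open>w\<close> fixes \<open>w\<close>, hence \<open>x'\<close>, so all states in \<open>x'\<close> have this cup.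
\<close>

lemma X_witness_cups:
  assumes w: "w \<in> inf_link_states" "w' \<in> inf_link_states" and x: "x' \<in> eq_span w'" "x' \<noteq> 0"
    and a: "\<And>g h. act \<delta> g (sg w) = act \<delta> h (sg w) \<Longrightarrow> act \<delta> g x' = act \<delta> h x'"
  obtains N where "\<And>i. N \<le> i \<Longrightarrow> i < w i \<Longrightarrow> w' i = w i"
proof -
  obtain N where N: "\<And>u. u \<in> Poly_Mapping.keys x' \<Longrightarrow> bounded_by w' N u" using span_bounded[OF w(2) x(1)] by blast
  have "w' i = w i" if i: "N \<le> i" "i < w i" for i
  proof -
    obtain g where g: "\<forall>l\<in>set g. i \<le> l" "wact g w = Some (0, w)"
      "\<forall>u k v. u \<in> inf_link_states \<longrightarrow> wact g u = Some (k, v) \<longrightarrow> v i = w i"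
      using cup_projector[OF w(1) i(2)] by blast
    have "act \<delta> g x' = x'" using a[of g "[]"] act_wact[OF w(1), of \<delta> g] g(2) by simp
    moreover obtain u where u: "u \<in> Poly_Mapping.keys x'" using x(2) by (metis all_not_in_conv keys_eq_empty)
    ultimately have ua: "u \<in> Poly_Mapping.keys (act \<delta> g x')" by simp
    have "x' \<in> link_vecs" using x(1) span_link_vecs by (rule subsetD[rotated])
    then obtain u' k where u': "u' \<in> Poly_Mapping.keys x'" "wact g u' = Some (k, u)"
      using ua by (rule keys_act)
    have "u' \<in> inf_link_states" using N[OF u'(1)] by (simp add: bounded_by_def)
    then have "u i = w i" using g(3) u'(2) by blast
    then show ?thesis using N[OF u] i by (simp add: bounded_by_def)
  qed
  then show ?thesis by (rule that)
qed

text \<open>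
  Flatten \<open>w\<close> on the interval. The projector onto the flat cups fixes the flattened state, hence the
  image of \<open>x'\<close>, whose states thus have at least as many cups as \<open>w\<close>.
\<close>

lemma X_witness_strings:
  assumes w: "w \<in> inf_link_states" "w' \<in> inf_link_states" and x: "x' \<in> eq_span w'" "x' \<noteq> 0"
    and a: "\<And>g h. act \<delta> g (sg w) = act \<delta> h (sg w) \<Longrightarrow> act \<delta> g x' = act \<delta> h x'"
  obtains N where "\<And>n. N \<le> n \<Longrightarrow> closed_ivl 0 n w \<Longrightarrow> closed_ivl 0 n w' \<Longrightarrow> strs 0 n w' \<le> strs 0 n w"
proof -
  obtain N where N: "\<And>n. N \<le> n \<Longrightarrow> closed_ivl 0 n w' \<Longrightarrow> fits_vec w' n x'" using span_fits[OF w(2) x(1)] by blast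
  have "strs 0 n w' \<le> strs 0 n w" if n: "N \<le> n" "closed_ivl 0 n w" "closed_ivl 0 n w'" for n
  proof -
    obtain c p where c: "reach 0 n w c" "canon 0 n p c" using reach_canon[OF w(1) n(2)] by auto
    note pc = reach_props[OF c(1) w(1) n(2)]
    have fl: "flat 0 p c" and p: "2 * p \<le> n" using c(2) by (simp_all add: canon_def)
    have "reach 0 n c w" by (rule reach_within) (use pc w n in auto)
    then obtain r' where r': "inside 0 n r'" "wact r' c = Some (0, w)" using reach_word by blast
    obtain r where r: "inside 0 n r" "wact r w = Some (0, c)" using reach_word[OF c(1)] by blast
    let ?Q = "flat_word 0 p"
    have cl: "c \<in> inf_link_states" using pc by blast
    have aw: "act \<delta> r (sg w) = sg c" "act \<delta> r' (sg c) = sg w" "act \<delta> ?Q (sg c) = sg c"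
      using act_wact[OF w(1), of \<delta> r] act_wact[OF cl, of \<delta>] r r' flat_word_id[OF cl fl] by simp_all
    then have "act \<delta> (r' @ r) (sg w) = act \<delta> [] (sg w)" "act \<delta> (?Q @ r) (sg w) = act \<delta> r (sg w)"
      by (simp_all add: act_append)
    then have x: "act \<delta> r' (act \<delta> r x') = x'" "act \<delta> ?Q (act \<delta> r x') = act \<delta> r x'"
      using a by (metis act_append act_Nil)+
    have f: "fits_vec w' n (act \<delta> r x')" using fits_vec_act[OF N[OF n(1,3)] r(1)] .
    have "act \<delta> r x' \<noteq> 0" using x(1) assms(4) by auto
    then obtain u where u: "u \<in> Poly_Mapping.keys (act \<delta> r x')" by (metis all_not_in_conv keys_eq_empty)
    then have "u \<in> Poly_Mapping.keys (act \<delta> ?Q (act \<delta> r x'))" unfolding x(2) .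
    with fits_vec_link_vecs[OF f] obtain u' k where u': "u' \<in> Poly_Mapping.keys (act \<delta> r x')" "wact ?Q u' = Some (k, u)"
      by (rule keys_act)
    then have "u' \<in> inf_link_states" using f by (auto simp: fits_vec_def)
    then have "flat 0 p u" using flat_word_flat u'(2) by blast
    then have "strs 0 n u \<le> n - 2 * p" using flat_strs p by blast
    moreover have "strs 0 n u = strs 0 n w'" using f u by (auto simp: fits_vec_def)
    moreover have "n - 2 * p = strs 0 n w" using canon_strs[OF c(2)] pc by simp
    ultimately show ?thesis by simp
  qed
  then show ?thesis by (rule that)
qed

lemma X_iso_words:
  assumes w: "w \<in> inf_link_states" "w' \<in> inf_link_states" and iso: "module_iso (TL \<delta>) (X \<delta> w) (X \<delta> w')"
  obtains x' where "x' \<in> eq_span w'" "x' \<noteq> 0" "\<And>g h. act \<delta> g (sg w) = act \<delta> h (sg w) \<Longrightarrow> act \<delta> g x' = act \<delta> h x'"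
proof -
  obtain x' where x: "x' \<in> eq_span w'" "\<And>a. free_act \<delta> a (sg w) = 0 \<longleftrightarrow> free_act \<delta> a x' = 0"
    using X_iso_witness[OF w iso] by blast
  have "x' \<noteq> 0" using x(2)[of 1] by (metis free_act_one single_zero lookup_single_eq lookup_zero zero_neq_one)
  moreover have "act \<delta> g x' = act \<delta> h x'" if "act \<delta> g (sg w) = act \<delta> h (sg w)" for g h
    using x(2)[of "Poly_Mapping.single (Word g) 1 - Poly_Mapping.single (Word h) 1"] that
    unfolding free_act_word_diff by simp
  ultimately show ?thesis using that x(1) by blast
qed

lemma sim_from_tail:
  assumes w: "w \<in> inf_link_states" "w' \<in> inf_link_states" and t: "\<And>i. M \<le> i \<Longrightarrow> w i = w' i"
    and s: "\<And>n. N \<le> n \<Longrightarrow> closed_ivl 0 n w \<Longrightarrow> closed_ivl 0 n w' \<Longrightarrow> strs 0 n w' = strs 0 n w"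
  shows "sim w w'"
proof -
  obtain m where m: "max M N \<le> m" "closed_ivl 0 m w'" using closed_cofinal[OF w(2)] by blast
  obtain n where n: "m \<le> n" "closed_ivl 0 n w" using closed_cofinal[OF w(1)] by blast
  have "closed_ivl 0 n w'" by (rule closed_ivl_tail[OF w(2,1) m(2) _ n]) (use t m in auto)
  then show ?thesis unfolding sim_def using w n m t s[of n] by (intro conjI exI[of _ n]) auto
qed

text \<open>
  Equivalent states generate the same space, and the representations are then literally equal.
\<close>

lemma X_iso_iff:
  assumes w: "w \<in> inf_link_states" "w' \<in> inf_link_states"
  shows "module_iso (TL \<delta>) (X \<delta> w) (X \<delta> w') \<longleftrightarrow> sim w w'"
proof
  assume iso: "module_iso (TL \<delta>) (X \<delta> w) (X \<delta> w')"
  obtain x' where x: "x' \<in> eq_span w'" "x' \<noteq> 0" "\<And>g h. act \<delta> g (sg w) = act \<delta> h (sg w) \<Longrightarrow> act \<delta> g x' = act \<delta> h x'"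
    using X_iso_words[OF w iso] by blast
  obtain y where y: "y \<in> eq_span w" "y \<noteq> 0" "\<And>g h. act \<delta> g (sg w') = act \<delta> h (sg w') \<Longrightarrow> act \<delta> g y = act \<delta> h y"
    using X_iso_words[OF w(2,1) X_iso_sym[OF w iso]] by blast
  obtain N1 where N1: "\<And>i. N1 \<le> i \<Longrightarrow> i < w i \<Longrightarrow> w' i = w i" using X_witness_cups[OF w x] by blast
  obtain N2 where N2: "\<And>i. N2 \<le> i \<Longrightarrow> i < w' i \<Longrightarrow> w i = w' i" using X_witness_cups[OF w(2,1) y] by blast
  obtain M where M: "\<And>i. M \<le> i \<Longrightarrow> w i = w' i"
    using agree_tail[OF w, of "max N1 N2"] N1 N2 by (metis max.bounded_iff)
  obtain K1 where K1: "\<And>n. K1 \<le> n \<Longrightarrow> closed_ivl 0 n w \<Longrightarrow> closed_ivl 0 n w' \<Longrightarrow> strs 0 n w' \<le> strs 0 n w"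
    using X_witness_strings[OF w x] by blast
  obtain K2 where K2: "\<And>n. K2 \<le> n \<Longrightarrow> closed_ivl 0 n w' \<Longrightarrow> closed_ivl 0 n w \<Longrightarrow> strs 0 n w \<le> strs 0 n w'"
    using X_witness_strings[OF w(2,1) y] by blast
  show "sim w w'"
  proof (rule sim_from_tail[OF w])
    show "w i = w' i" if "M \<le> i" for i using M that by blast
    show "strs 0 n w' = strs 0 n w" if "max K1 K2 \<le> n" "closed_ivl 0 n w" "closed_ivl 0 n w'" for n
      using K1[of n] K2[of n] that by (intro antisym) auto
  qed
next
  assume s: "sim w w'"
  then have "sim w' u \<longleftrightarrow> sim w u" for u using sim_trans w sim_sym by metis
  then have "eq_span w' = eq_span w" by (simp add: eq_span_def)
  then have "X \<delta> w' = X \<delta> w"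
    using X_simps(1)[OF w(1), of \<delta>] X_simps(1)[OF w(2), of \<delta>] by (simp add: X_def)
  then show "module_iso (TL \<delta>) (X \<delta> w) (X \<delta> w')" using module_iso_refl by metis
qed

section \<open>Congruent states modulo the radical\<close>

definition cup_block :: "nat \<Rightarrow> nat \<Rightarrow> inf_link \<Rightarrow> bool" where
  "cup_block a b u \<longleftrightarrow> closed_ivl a b u \<and> (\<forall>k. a \<le> k \<and> k < b \<longrightarrow> u k \<noteq> k)"

lemma cup_block_E:
  assumes u: "u \<in> inf_link_states" "cup_block a b u" and i: "a \<le> i" "Suc i < b"
  shows "\<not> both_strings i u" "cup_block a b (E i u)"
proof -
  show d: "\<not> both_strings i u" using assms by (auto simp: cup_block_def both_strings_def)
  have c: "closed_ivl a b u" using u(2) by (simp add: cup_block_def)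
  have "strs a b u = 0" using u(2) by (simp add: cup_block_def strs_eq_0_iff)
  then have "strs a b (E i u) = 0" using strs_E[OF u(1) d c i] by simp
  then show "cup_block a b (E i u)" using E_closed[OF u(1) c i] by (simp add: cup_block_def strs_eq_0_iff)
qed

lemma closed_between:
  assumes u: "u \<in> inf_link_states" and "u r = r" "u s = s"
  shows "closed_ivl (Suc r) s u"
  unfolding closed_ivl_def
proof (intro allI impI)
  fix k assume k: "Suc r \<le> k \<and> k < s"
  note inv = link_inv[OF u]
  have "u k \<noteq> r" "u k \<noteq> s" using inv[of k] assms k by auto
  moreover have "\<not> u k < r" using link_nest(3)[OF u, of "u k" r] inv[of k] assms k by auto
  moreover have "\<not> s < u k" using link_nest(3)[OF u, of k s] assms k by auto
  ultimately show "Suc r \<le> u k \<and> u k < s" by linarith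
qed

lemma closed_after:
  assumes u: "u \<in> inf_link_states" and "u r = r" "closed_ivl 0 n u"
  shows "closed_ivl (Suc r) n u"
  unfolding closed_ivl_def
proof (intro allI impI)
  fix k assume k: "Suc r \<le> k \<and> k < n"
  note inv = link_inv[OF u]
  have "u k \<noteq> r" using inv[of k] assms k by auto
  moreover have "\<not> u k < r" using link_nest(3)[OF u, of "u k" r] inv[of k] assms k by auto
  moreover have "u k < n" using assms(3) k by (simp add: closed_0)
  ultimately show "Suc r \<le> u k \<and> u k < n" by linarith
qed

text \<open>
  The situation of a nonzero quotient: \<open>w\<close>, and therefore each state equivalent to it, lies outside the
  radical.
\<close>

locale radical_quotient =
  fixes \<delta> :: complex and w :: inf_link
  assumes w: "w \<in> inf_link_states" and nontriv: "sg w \<notin> rad \<delta> w"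
begin

text \<open>
  Proportionality of states in the quotient. It is an equivalence relation because no state is zero there.
\<close>

definition cong :: "inf_link \<Rightarrow> inf_link \<Rightarrow> bool" where
  "cong u v \<longleftrightarrow> sim w u \<and> sim w v \<and> (\<exists>c. c \<noteq> 0 \<and> sg u - scl c (sg v) \<in> rad \<delta> w)"

lemmas subrep = subrepD[OF subrep_rad[OF w, of \<delta>]]

lemma cong_link: "cong u v \<Longrightarrow> u \<in> inf_link_states \<and> v \<in> inf_link_states"
  by (auto simp: cong_def sim_link)

lemma state_notin: "sim w u \<Longrightarrow> sg u \<notin> rad \<delta> w" by (rule state_notin_rad[OF w nontriv])

lemma scl_in_rad: "sim w u \<Longrightarrow> scl c (sg u) \<in> rad \<delta> w \<Longrightarrow> c = 0"
proof (rule ccontr)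
  assume "sim w u" "scl c (sg u) \<in> rad \<delta> w" "c \<noteq> 0"
  then have "scl (1 / c) (scl c (sg u)) \<in> rad \<delta> w" using subrep(6) by blast
  then show False using state_notin[OF \<open>sim w u\<close>] \<open>c \<noteq> 0\<close> by simp
qed

lemma cong_sym: "cong u v \<Longrightarrow> cong v u"
proof -
  assume "cong u v"
  then obtain c where c: "sim w u" "sim w v" "c \<noteq> 0" "sg u - scl c (sg v) \<in> rad \<delta> w" by (auto simp: cong_def)
  have "scl (- (1 / c)) (sg u - scl c (sg v)) = sg v - scl (1 / c) (sg u)"
    using c(3) by (intro poly_mapping_eqI) (simp add: lookup_minus field_simps del: scl_simps)
  then have "sg v - scl (1 / c) (sg u) \<in> rad \<delta> w" using subrep(6)[OF c(4), of "- (1 / c)"] by metis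
  then show ?thesis using c unfolding cong_def by (intro conjI exI[of _ "1 / c"]) auto
qed

lemma act_letter: "u \<in> inf_link_states \<Longrightarrow> act \<delta> [i] (sg u) = scl (weight \<delta> i u) (sg (E i u))"
  by (simp add: act_Cons e_link_weight)

lemma sim_E': "sim w u \<Longrightarrow> \<not> both_strings i u \<Longrightarrow> sim w (E i u)"
  using sim_trans[OF w] sim_E sim_link by blast

text \<open>
  The generator maps \<open>u\<close> to a state, which is nonzero in the quotient; so it cannot kill \<open>v\<close>.
\<close>

lemma cong_E_aux:
  assumes "cong u v" "\<not> both_strings i u" "u i \<noteq> Suc i"
  shows "weight \<delta> i v \<noteq> 0" "cong (E i u) (E i v)"
proof -
  obtain c where c: "sim w u" "sim w v" "c \<noteq> 0" "sg u - scl c (sg v) \<in> rad \<delta> w" using assms by (auto simp: cong_def)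
  have "act \<delta> [i] (sg u - scl c (sg v)) = sg (E i u) - scl (c * weight \<delta> i v) (sg (E i v))"
  proof -
    have "weight \<delta> i u = 1" using assms(2,3) by (simp add: weight_def)
    then show ?thesis
      by (simp only: act_diff act_scl act_letter[OF sim_link[OF c(1)]] act_letter[OF sim_link[OF c(2)]] scl_simps(3,4))
  qed
  then have r: "sg (E i u) - scl (c * weight \<delta> i v) (sg (E i v)) \<in> rad \<delta> w" using subrep(5)[OF c(4), of "[i]"] by simp
  show wt: "weight \<delta> i v \<noteq> 0"
  proof
    assume "weight \<delta> i v = 0"
    then have "sg (E i u) \<in> rad \<delta> w" using r by simp
    then show False using state_notin sim_E' c(1) assms(2) by blast
  qed
  then have "\<not> both_strings i v" by (auto simp: weight_def)
  then show "cong (E i u) (E i v)" unfolding cong_def using r wt c sim_E' assms(2)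
    by (intro conjI exI[of _ "c * weight \<delta> i v"]) auto
qed

lemma cong_E: "cong u v \<Longrightarrow> \<not> both_strings i u \<Longrightarrow> u i \<noteq> Suc i \<Longrightarrow> cong (E i u) (E i v)"
  by (rule cong_E_aux)

lemma cong_both_strings:
  assumes "cong u v" "both_strings i u" "v i \<noteq> Suc i"
  shows "both_strings i v"
  using cong_E_aux(1)[OF cong_sym[OF assms(1)], of i] assms(2,3) by (auto simp: weight_def)

text \<open>
  Let \<open>u = c v\<close> in the quotient. Applying \<open>e\<^sub>i\<close> gives \<open>\<delta> u = c e\<^sub>i v\<close>, and applying \<open>e\<^sub>i e\<^sub>i\<^sub>+\<^sub>1\<close>, which fixes \<open>u\<close>, gives
  \<open>u = c \<delta> e\<^sub>i v\<close>. Hence \<open>c (1 - \<delta>\<^sup>2) e\<^sub>i v = 0\<close>, and \<open>e\<^sub>i v\<close> is a state.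
\<close>

lemma cong_overlap:
  assumes "cong u v" "u i = Suc i" "v (Suc i) = Suc (Suc i)"
  shows "\<delta>\<^sup>2 = 1"
proof -
  obtain c where c: "sim w u" "sim w v" "c \<noteq> 0" "sg u - scl c (sg v) \<in> rad \<delta> w" using assms by (auto simp: cong_def)
  note l = c(1,2)[THEN sim_link]
  have vi: "v i \<noteq> Suc i" using link_inv[OF l(2), of "Suc i"] link_inv[OF l(2), of i] assms(3) by auto
  have d: "\<not> both_strings i v" using assms(3) by (simp add: both_strings_def)
  have w1: "weight \<delta> i v = 1" "weight \<delta> (Suc i) v = \<delta>" "E (Suc i) v = v" "weight \<delta> i u = \<delta>" "E i u = u"
    using vi d assms(2,3) E_loop[OF l(2)] E_loop[OF l(1)] by (auto simp: weight_def both_strings_def)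
  have A: "act \<delta> [i] (sg u - scl c (sg v)) = scl \<delta> (sg u) - scl c (sg (E i v))"
    by (simp only: act_diff act_scl act_letter[OF l(1)] act_letter[OF l(2)] w1 scl_simps(3))
  have "act \<delta> [i, Suc i] (sg u) = sg u" using act_wact[OF l(1), of \<delta> "[i, Suc i]"] cup_pair_word[OF l(1) assms(2)]
    by (simp del: wact.simps)
  moreover have "act \<delta> [i, Suc i] (sg v) = act \<delta> [i] (act \<delta> [Suc i] (sg v))" by (simp add: act_Cons)
  then have "act \<delta> [i, Suc i] (sg v) = scl \<delta> (sg (E i v))"
    using act_letter[OF l(2)] w1 by (simp only: act_scl scl_simps(3))
  ultimately have B: "act \<delta> [i, Suc i] (sg u - scl c (sg v)) = sg u - scl (c * \<delta>) (sg (E i v))"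
    by (simp only: act_diff act_scl scl_simps(4))
  have "scl \<delta> (sg u - scl (c * \<delta>) (sg (E i v))) - (scl \<delta> (sg u) - scl c (sg (E i v))) \<in> rad \<delta> w"
    using subrep(8) subrep(6) subrep(5)[OF c(4)] A B by metis
  moreover have "scl \<delta> (sg u - scl (c * \<delta>) (sg (E i v))) - (scl \<delta> (sg u) - scl c (sg (E i v))) = scl (c * (1 - \<delta>\<^sup>2)) (sg (E i v))"
    by (rule poly_mapping_eqI) (simp add: lookup_minus lookup_add algebra_simps power2_eq_square del: scl_simps)
  ultimately have "c * (1 - \<delta>\<^sup>2) = 0" using scl_in_rad sim_E'[OF c(2) d] by metis
  then show ?thesis using c(3) by simp
qed

text \<open>
  If \<open>a\<close> has the same partner \<open>m\<close> in both states, \<open>e\<^sub>a\<close> makes a cup \<open>{a, a+1}\<close> and loses no information, since \<open>m\<close>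
  is known. So the states still differ after this cup. By induction, they can be made to differ at the
  partner of \<open>a + 2\<close>, and \<open>e\<^sub>a\<^sub>+\<^sub>1\<close> passes this partner on to \<open>a\<close>.
\<close>

lemma block_split:
  assumes "cong u v" "cup_block a b u" "cup_block a b v" "a \<le> k" "k < b" "u k \<noteq> v k"
  shows "\<exists>u' v'. cong u' v' \<and> cup_block a b u' \<and> cup_block a b v' \<and> u' a \<noteq> v' a \<and>
    (\<forall>k. \<not> (a \<le> k \<and> k < b) \<longrightarrow> u' k = u k \<and> v' k = v k)"
  using assms
proof (induction "b - a" arbitrary: a u v k rule: less_induct)
  case less
  note l = cong_link[OF less(2)]
  have ab: "a < b" using less by simp
  show ?case
  proof (cases "u a = v a")
    case False
    then show ?thesis using less by blast
  next
    case True
    define m where "m = u a"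
    have mm: "u a = m" "v a = m" "u m = a" "v m = a" using True l link_inv by (auto simp: m_def) metis
    have ma: "a < m" "m < b" using less(3) ab mm(1) unfolding cup_block_def closed_ivl_def by (metis le_neq_implies_less order_refl)+
    have Sab: "Suc a < b" using ma by simp
    have nd: "\<not> both_strings a u" using cup_block_E less Sab l by auto
    define u1 v1 where "u1 = E a u" and "v1 = E a v"
    have c1: "cong u1 v1"
    proof (cases "m = Suc a")
      case True then show ?thesis using E_loop l mm less(2) by (simp add: u1_def v1_def)
    next
      case False then show ?thesis using cong_E[OF less(2) nd] mm by (simp add: u1_def v1_def)
    qed
    have b1: "cup_block a b u1" "cup_block a b v1" using cup_block_E(2) less l Sab by (auto simp: u1_def v1_def)
    have cup1: "u1 a = Suc a" "u1 (Suc a) = a" "v1 a = Suc a" "v1 (Suc a) = a" by (simp_all add: u1_def v1_def)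
    have o1: "\<forall>k. \<not> (a \<le> k \<and> k < b) \<longrightarrow> u1 k = u k \<and> v1 k = v k"
      using E_outside[of u a b a] E_outside[of v a b a] l less(3,4) Sab by (auto simp: u1_def v1_def cup_block_def)
    have "\<exists>k1. a + 2 \<le> k1 \<and> k1 < b \<and> u1 k1 \<noteq> v1 k1"
    proof (cases "m = Suc a")
      case True
      then have "u1 = u" "v1 = v" using E_loop l mm by (simp_all add: u1_def v1_def)
      moreover have "k \<noteq> a" "k \<noteq> Suc a" using less(7) mm True by auto
      ultimately show ?thesis using less(5-7) by (intro exI[of _ k]) auto
    next
      case False
      then have m2: "a + 2 \<le> m" using ma by simp
      have um: "u (Suc a) \<noteq> Suc a" "v (Suc a) \<noteq> Suc a" using less(3,4) Sab by (auto simp: cup_block_def)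
      have E1: "u1 m = u (Suc a)" "v1 m = v (Suc a)" using m2 mm um by (auto simp: u1_def v1_def E_def)
      have km: "k \<noteq> a" "k \<noteq> m" using less(7) mm by auto
      show ?thesis
      proof (cases "k = Suc a")
        case True then show ?thesis using E1 m2 ma less(7) by (intro exI[of _ m]) auto
      next
        case f: False
        have gen: "E a z k = (if z k = Suc a then m else z k)" if "z a = m" "z m = a" "z \<in> inf_link_states" for z
        proof -
          have "z k \<noteq> a" using that km link_inv[OF that(3), of k] by auto
          then show ?thesis using km f that(1) m2 by (auto simp: E_def)
        qed
        have "u k \<noteq> m" "v k \<noteq> m" using km mm l link_inv by metis+
        then have "u1 k \<noteq> v1 k" using gen[of u] gen[of v] mm l less(7) by (auto simp: u1_def v1_def)
        then show ?thesis using f km less(5,6) by (intro exI[of _ k]) auto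
      qed
    qed
    then obtain k1 where k1: "a + 2 \<le> k1" "k1 < b" "u1 k1 \<noteq> v1 k1" by blast
    note l1 = cong_link[OF c1]
    have b2: "cup_block (a + 2) b u1" "cup_block (a + 2) b v1"
      using b1 closed_split_cup[of u1 a b] closed_split_cup[of v1 a b] l1 cup1 by (auto simp: cup_block_def)
    have "b - (a + 2) < b - a" using ab by simp
    then obtain u2 v2 where 2: "cong u2 v2" "cup_block (a + 2) b u2" "cup_block (a + 2) b v2" "u2 (a + 2) \<noteq> v2 (a + 2)"
      "\<forall>k. \<not> (a + 2 \<le> k \<and> k < b) \<longrightarrow> u2 k = u1 k \<and> v2 k = v1 k"
      using less(1)[OF _ c1 b2 k1] by blast
    note l2 = cong_link[OF 2(1)]
    have cup2: "u2 a = Suc a" "u2 (Suc a) = a" "v2 a = Suc a" "v2 (Suc a) = a" using 2(5) cup1 by auto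
    have ext: "cup_block a b z" if "cup_block (a + 2) b z" "z a = Suc a" "z (Suc a) = a" for z
      unfolding cup_block_def closed_ivl_def
    proof (intro conjI allI impI)
      fix k assume k: "a \<le> k \<and> k < b"
      consider "k = a" | "k = Suc a" | "a + 2 \<le> k" using k by linarith
      then have "a \<le> z k \<and> z k < b \<and> z k \<noteq> k"
      proof cases
        case 3
        then have "a + 2 \<le> z k \<and> z k < b \<and> z k \<noteq> k" using that(1) k by (simp add: cup_block_def closed_ivl_def)
        then show ?thesis by simp
      qed (use that Sab in auto)
      then show "a \<le> z k" "z k < b" "z k \<noteq> k" by simp_all
    qed
    have b3: "cup_block a b u2" "cup_block a b v2" using ext 2 cup2 by blast+
    have a3: "Suc (Suc a) < b" using k1 by simp
    let ?u3 = "E (Suc a) u2" and ?v3 = "E (Suc a) v2"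
    have "cong ?u3 ?v3" using cong_E[OF 2(1)] cup_block_E(1)[of u2 a b "Suc a"] l2 b3 a3 cup2 by simp
    moreover have "cup_block a b ?u3" "cup_block a b ?v3" using cup_block_E(2) l2 b3 a3 by auto
    moreover have "?u3 a = u2 (a + 2)" "?v3 a = v2 (a + 2)"
      using cup2 2(2,3) a3 by (simp_all add: E_def cup_block_def)
    moreover have "?u3 k = u k \<and> ?v3 k = v k" if "\<not> (a \<le> k \<and> k < b)" for k
    proof -
      have "?u3 k = u2 k" "?v3 k = v2 k" using E_outside[of u2 a b "Suc a" k] E_outside[of v2 a b "Suc a" k] l2 b3 a3 that
        by (auto simp: cup_block_def)
      moreover have "\<not> (a + 2 \<le> k \<and> k < b)" using that by auto
      ultimately show ?thesis using 2(5) o1 that by metis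
    qed
    ultimately show ?thesis using 2(4) by metis
  qed
qed

text \<open>
  With \<open>x\<close> the partner of \<open>a + 1\<close> in \<open>v\<close>, the generator \<open>e\<^bsub>x-1\<^esub>\<close> replaces \<open>x\<close> by a smaller partner, until the cup
  \<open>{a+1, a+2}\<close> of \<open>v\<close> overlaps the cup \<open>{a, a+1}\<close> of \<open>u\<close>. The generators used do not touch the cup of \<open>u\<close>.
\<close>

lemma descend_second:
  assumes "cong u v" "u a = Suc a" "Suc a < v a"
  shows "\<delta>\<^sup>2 = 1"
  using assms
proof (induction "v (Suc a)" arbitrary: u v rule: less_induct)
  case less
  note l = cong_link[OF less(2)]
  define x where "x = v (Suc a)"
  have x: "a < x" "x < v a" "x \<noteq> Suc a" using link_nest[of v a "Suc a"] l less(4) by (auto simp: x_def)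
  show ?case
  proof (cases "x = Suc (Suc a)")
    case True
    then show ?thesis using cong_overlap[OF less(2,3)] by (simp add: x_def)
  next
    case False
    then obtain i where i: "x = Suc i" "Suc a < i" using x by (cases x) auto
    have vi: "Suc a < v i" "v i < x" "v i \<noteq> i" using link_nest[of v "Suc a" i] l i by (auto simp: x_def)
    have "\<not> both_strings i v" "v i \<noteq> Suc i" using vi i by (auto simp: both_strings_def)
    then have c: "cong (E i u) (E i v)" using cong_E[OF cong_sym[OF less(2)]] cong_sym by blast
    have "E i v (Suc a) = v i" using i vi by (simp add: E_def x_def)
    moreover have "E i v a = v a" using i x by (simp add: E_def)
    moreover have "E i u a = Suc a" using i less(3) by (simp add: E_def)
    ultimately show ?thesis using less(1)[OF _ c] vi less(4) by (simp add: x_def)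
  qed
qed

text \<open>
  In the same way the partner of \<open>a\<close> in \<open>u\<close> is lowered to \<open>a + 1\<close>; the partner of \<open>a\<close> in \<open>v\<close> lies beyond and
  stays.
\<close>

lemma descend_first:
  assumes "cong u v" "a < u a" "u a < v a"
  shows "\<delta>\<^sup>2 = 1"
  using assms
proof (induction "u a" arbitrary: u v rule: less_induct)
  case less
  note l = cong_link[OF less(2)]
  show ?case
  proof (cases "u a = Suc a")
    case True then show ?thesis using descend_second less by simp
  next
    case False
    then obtain i where i: "u a = Suc i" "a < i" using less(3) by (cases "u a") auto
    have ui: "a < u i" "u i < u a" "u i \<noteq> i" using link_nest[of u a i] l i by auto
    have "\<not> both_strings i u" "u i \<noteq> Suc i" using ui i by (auto simp: both_strings_def)
    then have c: "cong (E i u) (E i v)" using cong_E[OF less(2)] by blast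
    have "E i u a = u i" using i ui by (simp add: E_def)
    moreover have "E i v a = v a" using i less(4) by (simp add: E_def)
    ultimately show ?thesis using less(1)[OF _ c] ui less(4) by simp
  qed
qed

lemma cong_block_delta:
  assumes "cong u v" "cup_block a b u" "cup_block a b v" "a \<le> k" "k < b" "u k \<noteq> v k"
  shows "\<delta>\<^sup>2 = 1"
proof -
  obtain u' v' where 1: "cong u' v'" "cup_block a b u'" "cup_block a b v'" "u' a \<noteq> v' a" using block_split[OF assms] by blast
  have "a < b" using assms by simp
  then have "a < u' a" "a < v' a" using 1(2,3) unfolding cup_block_def closed_ivl_def by (metis le_neq_implies_less order_refl)+
  then show ?thesis using descend_first[OF 1(1)] descend_first[OF cong_sym[OF 1(1)]] 1(4) by (metis nat_neq_iff)
qed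

text \<open>
  The generator \<open>e\<^bsub>s-1\<^esub>\<close> moves the string of \<open>u\<close> at \<open>s\<close> to the left. It finds no string of \<open>v\<close>, and so creates
  none. When the string arrives next to \<open>r\<close>, the generator \<open>e\<^sub>r\<close> kills \<open>u\<close> but not \<open>v\<close>.
\<close>

lemma string_clash:
  assumes "cong u v" "u r = r" "v r = r" "u s = s" "r < s"
    "\<forall>k. r < k \<and> k < s \<longrightarrow> u k \<noteq> k" "\<forall>k. r < k \<and> k \<le> s \<longrightarrow> v k \<noteq> k"
  shows False
  using assms
proof (induction s arbitrary: u v rule: less_induct)
  case (less s)
  note l = cong_link[OF less(2)]
  show False
  proof (cases "s = Suc r")
    case True
    then have "both_strings r u" "v r \<noteq> Suc r" using less by (auto simp: both_strings_def)
    then have "both_strings r v" using cong_both_strings less(2) by blast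
    then show False using less(8) True by (auto simp: both_strings_def)
  next
    case False
    then obtain i where i: "s = Suc i" "r < i" using less(6) by (cases s) auto
    have ui: "u i \<noteq> i" using less(7) i by simp
    have "closed_ivl (Suc r) s u" using closed_between l less by blast
    then have ub: "r < u i" "u i < s" using i by (auto simp: closed_ivl_def Suc_le_eq)
    have "\<not> both_strings i u" "u i \<noteq> Suc i" using ui ub i by (auto simp: both_strings_def)
    then have c: "cong (E i u) (E i v)" using cong_E[OF less(2)] by blast
    have uui: "u (u i) = i" using link_inv l by blast
    show False
    proof (rule less(1)[OF ub(2) c])
      show "E i u r = r" "E i v r = r" using i less(3,4) by (auto simp: E_def)
      show "E i u (u i) = u i" using uui ui ub i less(5) by (auto simp: E_def)
      show "r < u i" by (rule ub)
      show "\<forall>k. r < k \<and> k < u i \<longrightarrow> E i u k \<noteq> k"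
      proof (intro allI impI)
        fix k assume k: "r < k \<and> k < u i"
        then have "u k \<noteq> k" "u k \<noteq> Suc i" "u k \<noteq> i"
          using less(5,7) i ub link_inv[of u k] l uui by auto
        then show "E i u k \<noteq> k" using k ub i by (auto simp: E_def)
      qed
      show "\<forall>k. r < k \<and> k \<le> u i \<longrightarrow> E i v k \<noteq> k"
      proof (intro allI impI)
        fix k assume k: "r < k \<and> k \<le> u i"
        have v: "v k \<noteq> k" "v i \<noteq> i" "v (Suc i) \<noteq> Suc i" using less(8) k ub i by auto
        have "v k = i \<Longrightarrow> v (Suc i) \<noteq> k" "v k = Suc i \<Longrightarrow> v i \<noteq> k"
          using link_inv[of v i] link_inv[of v "Suc i"] link_inv[of v k] l by auto
        then show "E i v k \<noteq> k" using v by (auto simp: E_def)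
      qed
    qed
  qed
qed

text \<open>
  Let the states differ at the partner of \<open>r + 1\<close>. The generator \<open>e\<^sub>r\<close> moves the string at \<open>r\<close> to that partner,
  so the next string after \<open>r0\<close> comes at different places, and \<open>string_clash\<close> applies.
\<close>

lemma block_clash:
  assumes c: "cong u v" and r: "r0 < r" "u r0 = r0" "v r0 = r0" "u r = r" "v r = r"
    and no: "\<forall>k. r0 < k \<and> k < r \<longrightarrow> u k \<noteq> k \<and> v k \<noteq> k"
    and b: "cup_block (Suc r) b u" "cup_block (Suc r) b v" and d: "r < d" "d < b" "u d \<noteq> v d"
  shows False
proof -
  obtain u' v' where 1: "cong u' v'" "cup_block (Suc r) b u'" "cup_block (Suc r) b v'" "u' (Suc r) \<noteq> v' (Suc r)"
    "\<forall>k. \<not> (Suc r \<le> k \<and> k < b) \<longrightarrow> u' k = u k \<and> v' k = v k"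
    using block_split[OF c b, of d] d by auto
  note l = cong_link[OF 1(1)]
  have Sb: "Suc r < b" using d by simp
  have nn: "u' (Suc r) \<noteq> Suc r" "v' (Suc r) \<noteq> Suc r" using 1(2,3) Sb by (auto simp: cup_block_def)
  have rr: "u' r = r" "v' r = r" "u' r0 = r0" "v' r0 = r0" using 1(5) r by auto
  have "cong (E r u') (E r v')" using cong_E[OF 1(1)] nn rr by (auto simp: both_strings_def)
  moreover have props: "E r z r0 = r0 \<and> E r z (z (Suc r)) = z (Suc r) \<and> Suc r < z (Suc r) \<and>
      (\<forall>k. r0 < k \<and> k < z (Suc r) \<longrightarrow> E r z k \<noteq> k)"
    if z: "z \<in> inf_link_states" "cup_block (Suc r) b z" "z r = r" "z r0 = r0" "\<forall>k. r0 < k \<and> k < r \<longrightarrow> z k \<noteq> k" for z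
  proof -
    define t where "t = z (Suc r)"
    have zt: "z t = Suc r" using link_inv[OF z(1)] by (simp add: t_def)
    have t: "Suc r < t" "t < b" using z(2) Sb unfolding cup_block_def closed_ivl_def t_def by (metis le_neq_implies_less order_refl)+
    have "E r z r0 = r0" using r(1) z(4) by (simp add: E_def)
    moreover have "E r z t = t" using t zt z(3) by (simp add: E_def)
    moreover have "E r z k \<noteq> k" if k: "r0 < k" "k < t" for k
    proof (cases "k = r \<or> k = Suc r")
      case False
      have "z k \<noteq> k"
      proof (cases "k < r")
        case True then show ?thesis using z(5) k by simp
      next
        case f: False then show ?thesis using z(2) False k t by (auto simp: cup_block_def)
      qed
      moreover have "z k \<noteq> r" "z k \<noteq> Suc r" using link_inv[OF z(1), of k] z(3) False k by (auto simp: t_def)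
      ultimately show ?thesis using False by (simp add: E_def)
    qed auto
    ultimately show ?thesis using t by (simp add: t_def)
  qed
  have no': "\<forall>k. r0 < k \<and> k < r \<longrightarrow> u' k \<noteq> k" "\<forall>k. r0 < k \<and> k < r \<longrightarrow> v' k \<noteq> k" using no 1(5) by auto
  note U = props[OF l[THEN conjunct1] 1(2) rr(1,3) no'(1)] and V = props[OF l[THEN conjunct2] 1(3) rr(2,4) no'(2)]
  consider "u' (Suc r) < v' (Suc r)" | "v' (Suc r) < u' (Suc r)" using 1(4) by linarith
  then show False
  proof cases
    case 1
    then show ?thesis using string_clash[OF calculation, of r0 "u' (Suc r)"] U V r(1) by auto
  next
    case 2
    then show ?thesis using string_clash[OF cong_sym[OF calculation], of r0 "v' (Suc r)"] U V r(1) by auto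
  qed
qed

lemma sim_common:
  assumes "sim w u" "sim w v"
  obtains n where "K \<le> n" "closed_ivl 0 n w" "fits w n u" "fits w n v"
proof -
  obtain N M where "bounded_by w N u" "bounded_by w M v" using sim_bounded[OF w] assms by metis
  moreover obtain n where "max K (max N M) \<le> n" "closed_ivl 0 n w" using closed_cofinal[OF w] by blast
  ultimately show ?thesis using that[of n] bounded_fits by auto
qed

text \<open>
  Consider the first string after \<open>r\<close> in each state. If these are at different places, \<open>string_clash\<close>
  applies to \<open>r\<close> and the earlier one. If they coincide before \<open>d\<close>, replace the pair \<open>r0\<close>, \<open>r\<close> by \<open>r\<close> and this
  string. Otherwise \<open>d\<close> lies in a block of cups directly after \<open>r\<close>.
\<close>

lemma two_strings_clash:
  assumes c: "cong u v" and r: "r0 < r" "u r0 = r0" "v r0 = r0" "u r = r" "v r = r"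
    and no: "\<forall>k. r0 < k \<and> k < r \<longrightarrow> u k \<noteq> k \<and> v k \<noteq> k" and d: "r < d" "u d \<noteq> v d"
  shows False
  using r no d
proof (induction "d - r" arbitrary: r0 r rule: less_induct)
  case less
  note l = cong_link[OF c]
  have first: "\<exists>s. r < s \<and> z s = s \<and> (\<forall>k. r < k \<and> k < s \<longrightarrow> z k \<noteq> k)" if "\<exists>s. r < s \<and> z s = s" for z :: inf_link
  proof -
    define s where "s = (LEAST s. r < s \<and> z s = s)"
    have "r < s \<and> z s = s" unfolding s_def using that by (rule LeastI_ex)
    moreover have "\<forall>k. r < k \<and> k < s \<longrightarrow> z k \<noteq> k" using not_less_Least unfolding s_def by blast
    ultimately show ?thesis by blast
  qed
  show False
  proof (cases "\<exists>s. r < s \<and> u s = s")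
    case True
    then obtain s where s: "r < s" "u s = s" "\<forall>k. r < k \<and> k < s \<longrightarrow> u k \<noteq> k" using first by blast
    show False
    proof (cases "\<exists>k. r < k \<and> k \<le> s \<and> v k = k")
      case False then show False using string_clash[OF c less(5,6) s(2,1,3)] by blast
    next
      case True
      then obtain t where t: "r < t" "v t = t" "\<forall>k. r < k \<and> k < t \<longrightarrow> v k \<noteq> k" using first[of v] by blast
      have "t \<le> s" using True t by (meson le_trans not_le)
      show False
      proof (cases "t = s")
        case False
        then show False using string_clash[OF cong_sym[OF c] less(6,5) t(2,1,3)] s \<open>t \<le> s\<close> by auto
      next
        case True
        show False
        proof (cases "d < s")
          case ds: True
          have "cup_block (Suc r) s u" "cup_block (Suc r) s v"
            using closed_between[of u r s] closed_between[of v r s] l less(5,6) s t True by (auto simp: cup_block_def)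
          then show False using block_clash[OF c less(2-7) _ _ less(8) ds less(9)] by blast
        next
          case False
          have "d \<noteq> s" using less(9) s t True by auto
          then have "s < d" using False by simp
          then have "d - s < d - r" using s(1) by simp
          moreover have "\<forall>k. r < k \<and> k < s \<longrightarrow> u k \<noteq> k \<and> v k \<noteq> k" "v s = s" using s(3) t True by auto
          ultimately show False using less(1)[of s r] s(1,2) \<open>s < d\<close> less(5,6,9) by blast
        qed
      qed
    qed
  next
    case nu: False
    show False
    proof (cases "\<exists>s. r < s \<and> v s = s")
      case True
      then obtain s where s: "r < s" "v s = s" "\<forall>k. r < k \<and> k < s \<longrightarrow> v k \<noteq> k" using first by blast
      then show False using string_clash[OF cong_sym[OF c] less(6,5) s(2,1,3)] nu by blast
    next
      case nv: False
      have "sim w u" "sim w v" using c by (simp_all add: cong_def)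
      then obtain n where n: "Suc d \<le> n" "closed_ivl 0 n w" "fits w n u" "fits w n v" by (rule sim_common)
      have cup_block: "cup_block (Suc r) n z" if z: "z \<in> inf_link_states" "z r = r" "closed_ivl 0 n z" "\<not> (\<exists>s. r < s \<and> z s = s)" for z
        unfolding cup_block_def
      proof (intro conjI allI impI)
        show "closed_ivl (Suc r) n z" by (rule closed_after[OF z(1-3)])
        show "z k \<noteq> k" if "Suc r \<le> k \<and> k < n" for k using z(4) that by (auto simp: Suc_le_eq)
      qed
      have "cup_block (Suc r) n u" "cup_block (Suc r) n v" using cup_block n(3,4) less(5,6) nu nv by blast+
      moreover have "d < n" using n by simp
      ultimately show False using block_clash[OF c less(2-7) _ _ less(8) _ less(9)] by blast
    qed
  qed
qed

end

section \<open>Irreducible quotients\<close>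

definition rad_coset :: "complex \<Rightarrow> inf_link \<Rightarrow> inf_vec \<Rightarrow> inf_vec set" where
  "rad_coset \<delta> w x = (\<lambda>r. r + x) ` rad \<delta> w"

lemma rad_coset_eq_iff:
  assumes "w \<in> inf_link_states"
  shows "rad_coset \<delta> w x = rad_coset \<delta> w y \<longleftrightarrow> x - y \<in> rad \<delta> w"
proof
  note subrep = subrepD[OF subrep_rad[OF assms, of \<delta>]]
  assume "rad_coset \<delta> w x = rad_coset \<delta> w y"
  moreover have "x \<in> rad_coset \<delta> w x" unfolding rad_coset_def by (rule image_eqI[of _ _ 0]) (simp_all add: subrep(2))
  ultimately obtain r where "r \<in> rad \<delta> w" "x = r + y" unfolding rad_coset_def by blast
  then show "x - y \<in> rad \<delta> w" by simp
next
  note subrep = subrepD[OF subrep_rad[OF assms, of \<delta>]]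
  assume d: "x - y \<in> rad \<delta> w"
  have "rad_coset \<delta> w a \<subseteq> rad_coset \<delta> w b" if "a - b \<in> rad \<delta> w" for a b
  proof
    fix z assume "z \<in> rad_coset \<delta> w a"
    then obtain r where r: "r \<in> rad \<delta> w" "z = r + a" unfolding rad_coset_def by blast
    then have "z = (r + (a - b)) + b" by simp
    then show "z \<in> rad_coset \<delta> w b" using subrep(3)[OF r(1) that] unfolding rad_coset_def by blast
  qed
  moreover have "y - x \<in> rad \<delta> w" using subrep(7)[OF d] by simp
  ultimately show "rad_coset \<delta> w x = rad_coset \<delta> w y" using d by blast
qed

lemma rad_coset_zero: "rad_coset \<delta> w 0 = rad \<delta> w" by (simp add: rad_coset_def)

lemma rcoset_X: "w \<in> inf_link_states \<Longrightarrow> rad \<delta> w +>\<^bsub>X \<delta> w\<^esub> x = rad_coset \<delta> w x"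
  by (auto simp: a_r_coset_def r_coset_def rad_coset_def X_simps)

lemma L_carrier:
  assumes w: "w \<in> inf_link_states"
  shows "carrier (L \<delta> w) = rad_coset \<delta> w ` eq_span w" "zero (L \<delta> w) = rad \<delta> w"
proof -
  have "carrier (L \<delta> w) = (\<Union>x\<in>carrier (X \<delta> w). {rad \<delta> w +>\<^bsub>X \<delta> w\<^esub> x})"
    by (simp add: L_def quot_module_def A_RCOSETS_def RCOSETS_def a_r_coset_def)
  then show "carrier (L \<delta> w) = rad_coset \<delta> w ` eq_span w" by (auto simp: rcoset_X[OF w] X_simps[OF w])
  show "zero (L \<delta> w) = rad \<delta> w" by (simp add: L_def quot_module_def)
qed

lemma L_add:
  assumes w: "w \<in> inf_link_states"
  shows "rad_coset \<delta> w x \<oplus>\<^bsub>L \<delta> w\<^esub> rad_coset \<delta> w y = rad_coset \<delta> w (x + y)"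
proof -
  note subrep = subrepD[OF subrep_rad[OF w, of \<delta>]]
  have "rad_coset \<delta> w x \<oplus>\<^bsub>L \<delta> w\<^esub> rad_coset \<delta> w y = (\<Union>a\<in>rad_coset \<delta> w x. \<Union>b\<in>rad_coset \<delta> w y. {a + b})"
    by (simp add: L_def quot_module_def set_add_def set_mult_def X_simps[OF w])
  also have "\<dots> = rad_coset \<delta> w (x + y)"
  proof (intro equalityI subsetI)
    fix z assume "z \<in> (\<Union>a\<in>rad_coset \<delta> w x. \<Union>b\<in>rad_coset \<delta> w y. {a + b})"
    then obtain r s where "r \<in> rad \<delta> w" "s \<in> rad \<delta> w" "z = (r + x) + (s + y)" unfolding rad_coset_def by blast
    then have "z = (r + s) + (x + y)" "r + s \<in> rad \<delta> w" using subrep(3) by (simp_all add: algebra_simps)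
    then show "z \<in> rad_coset \<delta> w (x + y)" unfolding rad_coset_def by blast
  next
    fix z assume "z \<in> rad_coset \<delta> w (x + y)"
    then obtain r where r: "r \<in> rad \<delta> w" "z = r + (x + y)" unfolding rad_coset_def by blast
    then have "z = (r + x) + (0 + y)" by (simp add: algebra_simps)
    moreover have "r + x \<in> rad_coset \<delta> w x" "0 + y \<in> rad_coset \<delta> w y" using r(1) subrep(2) unfolding rad_coset_def by blast+
    ultimately show "z \<in> (\<Union>a\<in>rad_coset \<delta> w x. \<Union>b\<in>rad_coset \<delta> w y. {a + b})" by blast
  qed
  finally show ?thesis .
qed

lemma L_smult:
  assumes w: "w \<in> inf_link_states" and x: "x \<in> eq_span w"
  shows "coset \<delta> a \<odot>\<^bsub>L \<delta> w\<^esub> rad_coset \<delta> w x = rad_coset \<delta> w (free_act \<delta> a x)"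
proof -
  note subrep = subrepD[OF subrep_rad[OF w, of \<delta>]] and ssub = subrepD[OF subrep_span[OF w, of \<delta>]]
  have "rad \<delta> w +>\<^bsub>X \<delta> w\<^esub> (coset \<delta> a \<odot>\<^bsub>X \<delta> w\<^esub> y) = rad_coset \<delta> w (free_act \<delta> a x)" if y: "y \<in> rad_coset \<delta> w x" for y
  proof -
    obtain r where r: "r \<in> rad \<delta> w" "y = r + x" using y unfolding rad_coset_def by blast
    then have "y \<in> eq_span w" using ssub(3) rad_span[OF w] x by blast
    then have "coset \<delta> a \<odot>\<^bsub>X \<delta> w\<^esub> y = free_act \<delta> a r + free_act \<delta> a x" using r by (simp add: X_simps[OF w] free_act_add)
    moreover have "rad_coset \<delta> w (free_act \<delta> a r + free_act \<delta> a x) = rad_coset \<delta> w (free_act \<delta> a x)"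
      unfolding rad_coset_eq_iff[OF w] using subrep(4)[OF r(1)] by simp
    ultimately show ?thesis by (simp add: rcoset_X[OF w])
  qed
  moreover have "x \<in> rad_coset \<delta> w x" unfolding rad_coset_def by (rule image_eqI[of _ _ 0]) (simp_all add: subrep(2))
  moreover have "coset \<delta> a \<odot>\<^bsub>L \<delta> w\<^esub> rad_coset \<delta> w x = (\<Union>y\<in>rad_coset \<delta> w x. rad \<delta> w +>\<^bsub>X \<delta> w\<^esub> (coset \<delta> a \<odot>\<^bsub>X \<delta> w\<^esub> y))"
    by (simp add: L_def quot_module_def)
  ultimately show ?thesis by blast
qed

lemma L_nontrivial:
  assumes w: "w \<in> inf_link_states" and n: "carrier (L \<delta> w) \<noteq> {\<zero>\<^bsub>L \<delta> w\<^esub>}"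
  shows "sg w \<notin> rad \<delta> w"
proof
  assume "sg w \<in> rad \<delta> w"
  then have s: "eq_span w \<subseteq> rad \<delta> w" using subrep_contains_span[OF w subrep_rad[OF w] sim_refl[OF w]] by blast
  have "rad_coset \<delta> w x = rad \<delta> w" if "x \<in> eq_span w" for x
    using rad_coset_eq_iff[OF w, of \<delta> x 0] s that rad_coset_zero by auto
  then have "carrier (L \<delta> w) = {\<zero>\<^bsub>L \<delta> w\<^esub>}" unfolding L_carrier[OF w] using span_basic(1)[of w] by (auto intro!: image_eqI)
  then show False using n by blast
qed

lemma L_iso_sym:
  assumes w: "w \<in> inf_link_states" "w' \<in> inf_link_states" and iso: "module_iso (TL \<delta>) (L \<delta> w) (L \<delta> w')"
  shows "module_iso (TL \<delta>) (L \<delta> w') (L \<delta> w)"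
proof (rule module_iso_sym[OF iso])
  note ssub = subrepD[OF subrep_span[OF w(1), of \<delta>]]
  show "x \<oplus>\<^bsub>L \<delta> w\<^esub> y \<in> carrier (L \<delta> w)" if "x \<in> carrier (L \<delta> w)" "y \<in> carrier (L \<delta> w)" for x y
    using that ssub(3) by (auto simp: L_carrier[OF w(1)] L_add[OF w(1)])
  show "a \<odot>\<^bsub>L \<delta> w\<^esub> x \<in> carrier (L \<delta> w)" if "a \<in> carrier (TL \<delta>)" "x \<in> carrier (L \<delta> w)" for a x
    using that ssub(4) by (auto simp: L_carrier[OF w(1)] L_smult[OF w(1)] carrier_TL)
qed

lemma L_iso_witness:
  assumes w: "w \<in> inf_link_states" "w' \<in> inf_link_states" and iso: "module_iso (TL \<delta>) (L \<delta> w) (L \<delta> w')"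
  shows "\<exists>x'\<in>eq_span w'. \<forall>a. free_act \<delta> a (sg w) \<in> rad \<delta> w \<longleftrightarrow> free_act \<delta> a x' \<in> rad \<delta> w'"
proof -
  note ssub = subrepD[OF subrep_span[OF w(1), of \<delta>]]
  obtain h where h: "bij_betw h (rad_coset \<delta> w ` eq_span w) (rad_coset \<delta> w' ` eq_span w')"
    "\<And>a C. C \<in> rad_coset \<delta> w ` eq_span w \<Longrightarrow> h (coset \<delta> a \<odot>\<^bsub>L \<delta> w\<^esub> C) = coset \<delta> a \<odot>\<^bsub>L \<delta> w'\<^esub> h C"
    using iso by (auto simp: module_iso_def iso_def L_carrier[OF w(1)] L_carrier[OF w(2)] carrier_TL)
  have s: "sg w \<in> eq_span w" using sim_refl w by (simp add: span_single)
  have "h (rad_coset \<delta> w (sg w)) \<in> rad_coset \<delta> w' ` eq_span w'" by (rule bij_betw_apply[OF h(1) imageI[OF s]])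
  then obtain x' where x: "x' \<in> eq_span w'" "h (rad_coset \<delta> w (sg w)) = rad_coset \<delta> w' x'" by blast
  have ha: "h (rad_coset \<delta> w (free_act \<delta> a (sg w))) = rad_coset \<delta> w' (free_act \<delta> a x')" for a
    using h(2)[of "rad_coset \<delta> w (sg w)" a] s x L_smult[OF w(1) s] L_smult[OF w(2) x(1)] by simp
  have inj: "inj_on h (rad_coset \<delta> w ` eq_span w)" using h(1) by (simp add: bij_betw_def)
  have "free_act \<delta> a (sg w) \<in> rad \<delta> w \<longleftrightarrow> free_act \<delta> a x' \<in> rad \<delta> w'" for a
  proof -
    have "free_act \<delta> a (sg w) \<in> rad \<delta> w \<longleftrightarrow> rad_coset \<delta> w (free_act \<delta> a (sg w)) = rad_coset \<delta> w (free_act \<delta> 0 (sg w))"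
      by (simp add: rad_coset_eq_iff[OF w(1)])
    also have "\<dots> \<longleftrightarrow> h (rad_coset \<delta> w (free_act \<delta> a (sg w))) = h (rad_coset \<delta> w (free_act \<delta> 0 (sg w)))"
      by (rule inj_on_eq_iff[OF inj, symmetric]) (use ssub(4)[OF s] in blast)+
    also have "\<dots> \<longleftrightarrow> free_act \<delta> a x' \<in> rad \<delta> w'" unfolding ha by (simp add: rad_coset_eq_iff[OF w(2)])
    finally show ?thesis .
  qed
  then show ?thesis using x(1) by blast
qed

text \<open>
  What is used of an isomorphism that maps the class of \<open>w\<close> to the class of \<open>x'\<close>.
\<close>

definition word_witness :: "complex \<Rightarrow> inf_link \<Rightarrow> inf_link \<Rightarrow> inf_vec \<Rightarrow> bool" where
  "word_witness \<delta> w w' x' \<longleftrightarrow> x' \<in> eq_span w' \<and> (\<forall>g. act \<delta> g (sg w) \<in> rad \<delta> w \<longleftrightarrow> act \<delta> g x' \<in> rad \<delta> w') \<and>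
     (\<forall>g h. act \<delta> g (sg w) = act \<delta> h (sg w) \<longrightarrow> act \<delta> g x' - act \<delta> h x' \<in> rad \<delta> w')"

lemma L_iso_word_witness:
  assumes w: "w \<in> inf_link_states" "w' \<in> inf_link_states" and iso: "module_iso (TL \<delta>) (L \<delta> w) (L \<delta> w')"
  obtains x' where "word_witness \<delta> w w' x'"
proof -
  obtain x' where x: "x' \<in> eq_span w'" "\<forall>a. free_act \<delta> a (sg w) \<in> rad \<delta> w \<longleftrightarrow> free_act \<delta> a x' \<in> rad \<delta> w'"
    using L_iso_witness[OF w iso] by blast
  have "act \<delta> g (sg w) \<in> rad \<delta> w \<longleftrightarrow> act \<delta> g x' \<in> rad \<delta> w'" for g
    using x(2)[rule_format, of "Poly_Mapping.single (Word g) 1"] by (simp add: free_act_word)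
  moreover have "act \<delta> g x' - act \<delta> h x' \<in> rad \<delta> w'" if "act \<delta> g (sg w) = act \<delta> h (sg w)" for g h
    using x(2)[rule_format, of "Poly_Mapping.single (Word g) 1 - Poly_Mapping.single (Word h) 1"] that subrepD(2)[OF subrep_rad[OF w(1)]]
    unfolding free_act_word_diff by simp
  ultimately have "word_witness \<delta> w w' x'" using x(1) unfolding word_witness_def by blast
  then show ?thesis by (rule that)
qed

text \<open>
  Otherwise the word that extracts a state from \<open>x'\<close> kills \<open>w\<close>.
\<close>

lemma witness_strings:
  assumes w: "w \<in> inf_link_states" "w' \<in> inf_link_states" and x: "word_witness \<delta> w w' x'" and nt: "sg w \<notin> rad \<delta> w"
    and nt': "sg w' \<notin> rad \<delta> w'"
    and t: "\<forall>i\<ge>n. w i = w' i" "closed_ivl 0 n w" "closed_ivl 0 n w'"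
  shows "strs 0 n w \<le> strs 0 n w'"
proof (rule ccontr)
  assume lt: "\<not> strs 0 n w \<le> strs 0 n w'"
  have xs: "x' \<in> eq_span w'" using x by (simp add: word_witness_def)
  have "act \<delta> [] (sg w) \<notin> rad \<delta> w" using nt by simp
  then have "x' \<notin> rad \<delta> w'" using x unfolding word_witness_def by (metis act_Nil)
  from extraction[OF w(2) xs this, of n] obtain m g p c \<kappa> where m: "n \<le> m" "closed_ivl 0 m w'" "\<kappa> \<noteq> 0" "fits w' m c"
    "act \<delta> g x' = scl \<kappa> (sg c)"
    "\<And>u. u \<in> inf_link_states \<Longrightarrow> closed_ivl 0 m u \<Longrightarrow> strs 0 m w' < strs 0 m u \<Longrightarrow> act \<delta> g (sg u) = 0"
    by metis
  have cl: "closed_ivl 0 m w" using closed_ivl_tail[OF w t(2,1) m(1,2)] .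
  have "strs n m w = strs n m w'" by (rule strs_cong) (use t in simp)
  then have "strs 0 m w' < strs 0 m w" using strs_split[of 0 n m w] strs_split[of 0 n m w'] m(1) lt by simp
  then have "act \<delta> g (sg w) = 0" using m(6)[OF w(1) cl] by simp
  then have "act \<delta> g (sg w) \<in> rad \<delta> w" using subrepD(2)[OF subrep_rad[OF w(1)]] by simp
  then have "scl \<kappa> (sg c) \<in> rad \<delta> w'" using x m(5) unfolding word_witness_def by metis
  moreover have "sim w' c" using fits_sim[OF w(2) m(2,4)] .
  ultimately show False using radical_quotient.scl_in_rad[of \<delta> w' c \<kappa>] m(3) w(2) nt' by (simp add: radical_quotient_def)
qed

text \<open>
  A word maps \<open>x'\<close> to a multiple of a given state \<open>z\<close> with the tail of \<open>w'\<close>. Let \<open>a\<close> be the projector onto a cup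
  of \<open>w\<close> beyond \<open>n\<close> that \<open>w'\<close> lacks. It fixes \<open>w\<close> and commutes with that word, so \<open>a z\<close> and \<open>z\<close> have the same
  class. But the state in \<open>a z\<close> has the cup, while \<open>z\<close> lacks it.
\<close>

lemma twist:
  assumes w: "w \<in> inf_link_states" "w' \<in> inf_link_states" and x: "word_witness \<delta> w w' x'" and nt: "sg w \<notin> rad \<delta> w"
    and nt': "sg w' \<notin> rad \<delta> w'" and inf: "\<forall>N. \<exists>i\<ge>N. i < w i \<and> w' i \<noteq> w i"
  obtains n where "K \<le> n" "closed_ivl 0 n w'"
    "\<And>z. fits w' n z \<Longrightarrow> \<exists>v. radical_quotient.cong \<delta> w' z v \<and> v \<noteq> z \<and> (\<forall>k<n. v k = z k)"
proof -
  interpret Q: radical_quotient \<delta> w' by unfold_locales (use w nt' in auto)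
  have xs: "x' \<in> eq_span w'" using x by (simp add: word_witness_def)
  have "act \<delta> [] (sg w) \<notin> rad \<delta> w" using nt by simp
  then have "x' \<notin> rad \<delta> w'" using x unfolding word_witness_def by (metis act_Nil)
  from extraction[OF w(2) xs this, of K] obtain n g p c \<kappa> where n: "K \<le> n" "closed_ivl 0 n w'" "inside 0 n g" "\<kappa> \<noteq> 0"
    "fits w' n c" "act \<delta> g x' = scl \<kappa> (sg c)" by metis
  have "\<exists>v. Q.cong z v \<and> v \<noteq> z \<and> (\<forall>k<n. v k = z k)" if z: "fits w' n z" for z
  proof -
    have "reach 0 n c z" by (rule reach_within) (use n z in auto)
    then obtain r where r: "inside 0 n r" "wact r c = Some (0, z)" using reach_word by blast
    have "act \<delta> r (sg c) = sg z" using act_wact[of c \<delta> r] n(5) r(2) by simp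
    then have gz: "act \<delta> (r @ g) x' = scl \<kappa> (sg z)" using n(6) by (simp only: act_append act_scl)
    obtain i where i: "n \<le> i" "i < w i" "w' i \<noteq> w i" using inf by blast
    obtain a where a: "\<forall>l\<in>set a. i \<le> l" "wact a w = Some (0, w)"
      "\<forall>u k v. u \<in> inf_link_states \<longrightarrow> wact a u = Some (k, v) \<longrightarrow> v i = w i"
      using cup_projector[OF w(1) i(2)] by blast
    have aw: "act \<delta> a (sg w) = sg w" using act_wact[OF w(1)] a(2) by simp
    have far: "\<forall>l\<in>set a. \<forall>j\<in>set (r @ g). Suc l < j \<or> Suc j < l"
    proof (intro ballI)
      fix l j assume "l \<in> set a" "j \<in> set (r @ g)"
      then have "i \<le> l" "Suc j < n" using a(1) r(1) n(3) by (auto simp: inside_def)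
      then show "Suc l < j \<or> Suc j < l" using i(1) by simp
    qed
    have "sg w \<in> link_vecs" using w by (simp add: link_vecs_def)
    then have "act \<delta> (a @ (r @ g)) (sg w) = act \<delta> ((r @ g) @ a) (sg w)" by (rule act_commute[OF _ far])
    also have "\<dots> = act \<delta> (r @ g) (sg w)" using aw by (simp only: act_append)
    finally have "act \<delta> (a @ (r @ g)) x' - act \<delta> (r @ g) x' \<in> rad \<delta> w'" using x unfolding word_witness_def by blast
    then have d: "scl \<kappa> (act \<delta> a (sg z)) - scl \<kappa> (sg z) \<in> rad \<delta> w'"
      using gz by (simp only: act_append[of \<delta> a] act_scl)
    have sz: "sim w' z" using fits_sim[OF w(2) n(2) z] .
    have zl: "z \<in> inf_link_states" using z by simp
    show ?thesis
    proof (cases "wact a z")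
      case None
      then have "- scl \<kappa> (sg z) \<in> rad \<delta> w'" using d act_wact[OF zl, of \<delta> a] by simp
      then have "scl \<kappa> (sg z) \<in> rad \<delta> w'" using Q.subrep(7) by fastforce
      then show ?thesis using Q.scl_in_rad[OF sz] n(4) by blast
    next
      case (Some b)
      obtain k v where b: "wact a z = Some (k, v)" using Some by (cases b) auto
      then have az: "act \<delta> a (sg z) = scl (\<delta> ^ k) (sg v)" using act_wact[OF zl, of \<delta> a] by simp
      have "- (1 / \<kappa>) * \<kappa> = -1" using n(4) by simp
      then have "scl (- (1 / \<kappa>)) (scl \<kappa> (act \<delta> a (sg z)) - scl \<kappa> (sg z)) = sg z - scl (\<delta> ^ k) (sg v)"
        unfolding az by (intro poly_mapping_eqI) (simp add: lookup_minus field_simps n(4) del: scl_simps)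
      then have cr: "sg z - scl (\<delta> ^ k) (sg v) \<in> rad \<delta> w'" using Q.subrep(6)[OF d] by metis
      have "\<delta> ^ k \<noteq> 0"
      proof
        assume k0: "\<delta> ^ k = 0"
        have "sg z \<in> rad \<delta> w'" using cr unfolding k0 by (simp only: scl_simps(2) diff_zero)
        then show False using Q.state_notin sz by blast
      qed
      moreover have "sim w' v" using sim_trans[OF w(2) sz] sim_wact[OF zl b] by blast
      ultimately have "Q.cong z v" unfolding Q.cong_def using sz cr by blast
      moreover have "v \<noteq> z"
      proof
        assume "v = z"
        then have "z i = w i" using a(3) zl b by blast
        then show False using z i by simp
      qed
      moreover have "v k = z k" if "k < n" for k
      proof (rule wact_keep_below[OF b _ _ _ zl])
        show "\<forall>l\<in>set a. n \<le> l" using a(1) i(1) by auto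
        show "k < n" "z k < n" using that z by (auto simp: closed_0)
      qed
      ultimately show ?thesis by blast
    qed
  qed
  then show ?thesis using that n by blast
qed

section \<open>At most one string\<close>

definition at_most_one_string :: "inf_link \<Rightarrow> bool" where
  "at_most_one_string w \<longleftrightarrow> (\<forall>s t. w s = s \<longrightarrow> w t = t \<longrightarrow> s = t)"

lemma strs_mono: "m \<le> n \<Longrightarrow> strs 0 m w \<le> strs 0 n w"
  using strs_split[of 0 m n w] by simp

lemma at_most_one_string_iff: "at_most_one_string w \<longleftrightarrow> (\<forall>n. strs 0 n w \<le> 1)"
proof -
  have "strs 0 n w \<le> 1 \<longleftrightarrow> (\<forall>s<n. \<forall>t<n. w s = s \<longrightarrow> w t = t \<longrightarrow> s = t)" for n
    using card_le_Suc0_iff_eq[of "{k. 0 \<le> k \<and> k < n \<and> w k = k}"] by (auto simp: strs_def)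
  then show ?thesis unfolding at_most_one_string_def by (metis lessI less_imp_le_nat max.strict_coboundedI1 max.strict_coboundedI2)
qed

lemma num_strings_at_most_one_string: "num_strings w \<in> {0, 1} \<longleftrightarrow> at_most_one_string w"
proof
  assume n: "num_strings w \<in> {0, 1}"
  then have "finite {i. w i = i}" "card {i. w i = i} \<le> Suc 0"
    by (auto simp: num_strings_def zero_enat_def one_enat_def split: if_splits)
  then show "at_most_one_string w" using card_le_Suc0_iff_eq[of "{i. w i = i}"] by (auto simp: at_most_one_string_def)
next
  assume f: "at_most_one_string w"
  have fin: "finite {i. w i = i}"
  proof (cases "\<exists>s. w s = s")
    case True
    then obtain s where "w s = s" by blast
    then have "{i. w i = i} \<subseteq> {s}" using f by (auto simp: at_most_one_string_def)
    then show ?thesis by (rule finite_subset) simp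
  qed simp
  then have "card {i. w i = i} \<le> Suc 0" using f card_le_Suc0_iff_eq[OF fin] by (auto simp: at_most_one_string_def)
  then show "num_strings w \<in> {0, 1}" using fin
    by (cases "card {i. w i = i}") (auto simp: num_strings_def zero_enat_def one_enat_def)
qed

text \<open>
  The initial part \<open>z\<close> can be chosen freely. If \<open>w'\<close> has two strings, \<open>z\<close> is canonical and ends with two
  strings. If it has one, \<open>z\<close> starts with it, so that all other points up to a far closed point form a
  block of cups.
\<close>

lemma infinite_difference:
  assumes w: "w \<in> inf_link_states" "w' \<in> inf_link_states" and x: "word_witness \<delta> w w' x'" and nt: "sg w \<notin> rad \<delta> w"
    and nt': "sg w' \<notin> rad \<delta> w'" and inf: "\<forall>N. \<exists>i\<ge>N. i < w i \<and> w' i \<noteq> w i"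
  shows "\<delta>\<^sup>2 = 1 \<and> at_most_one_string w'"
proof -
  interpret Q: radical_quotient \<delta> w' by unfold_locales (use w nt' in auto)
  have tw: "\<exists>n\<ge>K. closed_ivl 0 n w' \<and> (\<forall>z. fits w' n z \<longrightarrow> (\<exists>v. Q.cong z v \<and> v \<noteq> z \<and> (\<forall>k<n. v k = z k)))" for K
    by (rule twist[OF w x nt nt' inf, of K]) blast
  have differ: "\<exists>d\<ge>n. v d \<noteq> z d" if "v \<noteq> z" "\<forall>k<n. v k = z k" for v z :: inf_link and n
    using that by (metis ext not_le)
  have fw: "at_most_one_string w'"
  proof (rule ccontr)
    assume "\<not> at_most_one_string w'"
    then obtain K where K: "2 \<le> strs 0 K w'" unfolding at_most_one_string_iff by (metis not_less_eq_eq one_add_one plus_1_eq_Suc)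
    obtain n where n: "K \<le> n" "closed_ivl 0 n w'" "\<forall>z. fits w' n z \<longrightarrow> (\<exists>v. Q.cong z v \<and> v \<noteq> z \<and> (\<forall>k<n. v k = z k))"
      using tw by blast
    obtain c p where c: "reach 0 n w' c" "canon 0 n p c" using reach_canon[OF w(2) n(2)] by auto
    have fc: "fits w' n c" using reach_props[OF c(1) w(2) n(2)] by auto
    then obtain v where v: "Q.cong c v" "v \<noteq> c" "\<forall>k<n. v k = c k" using n(3) by blast
    obtain d where d: "n \<le> d" "v d \<noteq> c d" using differ[OF v(2,3)] by blast
    have "n - 2 * p = strs 0 n w'" using canon_strs[OF c(2)] fc by simp
    then have np: "2 * p + 2 \<le> n" using K strs_mono[OF n(1), of w'] by simp
    then have s: "c (n - 2) = n - 2" "c (n - 1) = n - 1" using c(2) by (auto simp: canon_def)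
    show False
      by (rule Q.two_strings_clash[OF v(1), of "n - 2" "n - 1" d]) (use s v(3) np d in auto)
  qed
  have "\<delta>\<^sup>2 = 1"
  proof (cases "\<exists>K. strs 0 K w' \<noteq> 0")
    case False
    obtain n where n: "closed_ivl 0 n w'" "\<forall>z. fits w' n z \<longrightarrow> (\<exists>v. Q.cong z v \<and> v \<noteq> z \<and> (\<forall>k<n. v k = z k))"
      using tw by blast
    then obtain v where v: "Q.cong w' v" "v \<noteq> w'" "\<forall>k<n. v k = w' k" using w by blast
    obtain d where d: "n \<le> d" "v d \<noteq> w' d" using differ[OF v(2,3)] by blast
    have "sim w' w'" "sim w' v" using v(1) by (simp_all add: Q.cong_def)
    then obtain m where m': "Suc d \<le> m" "closed_ivl 0 m w'" "fits w' m w'" "fits w' m v" by (rule Q.sim_common)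
    note m = m'(1,3,4)
    have "strs 0 m w' = 0" using False by blast
    then have "cup_block 0 m y" if "fits w' m y" for y
      using that strs_eq_0_iff[of 0 m y] unfolding cup_block_def by presburger
    then have "cup_block 0 m w'" "cup_block 0 m v" using m by blast+
    then show ?thesis using Q.cong_block_delta[OF v(1), of 0 m d] d m by auto
  next
    case True
    then obtain K where K: "strs 0 K w' \<noteq> 0" by blast
    obtain n where n: "K \<le> n" "closed_ivl 0 n w'" "\<forall>z. fits w' n z \<longrightarrow> (\<exists>v. Q.cong z v \<and> v \<noteq> z \<and> (\<forall>k<n. v k = z k))"
      using tw by blast
    have one: "strs 0 m w' = 1" if "n \<le> m" for m
    proof -
      have "strs 0 K w' \<le> strs 0 m w'" using strs_mono[of K m w'] n(1) that by simp
      moreover have "strs 0 m w' \<le> 1" using fw at_most_one_string_iff by blast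
      ultimately show ?thesis using K by simp
    qed
    obtain c p where c: "reach 0 n w' c" "canon 0 n p c" using reach_canon[OF w(2) n(2)] by auto
    have fc: "fits w' n c" using reach_props[OF c(1) w(2) n(2)] by auto
    have np: "n = 2 * p + 1" using canon_strs[OF c(2)] fc one[of n] by simp
    have fl: "flat 0 p c" "c (2 * p) = 2 * p" using c(2) np by (auto simp: canon_def)
    then obtain z where z: "reach 0 (0 + 2 * p + 1) c z" "z 0 = 0"
      using reach_shift[of c 0 p] fc by auto
    have zn: "reach 0 n c z" using z(1) np by simp
    have fz: "fits w' n z" using reach_props[OF zn] fc by auto
    then obtain v where v: "Q.cong z v" "v \<noteq> z" "\<forall>k<n. v k = z k" using n(3) by blast
    have v0: "v 0 = 0" using v(3) z(2) np by simp
    obtain d where d: "n \<le> d" "v d \<noteq> z d" using differ[OF v(2,3)] by blast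
    have "sim w' z" "sim w' v" using v(1) by (simp_all add: Q.cong_def)
    then obtain m where m': "Suc d \<le> m" "closed_ivl 0 m w'" "fits w' m z" "fits w' m v" by (rule Q.sim_common)
    note m = m'(1,3,4)
    have "cup_block (Suc 0) m y" if y: "fits w' m y" "y 0 = 0" for y
    proof -
      have "strs 0 (Suc 0) y = 1" using strs_all_iff[of 0 "Suc 0" y] y(2) by simp
      moreover have "strs 0 m y = 1" using one[of m] y(1) d m by simp
      ultimately have "strs (Suc 0) m y = 0" using strs_split[of 0 "Suc 0" m y] d m by simp
      then show ?thesis using closed_after[of y 0 m] y by (simp add: cup_block_def strs_eq_0_iff)
    qed
    then have "cup_block (Suc 0) m z" "cup_block (Suc 0) m v" using m v0 z by blast+
    then show ?thesis using Q.cong_block_delta[OF v(1), of "Suc 0" m d] d m np by auto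
  qed
  then show ?thesis using fw by blast
qed

section \<open>The one-dimensional case\<close>

text \<open>
  The points below a cup are paired among themselves.
\<close>

lemma partner_parity:
  assumes "u \<in> inf_link_states" "u k \<noteq> k"
  shows "odd (u k) \<longleftrightarrow> even k"
proof -
  have *: "odd (u a) \<longleftrightarrow> even a" if a: "a < u a" for a
  proof -
    have cl: "closed_ivl a (Suc (u a)) u"
      unfolding closed_ivl_def
    proof (intro allI impI)
      fix j assume j: "a \<le> j \<and> j < Suc (u a)"
      show "a \<le> u j \<and> u j < Suc (u a)"
        using j a link_nest[OF assms(1), of a j] link_inv[OF assms(1), of a]
        by (cases "j = a"; cases "j = u a") auto
    qed
    have "a < Suc (u a)" using a by simp
    note c = closed_cup[OF assms(1) cl a this]
    have "Suc a \<le> u a" using a by simp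
    then obtain m where "u a = Suc a + 2 * m" by (rule closed_no_strings_even[OF assms(1) c(1) _ c(3)])
    then show ?thesis by simp
  qed
  consider "k < u k" | "u k < k" using assms(2) by linarith
  then show ?thesis
  proof cases
    case 2
    then show ?thesis using *[of "u k"] link_inv[OF assms(1), of k] by auto
  qed (rule *)
qed

text \<open>
  Call \<open>k\<close> an opener if it is the left end of a cup. A generator that closes no loop replaces one opener by
  another one of opposite parity, as a case distinction on the positions of the partners shows.
\<close>

lemma opener_change:
  assumes u: "u \<in> inf_link_states" and d: "\<not> both_strings i u" and l: "u i \<noteq> Suc i"
  shows "\<exists>p q. odd p \<noteq> odd q \<and> (\<forall>k. (k < E i u k) \<noteq> (k < u k) \<longleftrightarrow> k = p \<or> k = q)"
proof -
  note inv = link_inv[OF u]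
  define a b where "a = u i" and "b = u (Suc i)"
  have ab: "u a = i" "u b = Suc i" "a \<noteq> b" using inv link_eq_iff[OF u, of i "Suc i"] by (auto simp: a_def b_def)
  have bi: "b \<noteq> i" using l inv[of "Suc i"] by (auto simp: b_def)
  have ai: "a \<noteq> Suc i" using l by (simp add: a_def)
  have other: "E i u k = u k" if "k \<noteq> i" "k \<noteq> Suc i" "k \<noteq> a" "k \<noteq> b" for k
  proof -
    have "u k \<noteq> i" "u k \<noteq> Suc i" using that inv[of k] by (auto simp: a_def b_def)
    then show ?thesis using that by (simp add: E_def)
  qed
  have Ea: "E i u a = (if b = Suc i then a else b)" if "a \<noteq> i" using that ab ai by (simp add: E_def b_def)
  have Eb: "E i u b = (if a = i then b else a)" if "b \<noteq> Suc i" using that ab bi by (simp add: E_def a_def)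
  have pa: "a \<noteq> i \<Longrightarrow> odd a \<noteq> odd i" using partner_parity[OF u, of i] by (auto simp: a_def)
  have pb: "b \<noteq> Suc i \<Longrightarrow> odd b \<noteq> odd (Suc i)" using partner_parity[OF u, of "Suc i"] by (auto simp: b_def)
  have key: ?thesis if pq: "odd p \<noteq> odd q"
    and ch: "\<And>k. k \<in> {i, Suc i, a, b} \<Longrightarrow> (k < E i u k) \<noteq> (k < u k) \<longleftrightarrow> k = p \<or> k = q"
    and "p \<in> {i, Suc i, a, b}" "q \<in> {i, Suc i, a, b}" for p q
  proof -
    have "(k < E i u k) \<noteq> (k < u k) \<longleftrightarrow> k = p \<or> k = q" for k
    proof (cases "k \<in> {i, Suc i, a, b}")
      case False then show ?thesis using other[of k] that(3,4) by auto
    qed (rule ch)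
    then show ?thesis using pq by blast
  qed
  have ui: "u i = a" "u (Suc i) = b" by (simp_all add: a_def b_def)
  consider "a = i" | "b = Suc i" "a \<noteq> i" | "a \<noteq> i" "b \<noteq> Suc i" "a < i" "Suc i < b"
    | "a \<noteq> i" "b \<noteq> Suc i" "a < i" "b < i" | "a \<noteq> i" "b \<noteq> Suc i" "Suc i < a"
    using bi ai by linarith
  then show ?thesis
  proof cases
    case 1
    then have bS: "b \<noteq> Suc i" using d by (auto simp: both_strings_def a_def b_def)
    (* a cup from b to i + 1 would cover the string at i *)
    have "\<not> b < i" using link_nest(3)[OF u, of b i] ab 1 by (auto simp: a_def)
    then have "Suc i < b" using bS bi by simp
    then show ?thesis by (intro key[of i "Suc i"]) (use 1 Eb ui ab in auto)
  next
    case 2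
    have "\<not> Suc i < a" using link_nest(3)[OF u, of i "Suc i"] 2 by (auto simp: a_def b_def)
    then have "a < i" using 2 ai by simp
    then show ?thesis by (intro key[of a i]) (use 2 Ea ui ab pa in auto)
  next
    case 3
    then show ?thesis by (intro key[of i "Suc i"]) (use Ea Eb ui ab in auto)
  next
    case 4
    have "\<not> a < b" using link_nest(2)[OF u, of a b] 4 ab by auto
    then have "b < a" using ab by simp
    then show ?thesis by (intro key[of a i]) (use 4 Ea Eb ui ab pa in auto)
  next
    case 5
    then have "i < b" "b < a" using link_nest(1,2)[OF u, of i "Suc i"] by (auto simp: a_def b_def)
    then have "Suc i < b" using 5 by simp
    then show ?thesis by (intro key[of "Suc i" b]) (use 5 \<open>b < a\<close> Ea Eb ui ab pb in auto)
  qed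
qed

locale one_dimensional = radical_quotient +
  assumes at_most_one_string: "at_most_one_string w" and sq: "\<delta>\<^sup>2 = 1"
begin

text \<open>
  Only the comparison with \<open>w\<close> is finite, since \<open>w\<close> itself may have infinitely many odd openers.
\<close>

definition odd_diff :: "inf_link \<Rightarrow> nat set" where
  "odd_diff u = {k. odd k \<and> (k < u k) \<noteq> (k < w k)}"

text \<open>
  As \<open>\<delta>\<^sup>2 = 1\<close>, this is trivial for \<open>\<delta> = 1\<close>, and for \<open>\<delta> = -1\<close> it is the parity of the number of odd openers
  relative to \<open>w\<close>.
\<close>

definition link_sign :: "inf_link \<Rightarrow> complex" where
  "link_sign u = \<delta> ^ card (odd_diff u)"

definition aug :: "inf_vec \<Rightarrow> complex" where
  "aug = lin_val link_sign"

lemma delta_square: "\<delta> * \<delta> = 1" "\<delta> \<noteq> 0" using sq by (auto simp: power2_eq_square)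

lemma link_sign_nz: "link_sign u \<noteq> 0" using delta_square by (simp add: link_sign_def)

lemma finite_odd_diff: "sim w u \<Longrightarrow> finite (odd_diff u)"
proof -
  assume "sim w u"
  then obtain n where "\<forall>k\<ge>n. u k = w k" by (auto simp: sim_def)
  then show ?thesis by (intro finite_subset[of "odd_diff u" "{..<n}"]) (auto simp: odd_diff_def not_le[symmetric])
qed

text \<open>
  Equivalent states have the same number of strings, here at most one.
\<close>

lemma not_both_strings: "sim w u \<Longrightarrow> \<not> both_strings i u"
proof
  assume s: "sim w u" "both_strings i u"
  from s(1) s(1) obtain n where n: "i + 2 \<le> n" "closed_ivl 0 n w" "fits w n u" "fits w n u" by (rule sim_common)
  have "\<forall>k. i \<le> k \<and> k < i + 2 \<longrightarrow> u k = k"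
  proof (intro allI impI)
    fix k assume "i \<le> k \<and> k < i + 2"
    then have "k = i \<or> k = Suc i" by linarith
    then show "u k = k" using s(2) by (auto simp: both_strings_def)
  qed
  then have "strs i (i + 2) u = (i + 2) - i" by (subst strs_all_iff) simp_all
  then have "2 \<le> strs 0 n u" using strs_split[of 0 i n u] strs_split[of i "i + 2" n u] n(1) by simp
  moreover have "strs 0 n w \<le> 1" using at_most_one_string at_most_one_string_iff by blast
  ultimately show False using n(3) by simp
qed

text \<open>
  A loop contributes the factor \<open>\<delta>\<close> directly; otherwise exactly one odd point becomes or stops being an
  opener, which changes the exponent of \<open>\<delta>\<close> by one.
\<close>

lemma link_sign_E:
  assumes s: "sim w u"
  shows "weight \<delta> i u * link_sign (E i u) = \<delta> * link_sign u"
proof (cases "u i = Suc i")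
  case True
  then show ?thesis using E_loop[OF sim_link[OF s]] by (simp add: weight_def both_strings_def)
next
  case False
  note nd = not_both_strings[OF s, of i]
  obtain p q where pq: "odd p \<noteq> odd q" "\<forall>k. (k < E i u k) \<noteq> (k < u k) \<longleftrightarrow> k = p \<or> k = q"
    using opener_change[OF sim_link[OF s] nd False] by blast
  define k0 where "k0 = (if odd p then p else q)"
  have k0: "odd k0" "\<And>k. odd k \<Longrightarrow> (k < E i u k) \<noteq> (k < u k) \<longleftrightarrow> k = k0"
    using pq by (auto simp: k0_def)
  have mem: "k \<in> odd_diff (E i u) \<longleftrightarrow> (if k = k0 then k \<notin> odd_diff u else k \<in> odd_diff u)" for k
    using k0(1) k0(2)[of k] unfolding odd_diff_def mem_Collect_eq by (cases "odd k") (metis (full_types))+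
  have "link_sign (E i u) = \<delta> * link_sign u"
  proof (cases "k0 \<in> odd_diff u")
    case True
    have eq: "odd_diff u = insert k0 (odd_diff (E i u))"
    proof (rule Set.set_eqI)
      fix k show "k \<in> odd_diff u \<longleftrightarrow> k \<in> insert k0 (odd_diff (E i u))"
        using mem[of k] True by (cases "k = k0") simp_all
    qed
    have "k0 \<notin> odd_diff (E i u)" using mem[of k0] True by simp
    moreover have "finite (odd_diff (E i u))" using finite_odd_diff[OF s] unfolding eq by simp
    ultimately have "card (odd_diff u) = Suc (card (odd_diff (E i u)))" unfolding eq by simp
    then show ?thesis using delta_square by (simp add: link_sign_def mult.assoc[symmetric])
  next
    case False
    have "odd_diff (E i u) = insert k0 (odd_diff u)"
    proof (rule Set.set_eqI)
      fix k show "k \<in> odd_diff (E i u) \<longleftrightarrow> k \<in> insert k0 (odd_diff u)"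
        using mem[of k] False by (cases "k = k0") simp_all
    qed
    then have "card (odd_diff (E i u)) = Suc (card (odd_diff u))" using False finite_odd_diff[OF s] by simp
    then show ?thesis by (simp add: link_sign_def)
  qed
  moreover have "weight \<delta> i u = 1" using nd False by (simp add: weight_def)
  ultimately show ?thesis by simp
qed

lemma aug_act: "x \<in> eq_span w \<Longrightarrow> aug (act \<delta> g x) = \<delta> ^ length g * aug x"
proof (induction g)
  case (Cons i g)
  let ?y = "act \<delta> g x"
  have y: "?y \<in> eq_span w" using act_span[OF w Cons.prems] .
  have "aug (act \<delta> (i # g) x) = lin_val (\<lambda>u. lin_val link_sign (e_link \<delta> i u)) ?y"
    by (simp add: aug_def act_Cons lin_val_lin_ext)
  also have "\<dots> = lin_val (\<lambda>u. \<delta> * link_sign u) ?y"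
  proof (rule lin_val_cong)
    fix u assume "u \<in> Poly_Mapping.keys ?y"
    then have s: "sim w u" using y by (auto simp: eq_span_def)
    show "lin_val link_sign (e_link \<delta> i u) = \<delta> * link_sign u" using link_sign_E[OF s, of i] by (simp add: e_link_weight[OF sim_link[OF s]])
  qed
  also have "\<dots> = \<delta> * aug ?y" by (simp add: lin_val_mult_left aug_def)
  finally show ?case using Cons by simp
qed simp

lemma aug_linear: "aug (x + y) = aug x + aug y" "aug (x - y) = aug x - aug y" "aug (scl c x) = c * aug x"
  "aug (sg u) = link_sign u"
  by (simp_all add: aug_def lin_val_add lin_val_diff lin_val_scl)

lemma aug_free: "x \<in> eq_span w \<Longrightarrow> aug (free_act \<delta> a x) = lin_val (\<lambda>u. \<delta> ^ length (letters u)) a * aug x"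
proof -
  assume x: "x \<in> eq_span w"
  have "aug (free_act \<delta> a x) = (\<Sum>u\<in>Poly_Mapping.keys a. Poly_Mapping.lookup a u * (\<delta> ^ length (letters u) * aug x))"
    unfolding free_act_def word_act_act using aug_act[OF x] by (simp add: aug_def lin_val_sum lin_val_scl)
  then show ?thesis by (simp add: lin_val_def sum_distrib_right mult.assoc)
qed

text \<open>
  A vector outside the radical is mapped by a word to a multiple of a state, on which the functional
  does not vanish; so the kernel lies in the radical. The kernel has codimension one and the radical
  is proper, so both are equal.
\<close>

lemma rad_iff_aug: "x \<in> eq_span w \<Longrightarrow> x \<in> rad \<delta> w \<longleftrightarrow> aug x = 0"
proof -
  have ker: "x \<in> rad \<delta> w" if x: "x \<in> eq_span w" "aug x = 0" for x
  proof (rule ccontr)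
    assume "x \<notin> rad \<delta> w"
    from extraction[OF w x(1) this, of 0] obtain g c \<kappa> where g: "\<kappa> \<noteq> 0" "act \<delta> g x = scl \<kappa> (sg c)" by metis
    have "aug (act \<delta> g x) = 0" using aug_act[OF x(1), of g] x(2) by simp
    then show False unfolding g(2) aug_linear using link_sign_nz g(1) by simp
  qed
  assume x: "x \<in> eq_span w"
  have sw: "sg w \<in> eq_span w" using sim_refl[OF w] by (simp add: span_single)
  show ?thesis
  proof
    assume r: "x \<in> rad \<delta> w"
    show "aug x = 0"
    proof (rule ccontr)
      assume nz: "aug x \<noteq> 0"
      define c where "c = link_sign w / aug x"
      have "sg w - scl c x \<in> eq_span w" using subrepD(8)[OF subrep_span[OF w]] sw span_basic(3)[OF x] by blast
      moreover have "aug (sg w - scl c x) = 0" using nz unfolding aug_linear by (simp add: c_def)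
      ultimately have "(sg w - scl c x) + scl c x \<in> rad \<delta> w" using ker subrep(3) subrep(6)[OF r] by blast
      then show False using nontriv by simp
    qed
  qed (rule ker[OF x])
qed

lemma aug_state: "\<exists>e\<in>eq_span w. aug e = 1"
proof
  show "scl (1 / link_sign w) (sg w) \<in> eq_span w" using sim_refl[OF w] by (intro span_basic(3)) (simp add: span_single)
  show "aug (scl (1 / link_sign w) (sg w)) = 1" unfolding aug_linear using link_sign_nz by simp
qed

end

text \<open>
  Each class is determined by the value of the functional, and an algebra element acts on this value by
  a scalar that does not depend on the link state.
\<close>

lemma one_dimensional_iso:
  assumes "one_dimensional \<delta> w" "one_dimensional \<delta> w'"
  shows "module_iso (TL \<delta>) (L \<delta> w) (L \<delta> w')"
proof -
  interpret A: one_dimensional \<delta> w by fact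
  interpret B: one_dimensional \<delta> w' by fact
  obtain e where e: "e \<in> eq_span w" "A.aug e = 1" using A.aug_state by blast
  obtain e' where e': "e' \<in> eq_span w'" "B.aug e' = 1" using B.aug_state by blast
  note sA = subrepD[OF subrep_span[OF A.w, of \<delta>]] and sB = subrepD[OF subrep_span[OF B.w, of \<delta>]]
  have eqA: "rad_coset \<delta> w x = rad_coset \<delta> w y \<longleftrightarrow> A.aug x = A.aug y" if "x \<in> eq_span w" "y \<in> eq_span w" for x y
    using A.rad_iff_aug[OF sA(8)[OF that]] by (simp add: rad_coset_eq_iff[OF A.w] A.aug_linear)
  have eqB: "rad_coset \<delta> w' x = rad_coset \<delta> w' y \<longleftrightarrow> B.aug x = B.aug y" if "x \<in> eq_span w'" "y \<in> eq_span w'" for x y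
    using B.rad_iff_aug[OF sB(8)[OF that]] by (simp add: rad_coset_eq_iff[OF B.w] B.aug_linear)
  define h where "h C = rad_coset \<delta> w' (scl (A.aug (SOME x. x \<in> eq_span w \<and> C = rad_coset \<delta> w x)) e')" for C
  have h: "h (rad_coset \<delta> w x) = rad_coset \<delta> w' (scl (A.aug x) e')" if x: "x \<in> eq_span w" for x
  proof -
    define y where "y = (SOME y. y \<in> eq_span w \<and> rad_coset \<delta> w x = rad_coset \<delta> w y)"
    have "y \<in> eq_span w \<and> rad_coset \<delta> w x = rad_coset \<delta> w y" unfolding y_def by (rule someI[of _ x]) (use x in simp)
    then have "A.aug y = A.aug x" using eqA x by metis
    then show ?thesis by (simp add: h_def y_def)
  qed
  have se: "scl c e' \<in> eq_span w'" "B.aug (scl c e') = c" for c using sB(6)[OF e'(1)] e'(2) by (simp_all add: B.aug_linear)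
  have "h \<in> iso (add_monoid (L \<delta> w)) (add_monoid (L \<delta> w'))"
    unfolding iso_def hom_def
  proof (intro CollectI conjI ballI Pi_I)
    show "h C \<in> carrier (add_monoid (L \<delta> w'))" if "C \<in> carrier (add_monoid (L \<delta> w))" for C
      using that h se by (auto simp: L_carrier[OF A.w] L_carrier[OF B.w])
    show "h (C \<otimes>\<^bsub>add_monoid (L \<delta> w)\<^esub> D) = h C \<otimes>\<^bsub>add_monoid (L \<delta> w')\<^esub> h D"
      if CD: "C \<in> carrier (add_monoid (L \<delta> w))" "D \<in> carrier (add_monoid (L \<delta> w))" for C D
    proof -
      obtain x y where xy: "x \<in> eq_span w" "y \<in> eq_span w" "C = rad_coset \<delta> w x" "D = rad_coset \<delta> w y"
        using CD by (auto simp: L_carrier[OF A.w])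
      then show ?thesis using h sA(3)[OF xy(1,2)]
        by (simp add: L_add[OF A.w] L_add[OF B.w] A.aug_linear scl_add)
    qed
    show "bij_betw h (carrier (add_monoid (L \<delta> w))) (carrier (add_monoid (L \<delta> w')))"
      unfolding bij_betw_def
    proof
      show "inj_on h (carrier (add_monoid (L \<delta> w)))"
      proof (rule inj_onI)
        fix C D assume CD: "C \<in> carrier (add_monoid (L \<delta> w))" "D \<in> carrier (add_monoid (L \<delta> w))" "h C = h D"
        obtain x y where xy: "x \<in> eq_span w" "y \<in> eq_span w" "C = rad_coset \<delta> w x" "D = rad_coset \<delta> w y"
          using CD(1,2) by (auto simp: L_carrier[OF A.w])
        then have "A.aug x = A.aug y" using CD(3) h eqB[OF se(1) se(1)] se(2) by metis
        then show "C = D" using eqA xy by simp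
      qed
      show "h ` carrier (add_monoid (L \<delta> w)) = carrier (add_monoid (L \<delta> w'))"
      proof (intro equalityI subsetI)
        fix D assume "D \<in> h ` carrier (add_monoid (L \<delta> w))"
        then show "D \<in> carrier (add_monoid (L \<delta> w'))" using h se by (auto simp: L_carrier[OF A.w] L_carrier[OF B.w])
      next
        fix D assume "D \<in> carrier (add_monoid (L \<delta> w'))"
        then obtain y where y: "y \<in> eq_span w'" "D = rad_coset \<delta> w' y" by (auto simp: L_carrier[OF B.w])
        have s: "scl (B.aug y) e \<in> eq_span w" using sA(6)[OF e(1)] .
        have "h (rad_coset \<delta> w (scl (B.aug y) e)) = D"
          unfolding h[OF s] y(2) using eqB[OF se(1) y(1)] se(2) e(2) by (simp add: A.aug_linear)
        moreover have "rad_coset \<delta> w (scl (B.aug y) e) \<in> carrier (add_monoid (L \<delta> w))" using s by (simp add: L_carrier[OF A.w])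
        ultimately show "D \<in> h ` carrier (add_monoid (L \<delta> w))" by blast
      qed
    qed
  qed
  moreover have "h (a \<odot>\<^bsub>L \<delta> w\<^esub> C) = a \<odot>\<^bsub>L \<delta> w'\<^esub> h C"
    if aC: "a \<in> carrier (TL \<delta>)" "C \<in> carrier (L \<delta> w)" for a C
  proof -
    obtain b x where b: "a = coset \<delta> b" "x \<in> eq_span w" "C = rad_coset \<delta> w x"
      using aC by (auto simp: carrier_TL L_carrier[OF A.w])
    have "h (a \<odot>\<^bsub>L \<delta> w\<^esub> C) = rad_coset \<delta> w' (scl (A.aug (free_act \<delta> b x)) e')"
      using h[OF sA(4)[OF b(2)]] by (simp add: b L_smult[OF A.w b(2)])
    also have "\<dots> = rad_coset \<delta> w' (free_act \<delta> b (scl (A.aug x) e'))"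
      using eqB[OF se(1) sB(4)[OF se(1)]] se by (simp add: A.aug_free[OF b(2)] B.aug_free[OF se(1)])
    also have "\<dots> = a \<odot>\<^bsub>L \<delta> w'\<^esub> h C" by (simp add: b(1,3) h[OF b(2)] L_smult[OF B.w se(1)])
    finally show ?thesis .
  qed
  ultimately show ?thesis unfolding module_iso_def by blast
qed

section \<open>Isomorphism of the irreducible quotients\<close>

text \<open>
  If \<open>w\<close> had two strings, it would be equivalent to a state with neighbouring strings, and the generator
  between them would kill it. On the other side every generator acts by the nonzero scalar \<open>\<delta>\<close>.
\<close>

lemma at_most_one_string_transfer:
  assumes w: "w \<in> inf_link_states" and B: "one_dimensional \<delta> w'" and x: "word_witness \<delta> w w' x'" and nt: "sg w \<notin> rad \<delta> w"
  shows "at_most_one_string w"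
proof (rule ccontr)
  interpret B: one_dimensional \<delta> w' by fact
  assume "\<not> at_most_one_string w"
  then obtain K where K: "2 \<le> strs 0 K w" unfolding at_most_one_string_iff by (metis not_less_eq_eq one_add_one plus_1_eq_Suc)
  obtain n where n: "K \<le> n" "closed_ivl 0 n w" using closed_cofinal[OF w] by blast
  obtain c p where c: "reach 0 n w c" "canon 0 n p c" using reach_canon[OF w n(2)] by auto
  have fc: "fits w n c" using reach_props[OF c(1) w n(2)] by auto
  have "n - 2 * p = strs 0 n w" using canon_strs[OF c(2)] fc by simp
  then have np: "2 * p + 2 \<le> n" using K strs_mono[OF n(1), of w] by simp
  then have "2 * p \<le> n - 2" "n - 2 < n" "Suc (n - 2) < n" by simp_all
  then have top: "both_strings (n - 2) c" using c(2) by (simp add: canon_def both_strings_def)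
  obtain r where r: "wact r w = Some (0, c)" using reach_word[OF c(1)] by blast
  have ar: "act \<delta> r (sg w) = sg c" using act_wact[OF w, of \<delta> r] r by simp
  have cl: "c \<in> inf_link_states" using fc by simp
  have "act \<delta> ((n - 2) # r) (sg w) = act \<delta> [n - 2] (sg c)" using ar by (simp add: act_Cons)
  also have "\<dots> = 0" using top cl by (simp add: act_Cons e_link_weight weight_def)
  finally have "act \<delta> ((n - 2) # r) (sg w) \<in> rad \<delta> w" using subrepD(2)[OF subrep_rad[OF w]] by simp
  then have "act \<delta> ((n - 2) # r) x' \<in> rad \<delta> w'" using x unfolding word_witness_def by blast
  moreover have xs: "x' \<in> eq_span w'" using x by (simp add: word_witness_def)
  ultimately have "B.aug x' = 0" using B.rad_iff_aug[OF act_span[OF B.w xs]] B.aug_act[OF xs] B.delta_square by simp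
  then have "act \<delta> r x' \<in> rad \<delta> w'" using B.rad_iff_aug[OF act_span[OF B.w xs]] B.aug_act[OF xs] by simp
  then have "sg c \<in> rad \<delta> w" using x ar unfolding word_witness_def by metis
  then show False using state_notin_rad[OF w nt fits_sim[OF w n(2) fc]] by blast
qed

text \<open>
  If both states have only finitely many cups that the other lacks, their tails agree and the numbers of
  strings bound each other. If not, \<open>infinite_difference\<close> applies in one direction, and
  \<open>at_most_one_string_transfer\<close> gives the statement about the other state.
\<close>

lemma L_iso_iff:
  assumes w: "w \<in> inf_link_states" "w' \<in> inf_link_states"
    and nt: "sg w \<notin> rad \<delta> w" "sg w' \<notin> rad \<delta> w'"
  shows "module_iso (TL \<delta>) (L \<delta> w) (L \<delta> w') \<longleftrightarrow> sim w w' \<or> (\<delta>\<^sup>2 = 1 \<and> at_most_one_string w \<and> at_most_one_string w')"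
proof
  assume iso: "module_iso (TL \<delta>) (L \<delta> w) (L \<delta> w')"
  obtain x where x: "word_witness \<delta> w w' x" by (rule L_iso_word_witness[OF w iso])
  obtain y where y: "word_witness \<delta> w' w y" by (rule L_iso_word_witness[OF w(2,1) L_iso_sym[OF w iso]])
  have od: "one_dimensional \<delta> z" if "z \<in> inf_link_states" "sg z \<notin> rad \<delta> z" "\<delta>\<^sup>2 = 1" "at_most_one_string z" for z
    using that by unfold_locales
  consider "\<forall>N. \<exists>i\<ge>N. i < w i \<and> w' i \<noteq> w i" | "\<forall>N. \<exists>i\<ge>N. i < w' i \<and> w i \<noteq> w' i"
    | N M where "\<forall>i\<ge>N. i < w i \<longrightarrow> w' i = w i" "\<forall>i\<ge>M. i < w' i \<longrightarrow> w i = w' i" by blast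
  then show "sim w w' \<or> (\<delta>\<^sup>2 = 1 \<and> at_most_one_string w \<and> at_most_one_string w')"
  proof cases
    case 1
    then have "\<delta>\<^sup>2 = 1 \<and> at_most_one_string w'" by (rule infinite_difference[OF w x nt])
    then show ?thesis using at_most_one_string_transfer[OF w(1) od x nt(1)] w nt by blast
  next
    case 2
    then have "\<delta>\<^sup>2 = 1 \<and> at_most_one_string w" by (rule infinite_difference[OF w(2,1) y nt(2,1)])
    then show ?thesis using at_most_one_string_transfer[OF w(2) od y nt(2)] w nt by blast
  next
    case 3
    have "w' i = w i" if "max N M \<le> i" "i < w i" for i using 3(1) that by simp
    moreover have "w i = w' i" if "max N M \<le> i" "i < w' i" for i using 3(2) that by simp
    ultimately have "\<exists>K. \<forall>i\<ge>K. w i = w' i" using agree_tail[OF w, of "max N M"] by metis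
    then obtain K where K: "\<And>i. K \<le> i \<Longrightarrow> w i = w' i" by blast
    have "sim w w'"
    proof (rule sim_from_tail[OF w])
      show "w i = w' i" if "K \<le> i" for i using K that by blast
      show "strs 0 n w' = strs 0 n w" if "K \<le> n" "closed_ivl 0 n w" "closed_ivl 0 n w'" for n
        using witness_strings[OF w x nt _ that(2,3)] witness_strings[OF w(2,1) y nt(2,1) _ that(3,2)] K that(1)
        by (intro antisym) simp_all
    qed
    then show ?thesis by blast
  qed
next
  assume "sim w w' \<or> (\<delta>\<^sup>2 = 1 \<and> at_most_one_string w \<and> at_most_one_string w')"
  then show "module_iso (TL \<delta>) (L \<delta> w) (L \<delta> w')"
  proof
    assume s: "sim w w'"
    then have "sim w' u \<longleftrightarrow> sim w u" for u using sim_trans w sim_sym by metis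
    then have "eq_span w' = eq_span w" by (simp add: eq_span_def)
    then have X: "X \<delta> w' = X \<delta> w"
      using X_simps(1)[OF w(1), of \<delta>] X_simps(1)[OF w(2), of \<delta>] by (simp add: X_def)
    then have "L \<delta> w' = L \<delta> w" by (simp add: L_def inf_radical_def)
    then show ?thesis using module_iso_refl by metis
  next
    assume "\<delta>\<^sup>2 = 1 \<and> at_most_one_string w \<and> at_most_one_string w'"
    then show ?thesis by (intro one_dimensional_iso; unfold_locales) (use w nt in auto)
  qed
qed

text \<open>
  With \<open>t = q\<^sup>2\<close> one has \<open>t (\<delta>\<^sup>2 - 1) = t\<^sup>2 + t + 1\<close>, so \<open>\<delta>\<^sup>2 = 1\<close> says that \<open>t\<close> is a primitive third root of unity.
\<close>

lemma delta_sq_iff: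
  fixes q \<delta> :: complex
  assumes q: "q \<noteq> 0" "\<delta> = q + inverse q"
    and l: "(\<exists>k>0. q ^ k = 1) \<Longrightarrow> l = (LEAST k. 0 < k \<and> q ^ (2 * k) = 1)"
  shows "\<delta>\<^sup>2 = 1 \<longleftrightarrow> (\<exists>k>0. q ^ k = 1) \<and> l = 3"
proof -
  define t where "t = q\<^sup>2"
  have t0: "t \<noteq> 0" using q(1) by (simp add: t_def)
  have qk: "q ^ (2 * k) = t ^ k" for k by (simp add: t_def power_mult)
  have "q * \<delta> = t + 1" using q by (simp add: t_def power2_eq_square distrib_left)
  then have "t * \<delta>\<^sup>2 = (t + 1)\<^sup>2" unfolding t_def by (metis power_mult_distrib)
  then have "t * (\<delta>\<^sup>2 - 1) = t\<^sup>2 + t + 1" by (simp add: algebra_simps power2_eq_square)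
  then have eq: "\<delta>\<^sup>2 = 1 \<longleftrightarrow> t\<^sup>2 + t + 1 = 0" using t0 by auto
  have cube: "t ^ 3 - 1 = (t - 1) * (t\<^sup>2 + t + 1)" by (simp add: algebra_simps power2_eq_square power3_eq_cube)
  show ?thesis
  proof
    assume "\<delta>\<^sup>2 = 1"
    then have s: "t\<^sup>2 + t + 1 = 0" using eq by simp
    then have t3: "t ^ 3 = 1" using cube by simp
    have t1: "t \<noteq> 1" using s by auto
    have t2: "t\<^sup>2 \<noteq> 1"
    proof
      assume "t\<^sup>2 = 1"
      then have "t ^ 3 = t" by (simp add: power3_eq_cube power2_eq_square)
      then show False using t3 t1 by simp
    qed
    have "q ^ 6 = 1" using qk[of 3] t3 by simp
    then have ex: "\<exists>k>0. q ^ k = 1" by (intro exI[of _ 6]) simp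
    have "(LEAST k. 0 < k \<and> q ^ (2 * k) = 1) = 3"
      unfolding qk
    proof (rule Least_equality)
      show "0 < (3::nat) \<and> t ^ 3 = 1" using t3 by simp
      fix k assume k: "0 < k \<and> t ^ k = 1"
      show "3 \<le> k"
      proof (rule ccontr)
        assume "\<not> 3 \<le> k"
        then have "k = 1 \<or> k = 2" using k by linarith
        then show False using k t1 t2 by auto
      qed
    qed
    then show "(\<exists>k>0. q ^ k = 1) \<and> l = 3" using l ex by simp
  next
    assume a: "(\<exists>k>0. q ^ k = 1) \<and> l = 3"
    then obtain k where "0 < k" "q ^ k = 1" by blast
    then have k: "0 < k \<and> t ^ k = 1" by (simp add: t_def power_mult[symmetric] mult.commute[of 2] power_mult)
    have L: "3 = (LEAST k. 0 < k \<and> t ^ k = 1)" using a l by (simp add: qk)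
    have "0 < (3::nat) \<and> t ^ 3 = 1" unfolding L by (rule LeastI[of _ k]) (rule k)
    moreover have "t \<noteq> 1" using not_less_Least[of 1 "\<lambda>k. 0 < k \<and> t ^ k = 1"] L by auto
    ultimately have "t\<^sup>2 + t + 1 = 0" using cube by simp
    then show "\<delta>\<^sup>2 = 1" using eq by simp
  qed
qed

theorem theorem3p3:
  fixes q \<delta> :: complex and l :: nat and w w' :: inf_link
  assumes "q \<noteq> 0"
    and "\<delta> = q + inverse q"
    and "(\<exists>k>0. q ^ k = 1) \<Longrightarrow> l = (LEAST k. 0 < k \<and> q ^ (2 * k) = 1)"
    and "w \<in> inf_link_states" and "w' \<in> inf_link_states"
  shows "(module_iso (TL \<delta>) (X \<delta> w) (X \<delta> w') \<longleftrightarrow> link_equiv w w') \<and>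
    (carrier (L \<delta> w) \<noteq> {\<zero>\<^bsub>L \<delta> w\<^esub>} \<and> carrier (L \<delta> w') \<noteq> {\<zero>\<^bsub>L \<delta> w'\<^esub>} \<longrightarrow>
      (module_iso (TL \<delta>) (L \<delta> w) (L \<delta> w') \<longleftrightarrow>
        link_equiv w w' \<or>
        ((\<exists>k>0. q ^ k = 1) \<and> l = 3 \<and> num_strings w \<in> {0, 1} \<and> num_strings w' \<in> {0, 1})))"
proof (intro conjI impI)
  note w = assms(4,5)
  have delta: "\<delta>\<^sup>2 = 1 \<longleftrightarrow> (\<exists>k>0. q ^ k = 1) \<and> l = 3"
    by (rule delta_sq_iff[OF assms(1,2)]) (rule assms(3))
  show "module_iso (TL \<delta>) (X \<delta> w) (X \<delta> w') \<longleftrightarrow> link_equiv w w'"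
    unfolding X_iso_iff[OF w] link_equiv_iff_sim[OF w] ..
  assume "carrier (L \<delta> w) \<noteq> {\<zero>\<^bsub>L \<delta> w\<^esub>} \<and> carrier (L \<delta> w') \<noteq> {\<zero>\<^bsub>L \<delta> w'\<^esub>}"
  then have nt: "sg w \<notin> rad \<delta> w" "sg w' \<notin> rad \<delta> w'" using L_nontrivial w by auto
  show "module_iso (TL \<delta>) (L \<delta> w) (L \<delta> w') \<longleftrightarrow>
        link_equiv w w' \<or>
        ((\<exists>k>0. q ^ k = 1) \<and> l = 3 \<and> num_strings w \<in> {0, 1} \<and> num_strings w' \<in> {0, 1})"
    unfolding L_iso_iff[OF w nt] link_equiv_iff_sim[OF w] num_strings_at_most_one_string delta
    by (simp only: conj_assoc)
qed

end
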